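(* Let $n \in \mathbb{N}$ be such that $n\geq 4$ and $n \not\equiv 0 \pmod 4$. Let $k\in\{2,n-3\}$, denote by $j(k)$ the number of isomorphism classes of $\mathbb{Z}$-forms of the Specht $\mathbb{Q}\mathfrak{S}_n$-module $S_{\mathbb{Q}}^{(n-k, 1^k)}$, and denote by $d(n)$ the number of divisors of $n$ in $\mathbb{N}$. (a) If $n \geq 5$ is odd, then $j(k) = 3 d(n)$. (b) If $n \equiv 2 \pmod 4$, then $j(k) = 2 d(n)$.
   Context: $\mathfrak{S}_n$ is the symmetric group of degree $n$; $\mathbb{N}$ is the set of positive integers. For a finite group $G$, a $\mathbb{Z}G$-lattice is a left $\mathbb{Z}G$-module that is finitely generated and free over $\mathbb{Z}$; a $\mathbb{Z}$-form of a finitely generated $\mathbb{Q}G$-module $V$ is a $\mathbb{Z}G$-lattice $M$ with $\mathbb{Q}\otimes_{\mathbb{Z}} M\cong V$ as $\mathbb{Q}G$-modules. Isomorphism classes of $\mathbb{Z}$-forms are taken with respect to $\mathbb{Z}G$-isomorphism. Specht modules: for a partition $\lambda$ of $n$, $M^\lambda_{\mathbb{Z}}$ is the permutation $\mathbb{Z}\mathfrak{S}_n$-lattice on the set of $\lambda$-tabloids $\{t\}$ (row-equivalence classes of $\lambda$-tableaux $t$), and $S^\lambda_{\mathbb{Z}}$ is its $\mathbb{Z}\mathfrak{S}_n$-sublattice spanned by the polytabloids $e_t=\sum_{\sigma\in C_t}\mathrm{sgn}(\sigma)\{\sigma t\}$, where $C_t$ is the column stabilizer of $t$. Moreover $S^\lambda_{\mathbb{Q}}:=\mathbb{Q}\otimes_{\mathbb{Z}}S^\lambda_{\mathbb{Z}}$.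 The partition $(n-k,1^k)$ has first part $n-k$ followed by $k$ parts equal to $1$. *)

theory Defs
  imports
    "HOL-Algebra.Algebra"
    "HOL-Algebra.Free_Abelian_Groups"
    "HOL-Algebra.Algebraic_Closure_Type"
    "HOL-Library.Infinite_Typeclass"
begin

section \<open>Modules over group rings\<close>

text \<open>
  A left module over the group ring \<open>RG\<close> is represented as an \<open>R\<close>-module together with
  an \<open>R\<close>-linear action of \<open>G\<close>.  The record type of modules inherits the fields
  \<open>mult\<close> and \<open>one\<close> from rings; they have no meaning for modules and are
  ignored throughout, in particular by isomorphisms.
\<close>

record ('r, 'm, 'g) gmodule = "('r, 'm) module" +
  act :: "'g \<Rightarrow> 'm \<Rightarrow> 'm"

definition group_ring_module ::
    "('g, 'x) monoid_scheme \<Rightarrow> 'r ring \<Rightarrow> ('r, 'm, 'g) gmodule \<Rightarrow> bool" where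
  "group_ring_module G R M \<longleftrightarrow>
     group G \<and> Module.module R M \<and>
     (\<forall>g\<in>carrier G. \<forall>x\<in>carrier M. act M g x \<in> carrier M) \<and>
     (\<forall>g\<in>carrier G. \<forall>x\<in>carrier M. \<forall>y\<in>carrier M.
        act M g (x \<oplus>\<^bsub>M\<^esub> y) = act M g x \<oplus>\<^bsub>M\<^esub> act M g y) \<and>
     (\<forall>g\<in>carrier G. \<forall>r\<in>carrier R. \<forall>x\<in>carrier M.
        act M g (r \<odot>\<^bsub>M\<^esub> x) = r \<odot>\<^bsub>M\<^esub> act M g x) \<and>
     (\<forall>x\<in>carrier M. act M \<one>\<^bsub>G\<^esub> x = x) \<and>
     (\<forall>g\<in>carrier G. \<forall>h\<in>carrier G. \<forall>x\<in>carrier M.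
        act M (g \<otimes>\<^bsub>G\<^esub> h) x = act M g (act M h x))"

definition group_ring_isomorphic ::
    "('g, 'x) monoid_scheme \<Rightarrow> 'r ring \<Rightarrow>
     ('r, 'm, 'g) gmodule \<Rightarrow> ('r, 'n, 'g) gmodule \<Rightarrow> bool" where
  "group_ring_isomorphic G R M N \<longleftrightarrow>
     (\<exists>f. bij_betw f (carrier M) (carrier N) \<and>
        (\<forall>x\<in>carrier M. \<forall>y\<in>carrier M. f (x \<oplus>\<^bsub>M\<^esub> y) = f x \<oplus>\<^bsub>N\<^esub> f y) \<and>
        (\<forall>r\<in>carrier R. \<forall>x\<in>carrier M. f (r \<odot>\<^bsub>M\<^esub> x) = r \<odot>\<^bsub>N\<^esub> f x) \<and>
        (\<forall>g\<in>carrier G. \<forall>x\<in>carrier M. f (act M g x) = act N g (f x)))"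

definition finitely_generated_free :: "'r ring \<Rightarrow> ('r, 'm, 'y) module_scheme \<Rightarrow> bool" where
  "finitely_generated_free R M \<longleftrightarrow>
     (\<exists>B. finite B \<and> B \<subseteq> carrier M \<and>
        (\<forall>x\<in>carrier M. \<exists>!c. c \<in> B \<rightarrow>\<^sub>E carrier R \<and> x = (\<Oplus>\<^bsub>M\<^esub>b\<in>B. c b \<odot>\<^bsub>M\<^esub> b)))"

definition ZG_lattice :: "('g, 'x) monoid_scheme \<Rightarrow> (int, 'm, 'g) gmodule \<Rightarrow> bool" where
  "ZG_lattice G M \<longleftrightarrow> group_ring_module G \<Z> M \<and> finitely_generated_free \<Z> M"


section \<open>Extension of scalars to the rationals\<close>

abbreviation rat_ring :: "rat ring" where
  "rat_ring \<equiv> ring_of_type_algebra"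

text \<open>
  The tensor product of the rationals with \<open>M\<close> over the integers is the free abelian group on
  the pairs \<open>(q, x)\<close> modulo the subgroup generated by the bilinearity relations.
\<close>

definition tensor_free ::
    "(int, 'm, 'y) module_scheme \<Rightarrow> ((rat \<times> 'm) \<Rightarrow>\<^sub>0 int) monoid" where
  "tensor_free M = free_Abelian_group (UNIV \<times> carrier M)"

definition tensor_relations ::
    "(int, 'm, 'y) module_scheme \<Rightarrow> ((rat \<times> 'm) \<Rightarrow>\<^sub>0 int) set" where
  "tensor_relations M = generate (tensor_free M)
     ({frag_of (p + q, x) - frag_of (p, x) - frag_of (q, x) | p q x. x \<in> carrier M} \<union>
      {frag_of (q, x \<oplus>\<^bsub>M\<^esub> y) - frag_of (q, x) - frag_of (q, y) | q x y.
         x \<in> carrier M \<and> y \<in> carrier M} \<union>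
      {frag_of (q * of_int a, x) - frag_of (q, a \<odot>\<^bsub>M\<^esub> x) | q a x. x \<in> carrier M})"

text \<open>
  A map \<open>h\<close> on pairs is extended linearly to the free abelian group and then to cosets.
  If the linear extension preserves the subgroup of relations, all cosets in the union below
  coincide, so the union is itself a coset.
\<close>

definition tensor_map ::
    "(int, 'm, 'y) module_scheme \<Rightarrow> (rat \<times> 'm \<Rightarrow> rat \<times> 'm) \<Rightarrow>
     ((rat \<times> 'm) \<Rightarrow>\<^sub>0 int) set \<Rightarrow> ((rat \<times> 'm) \<Rightarrow>\<^sub>0 int) set" where
  "tensor_map M h A =
     (\<Union>u\<in>A. tensor_relations M #>\<^bsub>tensor_free M\<^esub> frag_extend (\<lambda>z. frag_of (h z)) u)"

definition rational_tensor ::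
    "(int, 'm, 'g) gmodule \<Rightarrow> (rat, ((rat \<times> 'm) \<Rightarrow>\<^sub>0 int) set, 'g) gmodule" where
  "rational_tensor M =
     (let T = tensor_free M Mod tensor_relations M in
      \<lparr>carrier = carrier T, monoid.mult = undefined, one = undefined,
       ring.zero = \<one>\<^bsub>T\<^esub>, ring.add = (\<otimes>\<^bsub>T\<^esub>),
       module.smult = (\<lambda>r. tensor_map M (\<lambda>(q, x). (r * q, x))),
       act = (\<lambda>g. tensor_map M (\<lambda>(q, x). (q, act M g x)))\<rparr>)"


section \<open>Forms over the integers\<close>

definition Z_form ::
    "('g, 'x) monoid_scheme \<Rightarrow> (rat, 'v, 'g) gmodule \<Rightarrow> (int, 'm, 'g) gmodule \<Rightarrow> bool" where
  "Z_form G V M \<longleftrightarrow>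
     ZG_lattice G M \<and> group_ring_isomorphic G rat_ring (rational_tensor M) V"

text \<open>
  The carriers range over all subsets of a type \<open>'m\<close>.  A finitely generated abelian group
  is countable, so for every infinite \<open>'m\<close> each isomorphism class of lattices has a
  representative with carrier in \<open>'m\<close>.
\<close>

definition Z_form_classes ::
    "('g, 'x) monoid_scheme \<Rightarrow> (rat, 'v, 'g) gmodule \<Rightarrow> (int, 'm::infinite, 'g) gmodule set set" where
  "Z_form_classes G V =
     {M. Z_form G V M} //
     {(M, N). Z_form G V M \<and> Z_form G V N \<and> group_ring_isomorphic G \<Z> M N}"


section \<open>Specht modules\<close>

text \<open>
  A partition is the list of its parts; rows and columns of its diagram are numbered from 0.
\<close>

definition young_diagram :: "nat list \<Rightarrow> (nat \<times> nat) set" where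
  "young_diagram l = {(i, j). i < length l \<and> j < l ! i}"

definition row :: "nat list \<Rightarrow> nat \<Rightarrow> (nat \<times> nat) set" where
  "row l i = {c \<in> young_diagram l. fst c = i}"

definition column :: "nat list \<Rightarrow> nat \<Rightarrow> (nat \<times> nat) set" where
  "column l j = {c \<in> young_diagram l. snd c = j}"

text \<open>
  Tableaux take the value 0 outside the diagram.  Permutations of \<open>{1..n}\<close> fix 0, so the
  symmetric group acts on tableaux by composition.
\<close>

definition tableaux :: "nat list \<Rightarrow> (nat \<times> nat \<Rightarrow> nat) set" where
  "tableaux l =
     {t. bij_betw t (young_diagram l) {1..sum_list l} \<and> (\<forall>c. c \<notin> young_diagram l \<longrightarrow> t c = 0)}"

definition tabloid :: "nat list \<Rightarrow> (nat \<times> nat \<Rightarrow> nat) \<Rightarrow> (nat \<times> nat \<Rightarrow> nat) set" where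
  "tabloid l t = {s \<in> tableaux l. \<forall>i. s ` row l i = t ` row l i}"

definition tabloids :: "nat list \<Rightarrow> (nat \<times> nat \<Rightarrow> nat) set set" where
  "tabloids l = tabloid l ` tableaux l"

definition column_stabilizer :: "nat list \<Rightarrow> (nat \<times> nat \<Rightarrow> nat) \<Rightarrow> (nat \<Rightarrow> nat) set" where
  "column_stabilizer l t =
     {\<sigma> \<in> carrier (sym_group (sum_list l)). \<forall>j. \<sigma> ` (t ` column l j) = t ` column l j}"

text \<open>
  An element of the permutation lattice is given by its coefficients with respect to the
  tabloids.  The coefficient of a tabloid \<open>T\<close> in \<open>\<sigma> f\<close> is the one of
  \<open>\<sigma>\<^sup>-\<^sup>1 T\<close> in \<open>f\<close>.
\<close>

definition permutation_lattice ::
    "nat list \<Rightarrow> (int, (nat \<times> nat \<Rightarrow> nat) set \<Rightarrow> int, nat \<Rightarrow> nat) gmodule" where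
  "permutation_lattice l =
     \<lparr>carrier = {f. \<forall>T. T \<notin> tabloids l \<longrightarrow> f T = 0},
      monoid.mult = undefined, one = undefined,
      ring.zero = (\<lambda>T. 0), ring.add = (\<lambda>f g T. f T + g T),
      module.smult = (\<lambda>a f T. a * f T),
      act = (\<lambda>\<sigma> f T. f ((\<lambda>t. inv\<^bsub>sym_group (sum_list l)\<^esub> \<sigma> \<circ> t) ` T))\<rparr>"

definition polytabloid ::
    "nat list \<Rightarrow> (nat \<times> nat \<Rightarrow> nat) \<Rightarrow> (nat \<times> nat \<Rightarrow> nat) set \<Rightarrow> int" where
  "polytabloid l t =
     (\<lambda>T. \<Sum>\<sigma>\<in>column_stabilizer l t. sign \<sigma> * (if T = tabloid l (\<sigma> \<circ> t) then 1 else 0))"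

definition specht_Z ::
    "nat list \<Rightarrow> (int, (nat \<times> nat \<Rightarrow> nat) set \<Rightarrow> int, nat \<Rightarrow> nat) gmodule" where
  "specht_Z l = (permutation_lattice l)
     \<lparr>carrier := {(\<lambda>T. \<Sum>t\<in>tableaux l. c t * polytabloid l t T) | c. True}\<rparr>"

abbreviation specht_Q where
  "specht_Q l \<equiv> rational_tensor (specht_Z l)"

definition hook_partition :: "nat \<Rightarrow> nat \<Rightarrow> nat list" where
  "hook_partition n k = (n - k) # replicate k 1"

end

theory Submission
  imports Defs "HOL-Library.Function_Algebras"
begin

text \<open>
  Let \<open>W\<close> be the space of rational flows on the complete graph with vertices \<open>1, \<dots>, n\<close>.  The Specht
  lattice of \<open>(n-2, 1, 1)\<close> is the lattice \<open>L0\<close> of integral flows, and the one of \<open>(3, 1, \<dots>, 1)\<close> embeds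
  into \<open>W\<close> after twisting with the sign character.  By Schur's lemma, the integral forms correspond to the invariant full
  lattices in \<open>W\<close> up to scaling.  For suitable transpositions, \<open>(1 - (a c)) (1 - (b d))\<close> maps a flow
  to a multiple of a 4-cycle, so a lattice can be scaled uniquely to lie between the span \<open>M1\<close>
  of the 4-cycles and the dual \<open>Mst\<close> of \<open>M1\<close>.  In between,
  \<open>L0\<close> has index 2 over \<open>M1\<close>, its dual \<open>P\<close> has index 2 in \<open>Mst\<close>, and the invariant
  submodules of \<open>P / L0\<close> are its multiples by the divisors of \<open>n\<close>.  The divisor \<open>e\<close> belonging to a
  lattice is the denominator of the differences \<open>x (a, c) - x (b, c)\<close>, its level.  For odd \<open>e\<close>, the lattice
  is determined by its intersection with the lattice \<open>H0\<close> of level 1, which can be \<open>M1\<close>, \<open>L0\<close>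
  or \<open>H0\<close>, where \<open>H0 \<noteq> L0\<close> if and only if \<open>n\<close> is odd.  If \<open>e\<close> is even and \<open>n\<close> is 2 modulo 4, the
  lattice contains \<open>L0\<close>, and there is one such lattice inside \<open>P\<close> and one outside.
\<close>

section \<open>Subgroups of rational function spaces\<close>

text \<open>Twisting by a character with values 1 and -1 leaves the invariant subgroups unchanged,
  so both partitions lead to the same lattices. Divisors of \<open>n\<close> appear because an entry
  of a flow is recovered from its triangle sums only up to the factor \<open>n\<close>
  (\<open>sum_tri_sum\<close>). A flow splits into its commutators with the transpositions at one
  vertex and a remainder, and a commutator with \<open>(a b)\<close> is, modulo \<open>L0\<close>, a
  multiple of \<open>fan a b\<close>; so a lattice is controlled by its level and by what it
  contains of \<open>H0\<close>. The obstacle is the prime 2, at which \<open>M1\<close>,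
  \<open>L0\<close> and \<open>H0\<close> differ. At odd level \<open>e\<close> a factor 4 is lost
  on the way and regained because 4 and \<open>e\<close> are coprime. At even level there is no such
  pair. Instead \<open>L0\<close> is forced into the lattice: three fans around a triangle, divided
  by \<open>e\<close>, add up to \<open>n / e\<close> times the triangle, and \<open>n / e\<close>
  is odd. This is where 4 must not divide \<open>n\<close>.\<close>

definition zsubmodule :: "'a::ab_group_add set \<Rightarrow> bool" where
  "zsubmodule L \<longleftrightarrow> 0 \<in> L \<and> (\<forall>x\<in>L. \<forall>y\<in>L. x - y \<in> L)"

definition scale :: "rat \<Rightarrow> ('i \<Rightarrow> rat) \<Rightarrow> 'i \<Rightarrow> rat" where
  "scale c x = (\<lambda>i. c * x i)"

lemma scale_apply [simp]: "scale c x i = c * x i"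
  by (simp add: scale_def)

lemma scale_simps [simp]:
  "scale 0 x = 0" "scale 1 x = x" "scale c 0 = 0" "scale c (scale d x) = scale (c * d) x"
  by (auto simp: fun_eq_iff)

lemma scale_distrib:
  "scale c (x + y) = scale c x + scale c y" "scale c (x - y) = scale c x - scale c y"
  "scale (c + d) x = scale c x + scale d x" "scale (c - d) x = scale c x - scale d x"
  "scale (- c) x = - scale c x" "scale c (- x) = - scale c x"
  by (auto simp: fun_eq_iff algebra_simps)

lemma sum_fun_apply: "(\<Sum>i\<in>A. f i) x = (\<Sum>i\<in>A. f i x)"
  by (induction A rule: infinite_finite_induct) auto

lemma scale_sum: "scale c (\<Sum>i\<in>A. f i) = (\<Sum>i\<in>A. scale c (f i))"
  by (simp add: fun_eq_iff sum_fun_apply sum_distrib_left)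

lemma scale_eq_iff: "c \<noteq> 0 \<Longrightarrow> scale c x = y \<longleftrightarrow> x = scale (1/c) y"
  by (auto simp: fun_eq_iff field_simps)

lemma zsubmodule_0: "zsubmodule L \<Longrightarrow> 0 \<in> L"
  and zsubmodule_diff: "zsubmodule L \<Longrightarrow> x \<in> L \<Longrightarrow> y \<in> L \<Longrightarrow> x - y \<in> L"
  by (auto simp: zsubmodule_def)

lemma zsubmodule_minus: "zsubmodule L \<Longrightarrow> x \<in> L \<Longrightarrow> - x \<in> L"
  by (metis diff_0 zsubmodule_0 zsubmodule_diff)

lemma zsubmodule_add: "zsubmodule L \<Longrightarrow> x \<in> L \<Longrightarrow> y \<in> L \<Longrightarrow> x + y \<in> L"
  by (metis diff_minus_eq_add zsubmodule_diff zsubmodule_minus)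

lemma zsubmodule_sum: "zsubmodule L \<Longrightarrow> (\<And>i. i \<in> A \<Longrightarrow> f i \<in> L) \<Longrightarrow> (\<Sum>i\<in>A. f i) \<in> L"
  by (induction A rule: infinite_finite_induct) (auto intro: zsubmodule_0 zsubmodule_add)

lemma zsubmodule_scale_nat: "zsubmodule L \<Longrightarrow> x \<in> L \<Longrightarrow> scale (of_nat k) x \<in> L"
  by (induction k) (auto simp: scale_distrib zsubmodule_0 intro: zsubmodule_add)

lemma zsubmodule_scale_int: "zsubmodule L \<Longrightarrow> x \<in> L \<Longrightarrow> scale (of_int k) x \<in> L"
  by (cases k rule: int_cases2)
    (auto simp: scale_distrib zsubmodule_scale_nat intro: zsubmodule_minus)

lemma zsubmodule_scale: "zsubmodule L \<Longrightarrow> x \<in> L \<Longrightarrow> c \<in> \<int> \<Longrightarrow> scale c x \<in> L"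
  by (auto elim!: Ints_cases intro: zsubmodule_scale_int)

lemma zsubmodule_Int: "zsubmodule L \<Longrightarrow> zsubmodule K \<Longrightarrow> zsubmodule (L \<inter> K)"
  by (auto simp: zsubmodule_def)

lemma zsubmodule_image:
  assumes L: "zsubmodule L" and diff: "\<And>x y. f (x - y) = f x - f y"
  shows "zsubmodule (f ` L)"
  unfolding zsubmodule_def
proof (intro conjI ballI)
  have "f 0 = 0" using diff[of 0 0] by simp
  then show "0 \<in> f ` L" using zsubmodule_0[OF L] by (metis imageI)
  fix a b assume "a \<in> f ` L" "b \<in> f ` L"
  then obtain x y where xy: "x \<in> L" "a = f x" "y \<in> L" "b = f y" by blast
  then have "a - b = f (x - y)" by (simp add: diff)
  then show "a - b \<in> f ` L" using zsubmodule_diff[OF L xy(1,3)] by (rule image_eqI)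
qed

lemma zsubmodule_Ints: "zsubmodule (\<int> :: 'a::ring_1 set)"
  by (auto simp: zsubmodule_def)

text \<open>Bezout. It is applied to 4 or 2, which come from the indices between \<open>M1\<close>
  and \<open>H0\<close>, together with an odd number.\<close>

lemma zsubmodule_scale_coprime:
  assumes L: "zsubmodule L" and x: "scale (of_int a) x \<in> L" "scale (of_int b) x \<in> L"
    and "coprime a b"
  shows "x \<in> L"
proof -
  obtain s t where st: "s * a + t * b = 1"
    using \<open>coprime a b\<close> bezout_int[of a b] by auto
  have "scale (of_int s) (scale (of_int a) x) + scale (of_int t) (scale (of_int b) x) \<in> L"
    by (intro zsubmodule_add zsubmodule_scale_int L x)
  also have "scale (of_int s) (scale (of_int a) x) + scale (of_int t) (scale (of_int b) x)
      = scale (of_int (s * a + t * b)) x"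
    by (simp add: scale_distrib)
  finally show ?thesis by (simp add: st)
qed

lemma zsubmodule_int_principal:
  assumes S: "zsubmodule (S :: int set)"
  obtains g where "g \<ge> 0" "S = range (\<lambda>k. g * k)"
proof (cases "S = {0}")
  case True
  then show ?thesis by (intro that[of 0]) auto
next
  case False
  then obtain x where x: "x \<in> S" "x \<noteq> 0"
    using zsubmodule_0[OF S] by auto
  define m where "m = (LEAST m::nat. m > 0 \<and> int m \<in> S)"
  have mul: "k * y \<in> S" if "y \<in> S" for k y :: int
  proof -
    have "int m * y \<in> S" for m
      by (induction m) (auto simp: algebra_simps zsubmodule_0[OF S] intro: zsubmodule_add[OF S] that)
    then show ?thesis
      by (cases k rule: int_cases2) (auto dest: zsubmodule_minus[OF S])
  qed
  have "nat \<bar>x\<bar> > 0 \<and> int (nat \<bar>x\<bar>) \<in> S"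
    using x zsubmodule_minus[OF S x(1)] by (auto simp: abs_if)
  then have "m > 0 \<and> int m \<in> S"
    unfolding m_def by (rule LeastI)
  then have m: "m > 0" "int m \<in> S" by auto
  have least: "m \<le> k" if "k > 0" "int k \<in> S" for k
    unfolding m_def using that by (intro Least_le) auto
  have "y \<in> range (\<lambda>k. int m * k)" if y: "y \<in> S" for y
  proof -
    have "y mod int m = y - (y div int m) * int m"
      by (simp add: minus_div_mult_eq_mod)
    then have r: "y mod int m \<in> S"
      using zsubmodule_diff[OF S y mul[OF m(2)]] by simp
    have "nat (y mod int m) < m" using m(1) by (simp add: nat_less_iff)
    moreover have "int (nat (y mod int m)) = y mod int m" using m(1) by simp
    ultimately have "y mod int m = 0"
      using least[of "nat (y mod int m)"] r by fastforce
    then show ?thesis by (auto simp: dvd_def mod_eq_0_iff_dvd)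
  qed
  moreover have "int m * k \<in> S" for k
    using mul[OF m(2), of k] by (simp add: mult.commute)
  ultimately show ?thesis
    by (intro that[of "int m"]) auto
qed

text \<open>The common denominator \<open>N\<close> embeds the subgroup into the integers. Without
  such a bound a subgroup of the rationals need not be cyclic; \<open>g = 0\<close> stands for the
  trivial one.\<close>

lemma zsubmodule_rat_principal:
  fixes S :: "rat set" and N :: nat
  assumes S: "zsubmodule S" and N: "N > 0" "\<And>x. x \<in> S \<Longrightarrow> of_nat N * x \<in> \<int>"
  obtains g where "g \<ge> 0" "S = range (\<lambda>k. g * of_int k)"
proof -
  define S' where "S' = {k. of_int k / of_nat N \<in> S}"
  have "zsubmodule S'"
    using zsubmodule_0[OF S] zsubmodule_diff[OF S]
    by (auto simp: zsubmodule_def S'_def diff_divide_distrib)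
  then obtain g where g: "g \<ge> 0" "S' = range (\<lambda>k. g * k)"
    by (rule zsubmodule_int_principal)
  have "x \<in> range (\<lambda>k. of_int g / of_nat N * of_int k)" if x: "x \<in> S" for x
  proof -
    obtain k where k: "of_nat N * x = of_int k"
      using N(2)[OF x] by (elim Ints_cases)
    then have "x = of_int k / of_nat N"
      using N(1) by (simp add: field_simps)
    with x have "k \<in> S'" by (simp add: S'_def)
    then obtain j where "k = g * j" using g(2) by auto
    with \<open>x = of_int k / of_nat N\<close> show ?thesis by auto
  qed
  moreover have "of_int g / of_nat N * of_int k \<in> S" for k
  proof -
    have "g * k \<in> S'" using g(2) by auto
    then show ?thesis by (simp add: S'_def)
  qed
  ultimately show ?thesis
    using g(1) by (intro that[of "of_int g / of_nat N"]) auto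
qed

text \<open>Multiple transitivity of the symmetric group. It carries statements about fixed tuples
  such as 1, 2, 3, 4 to all tuples of distinct vertices.\<close>

lemma exists_permutes_map:
  assumes "distinct xs" "distinct ys" "length xs = length ys" "set xs \<subseteq> V" "set ys \<subseteq> V"
  shows "\<exists>p. p permutes V \<and> map p xs = ys"
  using assms
proof (induction xs ys rule: list_induct2')
  case 1
  then show ?case by (auto intro: permutes_id)
next
  case (4 x xs y ys)
  then obtain p where p: "p permutes V" "map p xs = ys" by auto
  \<comment> \<open>The transposition corrects the image of \<open>x\<close>; it fixes
    \<open>ys\<close> because neither \<open>p x\<close> nor \<open>y\<close> occurs there.\<close>
  let ?q = "transpose (p x) y \<circ> p"
  have xy: "x \<in> V" "y \<in> V" "x \<notin> set xs" "y \<notin> set ys" using 4(2-6) by auto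
  have px: "p x \<in> V" using p(1) xy(1) by (simp add: permutes_in_image)
  have "set ys = p ` set xs" using p(2) by auto
  then have nin: "p x \<notin> set ys"
    using xy(3) permutes_inj[OF p(1)] by (simp add: inj_image_mem_iff)
  have "?q permutes V"
    by (intro permutes_compose[OF p(1)] permutes_swap_id px xy)
  moreover have "map ?q (x # xs) = y # ys"
  proof -
    have "map (transpose (p x) y) ys = ys"
      using nin xy(4) by (intro map_idI) (auto simp: transpose_def)
    then have "map ?q xs = ys" using p(2) by (metis map_map)
    then show ?thesis by (simp only: list.map o_apply transpose_apply_first)
  qed
  ultimately show ?case by (intro exI[of _ ?q] conjI)
qed auto

text \<open>
  Modulo \<open>G\<close>, one vertex of a triangle may be exchanged for another one.  With a fourth vertex at
  hand, exchanges produce an odd permutation of the triangle, which changes the sign of \<open>f\<close>.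
\<close>

lemma triangle_class:
  fixes f :: "'v \<Rightarrow> 'v \<Rightarrow> 'v \<Rightarrow> 'a::ab_group_add"
  assumes V: "card V \<ge> 4" and G: "zsubmodule G"
    and rot: "\<And>a b c. f b c a = f a b c" and alt: "\<And>a b c. f b a c = - f a b c"
    and quad: "\<And>a b c d. distinct [a, b, c, d] \<Longrightarrow> {a, b, c, d} \<subseteq> V \<Longrightarrow> f a b c + f a c d \<in> G"
    and abc: "distinct [a, b, c]" "{a, b, c} \<subseteq> V"
  shows "f a b c + f a b c \<in> G"
    and "distinct [p, q, r] \<Longrightarrow> {p, q, r} \<subseteq> V \<Longrightarrow> f a b c - f p q r \<in> G"
proof -
  define R where "R x y \<longleftrightarrow> x - y \<in> G" for x y
  have refl: "R x x" for x using zsubmodule_0[OF G] by (simp add: R_def)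
  have sym: "R x y \<Longrightarrow> R y x" for x y
    using zsubmodule_minus[OF G, of "x - y"] by (simp add: R_def)
  have trans: "R x y \<Longrightarrow> R y z \<Longrightarrow> R x z" for x y z
    using zsubmodule_add[OF G, of "x - y" "y - z"] by (simp add: R_def)
  have repl2: "R (f a b c) (f a d c)" if "distinct [a, b, c]" "distinct [a, d, c]" "{a, b, c, d} \<subseteq> V" for a b c d
  proof (cases "b = d")
    case False
    then have "f a b c + f a c d \<in> G" using that by (intro quad) auto
    moreover have "f a c d = - f a d c" using alt[of d a c] unfolding rot[of c d a] rot[of a c d] by simp
    ultimately show ?thesis by (simp add: R_def)
  qed (simp add: refl)
  have repl3: "R (f a b c) (f a b d)" if "distinct [a, b, c]" "distinct [a, b, d]" "{a, b, c, d} \<subseteq> V" for a b c d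
    using repl2[of b c a d] that unfolding rot[of b c a] rot[of b d a] by auto
  have repl1: "R (f a b c) (f d b c)" if "distinct [a, b, c]" "distinct [d, b, c]" "{a, b, c, d} \<subseteq> V" for a b c d
    using repl2[of c a b d] that unfolding rot[of a b c] rot[of d b c] by auto
  have swap: "R (f a b c) (f b a c)" if abc: "distinct [a, b, c]" "{a, b, c} \<subseteq> V" for a b c
  proof -
    have "card {a, b, c} < card V" using V abc by auto
    then have "\<not> V \<subseteq> {a, b, c}" by (metis card_mono finite.emptyI finite_insert leD)
    then obtain d where d: "d \<in> V" "d \<notin> {a, b, c}" by blast
    have "R (f a b c) (f d b c)" using abc d by (intro repl1) auto
    moreover have "R (f d b c) (f d a c)" using abc d by (intro repl2) auto
    moreover have "R (f d a c) (f b a c)" using abc d by (intro repl1) auto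
    ultimately show ?thesis using trans by blast
  qed
  show "f a b c + f a b c \<in> G"
    using swap[OF abc] alt[of b a c] by (simp add: R_def)
  assume pqr: "distinct [p, q, r]" "{p, q, r} \<subseteq> V"
  have sw23: "R (f a b c) (f a c b)" if "distinct [a, b, c]" "{a, b, c} \<subseteq> V" for a b c
    using swap[of b c a] that unfolding rot[of b c a] rot[of c b a] by auto
  \<comment> \<open>\<open>p\<close> is brought to the first place and then \<open>q\<close> to the
    second. A vertex of the triangle in the wrong place needs a rotation or an odd permutation, a
    new vertex a single exchange.\<close>
  have step1: "\<exists>b' c'. distinct [p, b', c'] \<and> {p, b', c'} \<subseteq> V \<and> R (f a b c) (f p b' c')"
  proof -
    consider "p = a" | "p = b" | "p = c" | "p \<notin> {a, b, c}" by blast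
    then show ?thesis
    proof cases
      case 1 then show ?thesis using abc refl by blast
    next
      case 2
      have "distinct [p, a, c]" "{p, a, c} \<subseteq> V" using 2 abc by auto
      then show ?thesis using swap[OF abc] 2 by blast
    next
      case 3
      have "distinct [p, a, b]" "{p, a, b} \<subseteq> V" using 3 abc by auto
      then show ?thesis using 3 rot[of a b c] refl[of "f a b c"] by auto
    next
      case 4
      have "distinct [p, b, c]" "{p, b, c} \<subseteq> V" using 4 abc pqr by auto
      then show ?thesis using repl1[of a b c p] abc 4 pqr by auto
    qed
  qed
  then obtain b' c' where bc: "distinct [p, b', c']" "{p, b', c'} \<subseteq> V" "R (f a b c) (f p b' c')"
    by blast
  have "\<exists>c''. distinct [p, q, c''] \<and> {p, q, c''} \<subseteq> V \<and> R (f p b' c') (f p q c'')"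
  proof -
    consider "q = b'" | "q = c'" | "q \<notin> {b', c'}" by blast
    then show ?thesis
    proof cases
      case 1 then show ?thesis using bc refl by blast
    next
      case 2
      have "distinct [p, q, b']" "{p, q, b'} \<subseteq> V" using 2 bc by auto
      then show ?thesis using sw23[OF bc(1,2)] 2 by blast
    next
      case 3
      have "distinct [p, q, c']" "{p, q, c'} \<subseteq> V" using 3 bc pqr by auto
      then show ?thesis using repl2[of p b' c' q] bc 3 pqr by auto
    qed
  qed
  then obtain c'' where c: "distinct [p, q, c'']" "{p, q, c''} \<subseteq> V" "R (f p b' c') (f p q c'')"
    by blast
  have "R (f p q c'') (f p q r)" using c pqr by (intro repl3) auto
  then show "f a b c - f p q r \<in> G"
    using bc(3) c(3) trans unfolding R_def[symmetric] by blast
qed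

section \<open>Flows on the complete graph\<close>

text \<open>This is a right action and needs no inverse. For the invariance of a set the side does
  not matter; the left action of the group ring is \<open>twisted\<close>.\<close>

definition pull :: "('v \<Rightarrow> 'v) \<Rightarrow> ('v \<times> 'v \<Rightarrow> rat) \<Rightarrow> 'v \<times> 'v \<Rightarrow> rat" where
  "pull p x = (\<lambda>(a, b). x (p a, p b))"

lemma pull_apply [simp]: "pull p x (a, b) = x (p a, p b)"
  by (simp add: pull_def)

lemma pull_simps [simp]: "pull id x = x" "pull p 0 = 0" "pull p (pull q x) = pull (q \<circ> p) x"
  by (auto simp: fun_eq_iff)

lemma pull_linear:
  "pull p (x + y) = pull p x + pull p y" "pull p (x - y) = pull p x - pull p y"
  "pull p (scale c x) = scale c (pull p x)" "pull p (\<Sum>i\<in>A. f i) = (\<Sum>i\<in>A. pull p (f i))"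
  by (auto simp: fun_eq_iff sum_fun_apply)

definition arc :: "'v \<Rightarrow> 'v \<Rightarrow> 'v \<times> 'v \<Rightarrow> rat" where
  "arc a b = (\<lambda>i. of_bool (i = (a, b)) - of_bool (i = (b, a)))"

definition tri :: "'v \<Rightarrow> 'v \<Rightarrow> 'v \<Rightarrow> 'v \<times> 'v \<Rightarrow> rat" where
  "tri a b c = arc a b + arc b c + arc c a"

definition quad :: "'v \<Rightarrow> 'v \<Rightarrow> 'v \<Rightarrow> 'v \<Rightarrow> 'v \<times> 'v \<Rightarrow> rat" where
  "quad a b c d = arc a b + arc b c + arc c d + arc d a"

definition tri_sum :: "('v \<times> 'v \<Rightarrow> rat) \<Rightarrow> 'v \<Rightarrow> 'v \<Rightarrow> 'v \<Rightarrow> rat" where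
  "tri_sum x a b c = x (a, b) + x (b, c) + x (c, a)"

definition quad_sum :: "('v \<times> 'v \<Rightarrow> rat) \<Rightarrow> 'v \<Rightarrow> 'v \<Rightarrow> 'v \<Rightarrow> 'v \<Rightarrow> rat" where
  "quad_sum x a b c d = x (a, b) + x (b, c) + x (c, d) + x (d, a)"

lemma arc_swap: "arc b a = - arc a b"
  by (auto simp: arc_def fun_eq_iff)

lemma arc_self [simp]: "arc a a = 0"
  by (auto simp: arc_def fun_eq_iff)

lemma quad_eq_tri: "quad a b c d = tri a b c + tri a c d"
  by (simp add: quad_def tri_def arc_swap[of a c])

lemma tri_rot: "tri b c a = tri a b c"
  by (simp only: tri_def ac_simps)

lemma tri_swap: "tri b a c = - tri a b c"
  by (simp only: tri_def arc_swap[of b a] arc_swap[of a c] arc_swap[of c b] minus_add_distrib ac_simps)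

lemma pull_arc:
  assumes "p permutes S"
  shows "pull p (arc a b) = arc (inv_into UNIV p a) (inv_into UNIV p b)"
proof -
  have eq: "x = inv_into UNIV p y \<longleftrightarrow> p x = y" for x y
    using permutes_inv_eq[OF assms, of y x] by metis
  show ?thesis
  proof (rule ext, clarify)
    show "pull p (arc a b) (i, j) = arc (inv_into UNIV p a) (inv_into UNIV p b) (i, j)" for i j
      unfolding pull_apply arc_def prod.inject eq ..
  qed
qed

lemma pull_tri:
  assumes "p permutes S"
  shows "pull p (tri a b c) = tri (inv_into UNIV p a) (inv_into UNIV p b) (inv_into UNIV p c)"
  by (simp add: tri_def pull_linear pull_arc[OF assms])

lemma pull_quad:
  assumes "p permutes S"
  shows "pull p (quad a b c d)
    = quad (inv_into UNIV p a) (inv_into UNIV p b) (inv_into UNIV p c) (inv_into UNIV p d)"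
  by (simp add: quad_def pull_linear pull_arc[OF assms])

section \<open>Integers and half-integers\<close>

definition half_Ints :: "rat set" where
  "half_Ints = {x. x - 1/2 \<in> \<int>}"

lemma half_cases:
  assumes "2 * x \<in> \<int>"
  shows "(x :: rat) \<in> \<int> \<or> x \<in> half_Ints"
proof -
  obtain k where k: "2 * x = of_int k"
    using assms by (elim Ints_cases)
  show ?thesis
  proof (cases "even k")
    case True
    then obtain j where "k = 2 * j" by (elim evenE)
    with k show ?thesis by simp
  next
    case False
    then obtain j where "k = 2 * j + 1" by (elim oddE)
    with k have "x - 1/2 = of_int j" by simp
    then show ?thesis by (simp add: half_Ints_def algebra_simps)
  qed
qed

lemma Ints_half_odd: "odd k \<Longrightarrow> (of_int k / 2 :: rat) \<notin> \<int>"
proof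
  assume k: "odd k" "(of_int k / 2 :: rat) \<in> \<int>"
  then obtain j where "(of_int k / 2 :: rat) = of_int j" by (elim Ints_cases)
  then have "(of_int k :: rat) = of_int (2 * j)" by simp
  then have "k = 2 * j" by (simp only: of_int_eq_iff)
  with k show False by simp
qed

lemma Ints_half_even: "even k \<Longrightarrow> (of_int k / 2 :: rat) \<in> \<int>"
  by (auto elim!: evenE)

lemma half_not_Int: "x \<in> half_Ints \<Longrightarrow> x \<notin> \<int>"
proof
  assume "x \<in> half_Ints" "x \<in> \<int>"
  then have "x - (x - 1/2) \<in> \<int>"
    unfolding half_Ints_def by (metis Ints_diff mem_Collect_eq)
  then show False using Ints_half_odd[of 1] by simp
qed

lemma half_odd_mult: "x \<in> half_Ints \<Longrightarrow> odd k \<Longrightarrow> of_int k * x \<in> half_Ints"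
proof -
  assume x: "x \<in> half_Ints" and "odd k"
  then obtain j where "k = 2 * j + 1" by (elim oddE)
  then have "of_int k * x - 1/2 = of_int k * (x - 1/2) + of_int j"
    by (simp add: algebra_simps)
  also have "\<dots> \<in> \<int>" using x by (auto simp: half_Ints_def)
  finally show ?thesis by (simp add: half_Ints_def)
qed

lemma half_diff: "x \<in> half_Ints \<Longrightarrow> y \<in> half_Ints \<Longrightarrow> x - y \<in> \<int>"
  unfolding half_Ints_def using Ints_diff[of "x - 1/2" "y - 1/2"] by simp

lemma half_add_Int: "x \<in> half_Ints \<Longrightarrow> y \<in> \<int> \<Longrightarrow> x + y \<in> half_Ints"
  unfolding half_Ints_def using Ints_add[of "x - 1/2" y] by (simp add: algebra_simps)

lemma half_minus: "x \<in> half_Ints \<Longrightarrow> - x \<in> half_Ints"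
proof -
  assume "x \<in> half_Ints"
  then have "x - 1/2 \<in> \<int>" by (simp add: half_Ints_def)
  then have "- (x - 1/2) - 1 \<in> \<int>" by (rule Ints_diff[OF Ints_minus Ints_1])
  then show ?thesis by (simp add: half_Ints_def algebra_simps)
qed

section \<open>The space of flows\<close>

locale flows =
  fixes n :: nat
  \<comment> \<open>The witnesses \<open>quad 1 3 4 5\<close> and \<open>quad 1 2 5 3\<close> use
    five vertices; the theorem excludes \<open>n = 4\<close> because 4 does not divide
    \<open>n\<close>.\<close>
  assumes n_ge: "5 \<le> n"
begin

definition V :: "nat set" where "V = {1..n}"

lemma finite_V [simp]: "finite V" and card_V [simp]: "card V = n"
  by (simp_all add: V_def)

lemma V_small [simp]: "1 \<in> V" "2 \<in> V" "3 \<in> V" "4 \<in> V" "5 \<in> V"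
  using n_ge by (simp_all add: V_def)

lemma V_Suc_0 [simp]: "Suc 0 \<in> V"
  using V_small(1) by simp

text \<open>\<open>x (a, b)\<close> is the flow along the arc from \<open>a\<close> to \<open>b\<close>; nothing accumulates at a vertex.\<close>

definition W :: "(nat \<times> nat \<Rightarrow> rat) set" where
  "W = {x. (\<forall>a b. x (b, a) = - x (a, b)) \<and> (\<forall>a b. a \<notin> V \<longrightarrow> x (a, b) = 0) \<and>
           (\<forall>a. (\<Sum>b\<in>V. x (a, b)) = 0)}"

definition invariant :: "(nat \<times> nat \<Rightarrow> rat) set \<Rightarrow> bool" where
  "invariant L \<longleftrightarrow> (\<forall>p x. p permutes V \<longrightarrow> x \<in> L \<longrightarrow> pull p x \<in> L)"

lemma invariantD: "invariant L \<Longrightarrow> p permutes V \<Longrightarrow> x \<in> L \<Longrightarrow> pull p x \<in> L"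
  by (auto simp: invariant_def)

lemma W_anti: "x \<in> W \<Longrightarrow> x (b, a) = - x (a, b)"
  and W_out: "x \<in> W \<Longrightarrow> a \<notin> V \<Longrightarrow> x (a, b) = 0"
  and W_row: "x \<in> W \<Longrightarrow> (\<Sum>b\<in>V. x (a, b)) = 0"
  unfolding W_def by blast+

lemma W_I:
  assumes "\<And>a b. x (b, a) = - x (a, b)" "\<And>a b. a \<notin> V \<Longrightarrow> x (a, b) = 0" "\<And>a. (\<Sum>b\<in>V. x (a, b)) = 0"
  shows "x \<in> W"
  unfolding W_def using assms by blast

lemma W_diag: "x \<in> W \<Longrightarrow> x (a, a) = 0"
  using W_anti[of x a a] by simp

lemma W_out': "x \<in> W \<Longrightarrow> b \<notin> V \<Longrightarrow> x (a, b) = 0"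
  using W_anti[of x a b] W_out[of x b a] by simp

lemma W_zsubmodule: "zsubmodule W"
  unfolding zsubmodule_def
proof (intro conjI ballI)
  show "0 \<in> W" by (rule W_I) simp_all
  fix x y assume x: "x \<in> W" and y: "y \<in> W"
  show "x - y \<in> W"
  proof (rule W_I)
    show "(x - y) (b, a) = - (x - y) (a, b)" for a b
      by (simp add: W_anti[OF x, of b a] W_anti[OF y, of b a])
  qed (use x y in \<open>simp_all add: W_out W_row sum_subtractf\<close>)
qed

lemma W_scale:
  assumes x: "x \<in> W"
  shows "scale c x \<in> W"
proof (rule W_I)
  show "scale c x (b, a) = - scale c x (a, b)" for a b
    by (simp add: W_anti[OF x, of b a])
qed (simp_all add: W_out[OF x] W_row[OF x] sum_distrib_left[symmetric])

lemma permutes_V: "p permutes V \<Longrightarrow> p a \<in> V \<longleftrightarrow> a \<in> V"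
  by (rule permutes_in_image)

lemma W_invariant: "invariant W"
  unfolding invariant_def
proof (intro allI impI)
  fix p x assume p: "p permutes V" and x: "x \<in> W"
  have "(\<Sum>b\<in>V. x (p a, p b)) = (\<Sum>b\<in>V. x (p a, b))" for a
    by (rule sum.reindex_bij_betw[OF permutes_imp_bij[OF p]])
  then have "(\<Sum>b\<in>V. pull p x (a, b)) = 0" for a
    by (simp only: pull_apply W_row[OF x])
  moreover have "pull p x (b, a) = - pull p x (a, b)" for a b
    by (simp add: W_anti[OF x, of "p b" "p a"])
  moreover have "pull p x (a, b) = 0" if "a \<notin> V" for a b
    using that by (simp add: W_out[OF x] permutes_V[OF p])
  ultimately show "pull p x \<in> W"
    by (rule W_I[rotated 2])
qed

text \<open>Antisymmetry gives the entries below the diagonal, and the vanishing row sums give those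
  at \<open>v\<close>.\<close>

lemma W_eqI:
  assumes x: "x \<in> W" and y: "y \<in> W"
    and eq: "\<And>i j. i < j \<Longrightarrow> i \<in> V - {v} \<Longrightarrow> j \<in> V - {v} \<Longrightarrow> x (i, j) = y (i, j)"
  shows "x = y"
proof -
  have eq': "x (i, j) = y (i, j)" if "i \<in> V - {v}" "j \<noteq> v" for i j
  proof (cases "j \<in> V")
    case j: True
    show ?thesis
    proof (cases i j rule: linorder_cases)
      case less
      then show ?thesis using eq[of i j] that j by simp
    next
      case equal
      then show ?thesis using x y by (simp add: W_diag)
    next
      case greater
      then have "x (j, i) = y (j, i)" using eq[of j i] that j by simp
      then show ?thesis using W_anti[OF x, of i j] W_anti[OF y, of i j] by simp
    qed
  qed (use x y in \<open>simp add: W_out'\<close>)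
  have eqv: "x (i, v) = y (i, v)" if "i \<noteq> v" for i
  proof (cases "i \<in> V \<and> v \<in> V")
    case True
    have "(\<Sum>b\<in>V. z (i, b)) = z (i, v) + (\<Sum>b\<in>V - {v}. z (i, b))" for z :: "nat \<times> nat \<Rightarrow> rat"
      using True by (intro sum.remove) auto
    moreover have "(\<Sum>b\<in>V - {v}. x (i, b)) = (\<Sum>b\<in>V - {v}. y (i, b))"
      using True that by (intro sum.cong) (auto intro: eq')
    ultimately show ?thesis
      using W_row[OF x, of i] W_row[OF y, of i] by simp
  qed (use x y in \<open>auto simp: W_out W_out'\<close>)
  show ?thesis
  proof (rule ext, clarify)
    fix i j
    consider "i \<notin> V" | "i \<in> V" "j = v" "i \<noteq> v" | "i = v" "j = v" | "i \<in> V - {v}" "j \<noteq> v" | "i = v" "j \<noteq> v"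
      by auto
    then show "x (i, j) = y (i, j)"
    proof cases
      case 5
      then show ?thesis using eqv[of j] W_anti[OF x, of i j] W_anti[OF y, of i j] by simp
    qed (use x y eq' eqv in \<open>auto simp: W_out W_diag\<close>)
  qed
qed

lemma arc_row:
  assumes "a \<in> V" "b \<in> V"
  shows "(\<Sum>j\<in>V. arc a b (i, j)) = of_bool (i = a) - of_bool (i = b)"
proof -
  have "(\<Sum>j\<in>V. of_bool ((i, j) = (x, y)) :: rat) = of_bool (i = x)" if "y \<in> V" for x y
    using that by (simp add: of_bool_def)
  then show ?thesis
    using assms by (simp add: arc_def sum_subtractf del: prod.inject)
qed

lemma tri_in_W:
  assumes "{a, b, c} \<subseteq> V"
  shows "tri a b c \<in> W"
proof -
  have anti: "arc x y (j, i) = - arc x y (i, j)" for x y i j :: nat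
    by (simp add: arc_def conj_commute)
  have out: "arc x y (i, j) = 0" if "x \<in> V" "y \<in> V" "i \<notin> V" for x y i j
  proof -
    have "i \<noteq> x" "i \<noteq> y" using that by blast+
    then show ?thesis by (simp add: arc_def)
  qed
  show ?thesis
  proof (rule W_I)
    show "tri a b c (j, i) = - tri a b c (i, j)" for i j
      by (simp add: tri_def anti[of _ _ j i])
    show "tri a b c (i, j) = 0" if "i \<notin> V" for i j
      using assms that by (simp add: tri_def out)
    show "(\<Sum>j\<in>V. tri a b c (i, j)) = 0" for i
      using assms by (simp add: tri_def sum.distrib arc_row)
  qed
qed

section \<open>The integral flows and their generators\<close>

definition L0 :: "(nat \<times> nat \<Rightarrow> rat) set" where
  "L0 = {x \<in> W. \<forall>i. x i \<in> \<int>}"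

lemma L0_zsubmodule: "zsubmodule L0"
  using W_zsubmodule by (auto simp: zsubmodule_def L0_def)

lemma L0_invariant: "invariant L0"
  using W_invariant by (auto simp: invariant_def L0_def pull_def)

lemma arc_Ints: "arc a b i \<in> \<int>"
  by (simp add: arc_def)

lemma tri_in_L0: "{a, b, c} \<subseteq> V \<Longrightarrow> tri a b c \<in> L0"
  by (simp add: L0_def tri_in_W) (simp add: tri_def arc_Ints)

text \<open>Away from vertex 1, \<open>tri 1 a b\<close> is the single arc from \<open>a\<close> to
  \<open>b\<close>, so the entries of \<open>x\<close> are its coefficients in these
  triangles.\<close>

lemma L0_generated:
  assumes K: "zsubmodule K"
    and tri: "\<And>a b c. distinct [a, b, c] \<Longrightarrow> {a, b, c} \<subseteq> V \<Longrightarrow> tri a b c \<in> K"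
  shows "L0 \<subseteq> K"
proof
  fix x assume x: "x \<in> L0"
  let ?A = "{(a, b). a \<in> V \<and> b \<in> V \<and> a < b \<and> a \<noteq> 1 \<and> b \<noteq> 1}"
  let ?y = "\<Sum>(a, b)\<in>?A. scale (x (a, b)) (tri 1 a b)"
  have fin: "finite ?A" by (rule finite_subset[of _ "V \<times> V"]) auto
  have xW: "x \<in> W" using x by (simp add: L0_def)
  note V1 = V_small(1)
  have yW: "?y \<in> W"
    by (intro zsubmodule_sum W_zsubmodule) (use V1 in \<open>auto intro!: W_scale tri_in_W\<close>)
  have "x = ?y"
  proof (rule W_eqI[OF xW yW, of 1])
    fix i j assume ij: "i < j" "i \<in> V - {1}" "j \<in> V - {1}"
    have t: "tri 1 a b (i, j) = of_bool ((a, b) = (i, j))" if "a < b" for a b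
      using ij that by (auto simp: tri_def arc_def)
    have "?y (i, j) = (\<Sum>z\<in>?A. if z = (i, j) then x z else 0)"
      unfolding sum_fun_apply by (rule sum.cong) (use t in \<open>fastforce+\<close>)
    also have "\<dots> = x (i, j)"
      using fin ij by simp
    finally show "x (i, j) = ?y (i, j)" ..
  qed
  also have "?y \<in> K"
  proof (intro zsubmodule_sum K, clarify)
    fix a b assume "a \<in> V" "b \<in> V" "a < b" "a \<noteq> 1" "b \<noteq> 1"
    then show "scale (x (a, b)) (tri 1 a b) \<in> K"
      using x V1 by (intro zsubmodule_scale K tri) (auto simp: L0_def)
  qed
  finally show "x \<in> K" .
qed

lemma multiple_in_L0:
  assumes x: "x \<in> W"
  obtains N :: nat where "N > 0" "scale (of_nat N) x \<in> L0"
proof -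
  define N where "N = (\<Prod>i\<in>V \<times> V. nat (snd (quotient_of (x i))))"
  have pos: "nat (snd (quotient_of q)) > 0" for q
    using quotient_of_denom_pos'[of q] by simp
  have "of_nat N * x i \<in> \<int>" for i
  proof (cases "i \<in> V \<times> V")
    case True
    then have "N = nat (snd (quotient_of (x i))) * (\<Prod>i\<in>V \<times> V - {i}. nat (snd (quotient_of (x i))))"
      unfolding N_def by (intro prod.remove) auto
    moreover have "x i = of_int (fst (quotient_of (x i))) / of_int (snd (quotient_of (x i)))"
      by (metis quotient_of_div surjective_pairing)
    then have "of_nat (nat (snd (quotient_of (x i)))) * x i = of_int (fst (quotient_of (x i)))"
      using quotient_of_denom_pos'[of "x i"] by (simp add: field_simps)
    ultimately have "of_nat N * x i
        = of_nat (\<Prod>i\<in>V \<times> V - {i}. nat (snd (quotient_of (x i)))) * of_int (fst (quotient_of (x i)))"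
      by (simp add: mult.commute mult.left_commute)
    also have "\<dots> \<in> \<int>" by (intro Ints_mult Ints_of_nat Ints_of_int)
    finally show ?thesis .
  next
    case False
    then have "x i = 0" using x by (cases i) (auto simp: W_out W_out')
    then show ?thesis by simp
  qed
  moreover have "N > 0" unfolding N_def using pos by (intro prod_pos) auto
  ultimately show ?thesis
    by (intro that[of N]) (auto simp: L0_def intro: W_scale[OF x])
qed

section \<open>The sublattice of index two spanned by the 4-cycles\<close>

definition parity :: "(nat \<times> nat \<Rightarrow> rat) \<Rightarrow> rat" where
  "parity x = (\<Sum>i\<in>{(a, b). a \<in> V \<and> b \<in> V \<and> a < b}. x i)"

lemma parity_linear:
  "parity (x + y) = parity x + parity y" "parity (x - y) = parity x - parity y"
  "parity (scale c x) = c * parity x"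
  by (simp_all add: parity_def sum.distrib sum_subtractf sum_distrib_left)

lemma parity_arc:
  assumes "a \<in> V" "b \<in> V" "a \<noteq> b"
  shows "parity (arc a b) = (if a < b then 1 else - 1)"
proof -
  let ?A = "{(a, b). a \<in> V \<and> b \<in> V \<and> a < b}"
  have fin: "finite ?A" by (rule finite_subset[of _ "V \<times> V"]) auto
  have "(\<Sum>i\<in>?A. of_bool (i = z) :: rat) = of_bool (z \<in> ?A)" for z
    using fin by (simp add: of_bool_def)
  then show ?thesis
    using assms unfolding parity_def arc_def by (auto simp: sum_subtractf)
qed

lemma parity_tri:
  assumes "distinct [a, b, c]" "{a, b, c} \<subseteq> V"
  obtains k where "odd k" "parity (tri a b c) = of_int k"
proof -
  let ?s = "\<lambda>a b. if a < b then 1 else - 1 :: int"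
  have "parity (tri a b c) = of_int (?s a b + ?s b c + ?s c a)"
    using assms by (simp add: tri_def parity_linear parity_arc)
  moreover have "odd (?s a b + ?s b c + ?s c a)" by simp
  ultimately show ?thesis using that by blast
qed

lemma parity_Ints: "x \<in> L0 \<Longrightarrow> parity x \<in> \<int>"
  by (auto simp: parity_def L0_def intro: zsubmodule_sum[OF zsubmodule_Ints])

text \<open>Modulo 2, \<open>parity\<close> counts the arcs of an integral flow with their
  multiplicities, since reversing an arc only changes a sign. So triangles are odd and 4-cycles are
  even.\<close>

definition M1 :: "(nat \<times> nat \<Rightarrow> rat) set" where
  "M1 = {x \<in> L0. parity x / 2 \<in> \<int>}"

lemma M1_subset_L0: "M1 \<subseteq> L0"
  by (auto simp: M1_def)

lemma M1_zsubmodule: "zsubmodule M1"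
  unfolding zsubmodule_def
proof (intro conjI ballI)
  show "0 \<in> M1" using zsubmodule_0[OF L0_zsubmodule] by (simp add: M1_def parity_def)
  fix x y assume xy: "x \<in> M1" "y \<in> M1"
  then have "parity x / 2 - parity y / 2 \<in> \<int>"
    unfolding M1_def by (intro Ints_diff) auto
  then show "x - y \<in> M1"
    using xy zsubmodule_diff[OF L0_zsubmodule]
    by (auto simp: M1_def parity_linear diff_divide_distrib)
qed

lemma tri_not_in_M1:
  assumes "distinct [a, b, c]" "{a, b, c} \<subseteq> V"
  shows "tri a b c \<notin> M1"
  by (rule parity_tri[OF assms]) (auto simp: M1_def dest: Ints_half_odd)

lemma L0_mod_M1:
  assumes x: "x \<in> L0" and y: "y \<in> L0" "y \<notin> M1"
  shows "x \<in> M1 \<or> x - y \<in> M1"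
proof -
  obtain k where k: "parity x = of_int k" using parity_Ints[OF x] by (elim Ints_cases)
  obtain l where l: "parity y = of_int l" using parity_Ints[OF y(1)] by (elim Ints_cases)
  have "odd l" using y l Ints_half_even[of l] by (auto simp: M1_def)
  moreover have "x - y \<in> L0" using x y(1) by (rule zsubmodule_diff[OF L0_zsubmodule])
  moreover have "parity (x - y) = of_int (k - l)" by (simp add: parity_linear k l)
  ultimately show ?thesis
    using x k Ints_half_even[of k] Ints_half_even[of "k - l"] unfolding M1_def
    by (cases "even k") auto
qed

text \<open>\<open>M1\<close> has index two in \<open>L0\<close>, so no subgroup lies strictly
  between them.\<close>

lemma L0_subset_if:
  assumes K: "zsubmodule K" "M1 \<subseteq> K" and y: "y \<in> K" "y \<in> L0" "y \<notin> M1"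
  shows "L0 \<subseteq> K"
proof
  fix x assume "x \<in> L0"
  then have "x \<in> M1 \<or> x - y \<in> M1" using y by (intro L0_mod_M1)
  then show "x \<in> K"
    using K(2) y(1) zsubmodule_add[OF K(1), of "x - y" y] by auto
qed

lemma double_L0_M1: "x \<in> L0 \<Longrightarrow> scale 2 x \<in> M1"
  using zsubmodule_scale_int[OF L0_zsubmodule, of x 2] parity_Ints[of x]
  by (simp add: M1_def parity_linear)

lemma quad_in_M1:
  assumes "distinct [a, b, c, d]" "{a, b, c, d} \<subseteq> V"
  shows "quad a b c d \<in> M1"
proof -
  have 1: "distinct [a, b, c]" "{a, b, c} \<subseteq> V" and 2: "distinct [a, c, d]" "{a, c, d} \<subseteq> V"
    using assms by auto
  obtain k where k: "odd k" "parity (tri a b c) = of_int k" by (rule parity_tri[OF 1])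
  obtain l where l: "odd l" "parity (tri a c d) = of_int l" by (rule parity_tri[OF 2])
  have "quad a b c d \<in> L0"
    unfolding quad_eq_tri using 1 2 by (intro zsubmodule_add L0_zsubmodule tri_in_L0)
  moreover have "parity (quad a b c d) = of_int (k + l)"
    by (simp add: quad_eq_tri parity_linear k l)
  ultimately show ?thesis
    using k l Ints_half_even[of "k + l"] by (simp add: M1_def)
qed

text \<open>Modulo the intersection of \<open>K\<close> and \<open>M1\<close>, all triangles agree
  and have order at most 2 by \<open>triangle_class\<close>. Hence \<open>L0\<close> is the union of
  this subgroup and its coset of \<open>?t\<close>; as \<open>?t\<close> is odd, that coset misses
  \<open>M1\<close>.\<close>

lemma M1_generated:
  assumes K: "zsubmodule K"
    and quad: "\<And>a b c d. distinct [a, b, c, d] \<Longrightarrow> {a, b, c, d} \<subseteq> V \<Longrightarrow> quad a b c d \<in> K"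
  shows "M1 \<subseteq> K"
proof
  fix x assume x: "x \<in> M1"
  let ?C = "K \<inter> M1"
  have C: "zsubmodule ?C" using K M1_zsubmodule by (rule zsubmodule_Int)
  have cV: "card V \<ge> 4" using n_ge by simp
  have t: "distinct [1, 2, 3 :: nat]" "{1, 2, 3} \<subseteq> V" by simp_all
  let ?t = "tri 1 2 3"
  have qC: "tri a b c + tri a c d \<in> ?C" if "distinct [a, b, c, d]" "{a, b, c, d} \<subseteq> V" for a b c d
    using quad[OF that] quad_in_M1[OF that] by (simp add: quad_eq_tri)
  note cls = triangle_class[OF cV C, of tri, OF tri_rot tri_swap qC]
  have 2: "?t + ?t \<in> ?C"
    by (rule cls(1)) (use t in auto)
  let ?D = "{x. x \<in> ?C \<or> x - ?t \<in> ?C}"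
  have "zsubmodule ?D"
    unfolding zsubmodule_def
  proof (intro conjI ballI)
    show "0 \<in> ?D" using zsubmodule_0[OF C] by simp
    fix x y assume xy: "x \<in> ?D" "y \<in> ?D"
    have e: "x - y - ?t = (x - ?t) - y" "x - y = (x - ?t) - (y - ?t)"
      "x - y - ?t = x - (y - ?t) - (?t + ?t)" by simp_all
    show "x - y \<in> ?D"
      using xy zsubmodule_diff[OF C] 2 e by (metis (mono_tags, lifting) mem_Collect_eq)
  qed
  then have "L0 \<subseteq> ?D"
  proof (rule L0_generated)
    fix a b c assume abc: "distinct [a, b, c]" "{a, b, c} \<subseteq> V"
    have "tri a b c - ?t \<in> ?C" by (rule cls(2)[OF _ _ abc t]) 
    then show "tri a b c \<in> ?D" by simp
  qed
  then have "x \<in> ?C \<or> x - ?t \<in> ?C" using x M1_subset_L0 by auto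
  moreover have "?t \<notin> M1" using t by (rule tri_not_in_M1)
  moreover have "?t \<in> M1" if "x - ?t \<in> M1"
    using zsubmodule_diff[OF M1_zsubmodule x that] by simp
  ultimately show "x \<in> K" by blast
qed

text \<open>\<open>parity\<close> refers to the order of the vertices, so invariance is read off
  from the generators instead: permutations map 4-cycles to 4-cycles.\<close>

lemma M1_invariant: "invariant M1"
  unfolding invariant_def
proof (intro allI impI)
  fix p x assume p: "p permutes V" and x: "x \<in> M1"
  have "zsubmodule {x. pull p x \<in> M1}"
    using M1_zsubmodule by (auto simp: zsubmodule_def pull_linear)
  then have "M1 \<subseteq> {x. pull p x \<in> M1}"
  proof (rule M1_generated)
    fix a b c d assume abcd: "distinct [a, b, c, d]" "{a, b, c, d} \<subseteq> V"
    let ?q = "inv_into UNIV p"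
    have q: "?q permutes V" using p by (rule permutes_inv)
    have "distinct [?q a, ?q b, ?q c, ?q d]" "{?q a, ?q b, ?q c, ?q d} \<subseteq> V"
      using abcd permutes_V[OF q] permutes_inj[OF q] by (auto simp: inj_eq)
    then show "quad a b c d \<in> {x. pull p x \<in> M1}"
      by (simp add: pull_quad[OF p] quad_in_M1)
  qed
  with x show "pull p x \<in> M1" by auto
qed

text \<open>The left side changes sign under each of the two transpositions, so an entry survives
  only at a pair that meets both \<open>{a, c}\<close> and \<open>{b, d}\<close>. These pairs are
  the edges of the 4-cycle, and the signs leave one free value on them.\<close>

lemma quad_symmetrizer:
  assumes x: "x \<in> W" and abcd: "distinct [a, b, c, d]"
  shows "x - pull (transpose a c) x - pull (transpose b d) x
      + pull (transpose a c \<circ> transpose b d) x = scale (quad_sum x a b c d) (quad a b c d)"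
proof (rule ext, clarify)
  fix i j
  have anti: "x (b, a) = - x (a, b)" "x (c, b) = - x (b, c)" "x (d, c) = - x (c, d)" "x (a, d) = - x (d, a)"
    "x (c, a) = - x (a, c)" "x (d, b) = - x (b, d)"
    by (simp_all only: W_anti[OF x, of b a] W_anti[OF x, of c b] W_anti[OF x, of d c]
        W_anti[OF x, of a d] W_anti[OF x, of c a] W_anti[OF x, of d b])
  have diag: "x (k, k) = 0" for k by (rule W_diag[OF x])
  have dist: "a \<noteq> b" "a \<noteq> c" "a \<noteq> d" "b \<noteq> c" "b \<noteq> d" "c \<noteq> d"
    "b \<noteq> a" "c \<noteq> a" "d \<noteq> a" "c \<noteq> b" "d \<noteq> b" "d \<noteq> c"
    using abcd by auto
  have cases: "k = a \<or> k = b \<or> k = c \<or> k = d \<or> k \<notin> {a, b, c, d}" for k by blast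
  show "(x - pull (transpose a c) x - pull (transpose b d) x
      + pull (transpose a c \<circ> transpose b d) x) (i, j) = scale (quad_sum x a b c d) (quad a b c d) (i, j)"
    using cases[of i] cases[of j]
    by (elim disjE) (simp_all add: transpose_def anti diag dist quad_def arc_def quad_sum_def)
qed

text \<open>
  For the standard pairing of flows, \<open>P\<close> is dual to \<open>L0\<close>, which is spanned by the triangles, and
  \<open>Mst\<close> is dual to \<open>M1\<close>, which is spanned by the 4-cycles.
\<close>

definition Mst :: "(nat \<times> nat \<Rightarrow> rat) set" where
  "Mst = {x \<in> W. \<forall>a b c d. distinct [a, b, c, d] \<longrightarrow> {a, b, c, d} \<subseteq> V \<longrightarrow> quad_sum x a b c d \<in> \<int>}"

definition P :: "(nat \<times> nat \<Rightarrow> rat) set" where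
  "P = {x \<in> W. \<forall>a b c. distinct [a, b, c] \<longrightarrow> {a, b, c} \<subseteq> V \<longrightarrow> tri_sum x a b c \<in> \<int>}"

text \<open>By \<open>H0_iff\<close>, these are the flows whose entries off the diagonal are all
  integers or all half-integers. The form chosen here uses the differences that define the
  level.\<close>

definition H0 :: "(nat \<times> nat \<Rightarrow> rat) set" where
  "H0 = {x \<in> Mst. \<forall>a b c. distinct [a, b, c] \<longrightarrow> {a, b, c} \<subseteq> V \<longrightarrow> x (a, c) - x (b, c) \<in> \<int>}"

lemma MstD: "x \<in> Mst \<Longrightarrow> distinct [a, b, c, d] \<Longrightarrow> {a, b, c, d} \<subseteq> V \<Longrightarrow> quad_sum x a b c d \<in> \<int>"
  unfolding Mst_def by blast

lemma PD: "x \<in> P \<Longrightarrow> distinct [a, b, c] \<Longrightarrow> {a, b, c} \<subseteq> V \<Longrightarrow> tri_sum x a b c \<in> \<int>"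
  unfolding P_def by blast

lemma H0D: "x \<in> H0 \<Longrightarrow> distinct [a, b, c] \<Longrightarrow> {a, b, c} \<subseteq> V \<Longrightarrow> x (a, c) - x (b, c) \<in> \<int>"
  unfolding H0_def by blast

lemma Mst_W: "x \<in> Mst \<Longrightarrow> x \<in> W" and P_W: "x \<in> P \<Longrightarrow> x \<in> W"
  and H0_Mst: "x \<in> H0 \<Longrightarrow> x \<in> Mst" and L0_W: "x \<in> L0 \<Longrightarrow> x \<in> W"
  by (simp_all add: Mst_def P_def H0_def L0_def)

lemma quad_sum_linear:
  "quad_sum (x - y) a b c d = quad_sum x a b c d - quad_sum y a b c d"
  "quad_sum (scale r x) a b c d = r * quad_sum x a b c d"
  "quad_sum 0 a b c d = 0"
  "quad_sum (pull p x) a b c d = quad_sum x (p a) (p b) (p c) (p d)"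
  by (simp_all add: quad_sum_def algebra_simps)

lemma tri_sum_linear:
  "tri_sum (x - y) a b c = tri_sum x a b c - tri_sum y a b c"
  "tri_sum (scale r x) a b c = r * tri_sum x a b c"
  "tri_sum 0 a b c = 0"
  "tri_sum (pull p x) a b c = tri_sum x (p a) (p b) (p c)"
  by (simp_all add: tri_sum_def algebra_simps)

lemma permutes_distinct:
  assumes p: "p permutes V"
  shows "distinct (map p xs) \<longleftrightarrow> distinct xs" "p ` A \<subseteq> V \<longleftrightarrow> A \<subseteq> V"
  using permutes_inj[OF p] permutes_V[OF p]
  by (auto simp: distinct_map intro: inj_on_subset)

lemma permutes_distinct3:
  assumes p: "p permutes V" and abc: "distinct [a, b, c]" "{a, b, c} \<subseteq> V"
  shows "distinct [p a, p b, p c]" "{p a, p b, p c} \<subseteq> V"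
  using permutes_distinct(1)[OF p, of "[a, b, c]"] permutes_distinct(2)[OF p, of "{a, b, c}"] abc
  by simp_all

lemma permutes_distinct4:
  assumes p: "p permutes V" and abcd: "distinct [a, b, c, d]" "{a, b, c, d} \<subseteq> V"
  shows "distinct [p a, p b, p c, p d]" "{p a, p b, p c, p d} \<subseteq> V"
  using permutes_distinct(1)[OF p, of "[a, b, c, d]"] permutes_distinct(2)[OF p, of "{a, b, c, d}"] abcd
  by simp_all

lemma Mst_zsubmodule: "zsubmodule Mst"
  unfolding zsubmodule_def
proof (intro conjI ballI)
  show "0 \<in> Mst" using zsubmodule_0[OF W_zsubmodule] by (simp add: Mst_def quad_sum_linear)
  fix x y assume x: "x \<in> Mst" and y: "y \<in> Mst"
  have "quad_sum (x - y) a b c d \<in> \<int>" if "distinct [a, b, c, d]" "{a, b, c, d} \<subseteq> V" for a b c d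
    unfolding quad_sum_linear by (intro Ints_diff MstD x y that)
  moreover have "x - y \<in> W" by (intro zsubmodule_diff W_zsubmodule Mst_W x y)
  ultimately show "x - y \<in> Mst" unfolding Mst_def by blast
qed

lemma Mst_invariant: "invariant Mst"
  unfolding invariant_def
proof (intro allI impI)
  fix p x assume p: "p permutes V" and x: "x \<in> Mst"
  have "quad_sum (pull p x) a b c d \<in> \<int>" if "distinct [a, b, c, d]" "{a, b, c, d} \<subseteq> V" for a b c d
    unfolding quad_sum_linear by (intro MstD x permutes_distinct4[OF p] that)
  moreover have "pull p x \<in> W" by (intro invariantD[OF W_invariant p] Mst_W x)
  ultimately show "pull p x \<in> Mst" unfolding Mst_def by blast
qed

lemma P_zsubmodule: "zsubmodule P"
  unfolding zsubmodule_def
proof (intro conjI ballI)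
  show "0 \<in> P" using zsubmodule_0[OF W_zsubmodule] by (simp add: P_def tri_sum_linear)
  fix x y assume x: "x \<in> P" and y: "y \<in> P"
  have "tri_sum (x - y) a b c \<in> \<int>" if "distinct [a, b, c]" "{a, b, c} \<subseteq> V" for a b c
    unfolding tri_sum_linear by (intro Ints_diff PD x y that)
  moreover have "x - y \<in> W" by (intro zsubmodule_diff W_zsubmodule P_W x y)
  ultimately show "x - y \<in> P" unfolding P_def by blast
qed

lemma P_invariant: "invariant P"
  unfolding invariant_def
proof (intro allI impI)
  fix p x assume p: "p permutes V" and x: "x \<in> P"
  have "tri_sum (pull p x) a b c \<in> \<int>" if "distinct [a, b, c]" "{a, b, c} \<subseteq> V" for a b c
    unfolding tri_sum_linear by (intro PD x permutes_distinct3[OF p] that)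
  moreover have "pull p x \<in> W" by (intro invariantD[OF W_invariant p] P_W x)
  ultimately show "pull p x \<in> P" unfolding P_def by blast
qed

lemma H0_zsubmodule: "zsubmodule H0"
  unfolding zsubmodule_def
proof (intro conjI ballI)
  show "0 \<in> H0" using zsubmodule_0[OF Mst_zsubmodule] by (simp add: H0_def)
  fix x y assume x: "x \<in> H0" and y: "y \<in> H0"
  have "(x - y) (a, c) - (x - y) (b, c) \<in> \<int>" if "distinct [a, b, c]" "{a, b, c} \<subseteq> V" for a b c
    using Ints_diff[OF H0D[OF x that] H0D[OF y that]] by (simp add: algebra_simps)
  moreover have "x - y \<in> Mst" by (intro zsubmodule_diff Mst_zsubmodule H0_Mst x y)
  ultimately show "x - y \<in> H0" unfolding H0_def by blast
qed

lemma H0_invariant: "invariant H0"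
  unfolding invariant_def
proof (intro allI impI)
  fix p x assume p: "p permutes V" and x: "x \<in> H0"
  have "pull p x (a, c) - pull p x (b, c) \<in> \<int>" if "distinct [a, b, c]" "{a, b, c} \<subseteq> V" for a b c
    unfolding pull_apply by (intro H0D x permutes_distinct3[OF p] that)
  moreover have "pull p x \<in> Mst" by (intro invariantD[OF Mst_invariant p] H0_Mst x)
  ultimately show "pull p x \<in> H0" unfolding H0_def by blast
qed

section \<open>Triangle sums modulo the integers\<close>

lemma quad_sum_eq_tri_sum:
  assumes x: "x \<in> W"
  shows "quad_sum x a b c d = tri_sum x a b c + tri_sum x a c d"
  by (simp add: quad_sum_def tri_sum_def W_anti[OF x, of c a])

lemma P_subset_Mst: "P \<subseteq> Mst"
proof
  fix x assume x: "x \<in> P"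
  have "quad_sum x a b c d \<in> \<int>" if "distinct [a, b, c, d]" "{a, b, c, d} \<subseteq> V" for a b c d
    unfolding quad_sum_eq_tri_sum[OF P_W[OF x]]
    by (intro Ints_add PD x) (use that in auto)
  then show "x \<in> Mst" using P_W[OF x] unfolding Mst_def by blast
qed

lemma L0_subset_P: "L0 \<subseteq> P"
  by (auto simp: L0_def P_def tri_sum_def)

text \<open>Used with the integers as \<open>G\<close> for the elements of \<open>Mst\<close>, and
  with \<open>{0}\<close> to see that the sums around 4-cycles determine a flow.\<close>

lemma tri_sum_class:
  assumes x: "x \<in> W" and G: "zsubmodule G"
    and quad: "\<And>a b c d. distinct [a, b, c, d] \<Longrightarrow> {a, b, c, d} \<subseteq> V \<Longrightarrow> quad_sum x a b c d \<in> G"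
    and abc: "distinct [a, b, c]" "{a, b, c} \<subseteq> V"
  shows "2 * tri_sum x a b c \<in> G"
    and "distinct [p, q, r] \<Longrightarrow> {p, q, r} \<subseteq> V \<Longrightarrow> tri_sum x a b c - tri_sum x p q r \<in> G"
proof -
  have rot: "tri_sum x b c a = tri_sum x a b c" for a b c
    by (simp add: tri_sum_def)
  have alt: "tri_sum x b a c = - tri_sum x a b c" for a b c
    by (simp add: tri_sum_def W_anti[OF x, of b a] W_anti[OF x, of a c] W_anti[OF x, of c b])
  have V4: "card V \<ge> 4" using n_ge by simp
  note cls = triangle_class[OF V4 G, of "tri_sum x", OF rot alt quad[unfolded quad_sum_eq_tri_sum[OF x]] abc]
  show "2 * tri_sum x a b c \<in> G" using cls(1) unfolding mult_2 .
  show "distinct [p, q, r] \<Longrightarrow> {p, q, r} \<subseteq> V \<Longrightarrow> tri_sum x a b c - tri_sum x p q r \<in> G"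
    by (rule cls(2))
qed

text \<open>The class of the triangle sums modulo the integers is a homomorphism from
  \<open>Mst\<close> to the group of order 2, with kernel \<open>P\<close>; so \<open>P\<close> has
  index at most 2.\<close>

lemma Mst_tri_sum:
  assumes x: "x \<in> Mst" and abc: "distinct [a, b, c]" "{a, b, c} \<subseteq> V"
  shows "2 * tri_sum x a b c \<in> \<int>"
    and "distinct [p, q, r] \<Longrightarrow> {p, q, r} \<subseteq> V \<Longrightarrow> tri_sum x a b c - tri_sum x p q r \<in> \<int>"
  using tri_sum_class[OF Mst_W[OF x] zsubmodule_Ints MstD[OF x] abc] by blast+

lemma tri_sum_degenerate:
  assumes x: "x \<in> W"
  shows "tri_sum x a b a = 0" "tri_sum x a b b = 0"
  using W_anti[OF x, of b a] by (simp_all add: tri_sum_def W_diag[OF x])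

text \<open>The rows sum to 0, so only the arc from \<open>a\<close> to \<open>b\<close> survives.
  Triangle sums thus recover an entry up to the factor \<open>n\<close>, which is the source of the
  divisors of \<open>n\<close>.\<close>

lemma sum_tri_sum:
  assumes x: "x \<in> W"
  shows "(\<Sum>c\<in>V. tri_sum x a b c) = of_nat n * x (a, b)"
proof -
  have "(\<Sum>c\<in>V. x (c, a)) = (\<Sum>c\<in>V. - x (a, c))"
    by (intro sum.cong refl) (rule W_anti[OF x])
  then show ?thesis
    by (simp add: tri_sum_def sum.distrib sum_negf W_row[OF x])
qed

lemma sum_tri_sum':
  assumes x: "x \<in> W" and ab: "a \<in> V" "b \<in> V" "a \<noteq> b"
  shows "(\<Sum>c\<in>V - {a, b}. tri_sum x a b c) = of_nat n * x (a, b)"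
proof -
  have "(\<Sum>c\<in>V - {a, b}. tri_sum x a b c) = (\<Sum>c\<in>V. tri_sum x a b c)"
    by (rule sum.mono_neutral_left) (auto simp: tri_sum_degenerate[OF x])
  then show ?thesis by (simp add: sum_tri_sum[OF x])
qed

lemma W_eq_0I:
  assumes x: "x \<in> W"
    and quad: "\<And>a b c d. distinct [a, b, c, d] \<Longrightarrow> {a, b, c, d} \<subseteq> V \<Longrightarrow> quad_sum x a b c d = 0"
  shows "x = 0"
proof (rule ext, clarify)
  fix a b
  have "zsubmodule {0 :: rat}" by (simp add: zsubmodule_def)
  then have tri: "tri_sum x a b c = 0" if "distinct [a, b, c]" "{a, b, c} \<subseteq> V" for c
    using tri_sum_class(1)[OF x, of "{0}" a b c] quad that by simp
  show "x (a, b) = 0 (a, b)"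
  proof (cases "a \<in> V \<and> b \<in> V \<and> a \<noteq> b")
    case True
    then have "of_nat n * x (a, b) = (\<Sum>c\<in>V - {a, b}. tri_sum x a b c)"
      by (simp add: sum_tri_sum'[OF x])
    also have "\<dots> = 0" using True by (intro sum.neutral ballI tri) auto
    finally show ?thesis using n_ge by simp
  qed (auto simp: W_out[OF x] W_out'[OF x] W_diag[OF x])
qed

text \<open>There are \<open>n - 2\<close> proper triangles through the arc, and their sums are
  congruent modulo the integers.\<close>

lemma Mst_entry:
  assumes x: "x \<in> Mst" and ab: "a \<in> V" "b \<in> V" "a \<noteq> b"
  shows "of_nat n * x (a, b) - of_nat (n - 2) * tri_sum x 1 2 3 \<in> \<int>"
proof -
  have 123: "distinct [1, 2, 3 :: nat]" "{1, 2, 3} \<subseteq> V" by simp_all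
  have "card (V - {a, b}) = n - 2" using ab by (simp add: card_Diff_subset)
  then have "of_nat n * x (a, b) - of_nat (n - 2) * tri_sum x 1 2 3
      = (\<Sum>c\<in>V - {a, b}. tri_sum x a b c - tri_sum x 1 2 3)"
    by (simp add: sum_subtractf sum_tri_sum'[OF Mst_W[OF x] ab])
  also have "\<dots> \<in> \<int>"
    by (intro zsubmodule_sum zsubmodule_Ints Mst_tri_sum(2)[OF x] 123) (use ab in auto)
  finally show ?thesis .
qed

text \<open>The triangle term of \<open>Mst_entry\<close> cancels in the difference. Hence the level
  divides \<open>n\<close>, although single entries are only controlled up to the denominator
  \<open>2 * n\<close>.\<close>

lemma Mst_n_diff:
  assumes x: "x \<in> Mst" and abc: "distinct [a, b, c]" "{a, b, c} \<subseteq> V"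
  shows "of_nat n * (x (a, c) - x (b, c)) \<in> \<int>"
  using Ints_diff[OF Mst_entry[OF x, of a c] Mst_entry[OF x, of b c]] abc
  by (simp add: algebra_simps)

lemma Mst_multiple: "x \<in> Mst \<Longrightarrow> scale (of_nat (2 * n)) x \<in> L0"
proof -
  assume x: "x \<in> Mst"
  have "of_nat (2 * n) * x (a, b) \<in> \<int>" for a b
  proof (cases "a \<in> V \<and> b \<in> V \<and> a \<noteq> b")
    case True
    then have "2 * (of_nat n * x (a, b) - of_nat (n - 2) * tri_sum x 1 2 3)
        + of_nat (n - 2) * (2 * tri_sum x 1 2 3) \<in> \<int>"
      by (intro Ints_add Ints_mult Ints_of_nat Mst_entry[OF x] Mst_tri_sum(1)[OF x] Ints_numeral) simp_all
    then show ?thesis by (simp add: algebra_simps)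
  qed (auto simp: W_out[OF Mst_W[OF x]] W_out'[OF Mst_W[OF x]] W_diag[OF Mst_W[OF x]])
  then show ?thesis using W_scale[OF Mst_W[OF x]] by (auto simp: L0_def)
qed

text \<open>This is the sum around the 4-cycle \<open>a\<close>, \<open>c\<close>, \<open>b\<close>,
  \<open>d\<close>. It makes the difference of the rows \<open>a\<close> and \<open>b\<close>
  constant modulo the integers off \<open>a\<close> and \<open>b\<close>, which
  \<open>commutator_mod_L0\<close> exploits.\<close>

lemma Mst_diff:
  assumes x: "x \<in> Mst" and abcd: "distinct [a, b, c, d]" "{a, b, c, d} \<subseteq> V"
  shows "(x (a, c) - x (b, c)) - (x (a, d) - x (b, d)) \<in> \<int>"
proof -
  have "quad_sum x a c b d \<in> \<int>" by (rule MstD[OF x]) (use abcd in auto)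
  then show ?thesis
    using W_anti[OF Mst_W[OF x], of c b] W_anti[OF Mst_W[OF x], of d a]
    by (simp add: quad_sum_def algebra_simps)
qed

text \<open>All triangle sums are congruent and have denominator at most 2, so a single one that is
  not integral decides for all of them.\<close>

lemma Mst_not_P:
  assumes x: "x \<in> Mst" "x \<notin> P" and abc: "distinct [a, b, c]" "{a, b, c} \<subseteq> V"
  shows "tri_sum x a b c \<in> half_Ints"
proof -
  obtain p q r where pqr: "distinct [p, q, r]" "{p, q, r} \<subseteq> V" "tri_sum x p q r \<notin> \<int>"
    using x Mst_W[OF x(1)] unfolding P_def by blast
  have "tri_sum x a b c \<notin> \<int>"
  proof
    assume "tri_sum x a b c \<in> \<int>"
    then have "(tri_sum x p q r - tri_sum x a b c) + tri_sum x a b c \<in> \<int>"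
      by (intro Ints_add Mst_tri_sum(2)[OF x(1)] pqr abc)
    with pqr show False by simp
  qed
  then show ?thesis using half_cases[OF Mst_tri_sum(1)[OF x(1) abc]] by blast
qed

lemma Mst_diff_P:
  assumes x: "x \<in> Mst" "x \<notin> P" and y: "y \<in> Mst" "y \<notin> P"
  shows "x - y \<in> P"
proof -
  have "tri_sum (x - y) a b c \<in> \<int>" if "distinct [a, b, c]" "{a, b, c} \<subseteq> V" for a b c
    unfolding tri_sum_linear by (intro half_diff Mst_not_P x y that)
  moreover have "x - y \<in> W" by (intro zsubmodule_diff W_zsubmodule Mst_W x y)
  ultimately show ?thesis unfolding P_def by blast
qed

section \<open>The lattice of level 1\<close>

lemma half_sum:
  assumes "finite A" "odd (card A)" "\<And>i. i \<in> A \<Longrightarrow> f i \<in> half_Ints"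
  shows "(\<Sum>i\<in>A. f i) \<in> half_Ints"
proof -
  obtain k where k: "card A = 2 * k + 1" using assms(2) by (elim oddE)
  have "(\<Sum>i\<in>A. f i - 1/2) \<in> \<int>"
    using assms(3) by (intro zsubmodule_sum zsubmodule_Ints) (auto simp: half_Ints_def)
  then have "(\<Sum>i\<in>A. f i - 1/2) + of_nat k \<in> \<int>" by (intro Ints_add Ints_of_nat)
  moreover have "(\<Sum>i\<in>A. f i - 1/2) + of_nat k = (\<Sum>i\<in>A. f i) - 1/2"
    by (simp add: sum_subtractf k)
  ultimately show ?thesis by (simp add: half_Ints_def)
qed

text \<open>Integral column differences give integral row differences by antisymmetry, so all
  entries off the diagonal are congruent modulo the integers. As \<open>x (2, 1)\<close> is the
  negative of \<open>x (1, 2)\<close>, their common class has order at most 2.\<close>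

lemma H0_iff:
  "x \<in> H0 \<longleftrightarrow> x \<in> W \<and> ((\<forall>i. x i \<in> \<int>) \<or> (\<forall>a\<in>V. \<forall>b\<in>V. a \<noteq> b \<longrightarrow> x (a, b) \<in> half_Ints))"
proof
  assume x: "x \<in> H0"
  then have xW: "x \<in> W" by (intro Mst_W H0_Mst)
  define R where "R y z \<longleftrightarrow> y - z \<in> \<int>" for y z :: rat
  have trans: "R y z \<Longrightarrow> R z w \<Longrightarrow> R y w" for y z w
    using Ints_add[of "y - z" "z - w"] by (simp add: R_def)
  have col: "R (x (a, c)) (x (b, c))" if "a \<noteq> c" "b \<noteq> c" "{a, b, c} \<subseteq> V" for a b c
    using H0D[OF x, of a b c] that by (cases "a = b") (simp_all add: R_def)
  have row: "R (x (c, a)) (x (c, b))" if "a \<noteq> c" "b \<noteq> c" "{a, b, c} \<subseteq> V" for a b c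
    using col[of b c a] that W_anti[OF xW, of a c] W_anti[OF xW, of b c] by (simp add: R_def)
  have eq: "R (x (a, b)) (x (p, q))" if "a \<noteq> b" "p \<noteq> q" "{a, b, p, q} \<subseteq> V" for a b p q
  proof (cases "p = b")
    case False
    then have "R (x (a, b)) (x (p, b))" "R (x (p, b)) (x (p, q))"
      using that by (auto intro!: col row)
    then show ?thesis by (rule trans)
  next
    case True
    \<comment> \<open>Here \<open>(p, b)\<close> lies on the diagonal and cannot serve as the
      intermediate entry, so the path goes through a third vertex.\<close>
    have "card {a, b} < card V" using n_ge by (auto simp: card_insert_if)
    then have "\<not> V \<subseteq> {a, b}" by (metis card_mono finite.emptyI finite_insert leD)
    then obtain c where "c \<in> V" "c \<noteq> a" "c \<noteq> b" by blast
    then have "R (x (a, b)) (x (a, c))" "R (x (a, c)) (x (b, c))" "R (x (b, c)) (x (p, q))"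
      using that True by (auto intro!: col row)
    then show ?thesis using trans by blast
  qed
  have "x (1, 2) - x (2, 1) \<in> \<int>" using eq[of 1 2 2 1] by (simp add: R_def)
  then have "2 * x (1, 2) \<in> \<int>" using W_anti[OF xW, of 2 1] by simp
  then have "x (1, 2) \<in> \<int> \<or> x (1, 2) \<in> half_Ints" by (rule half_cases)
  then show "x \<in> W \<and> ((\<forall>i. x i \<in> \<int>) \<or> (\<forall>a\<in>V. \<forall>b\<in>V. a \<noteq> b \<longrightarrow> x (a, b) \<in> half_Ints))"
  proof
    assume int: "x (1, 2) \<in> \<int>"
    have "x (a, b) \<in> \<int>" for a b
    proof (cases "a \<in> V \<and> b \<in> V \<and> a \<noteq> b")
      case True
      then have "x (a, b) - x (1, 2) \<in> \<int>" using eq[of a b 1 2] by (simp add: R_def)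
      from Ints_add[OF this int] show ?thesis by simp
    qed (auto simp: W_out[OF xW] W_out'[OF xW] W_diag[OF xW])
    then show ?thesis using xW by auto
  next
    assume half: "x (1, 2) \<in> half_Ints"
    have "x (a, b) \<in> half_Ints" if "a \<in> V" "b \<in> V" "a \<noteq> b" for a b
    proof -
      have "x (a, b) - x (1, 2) \<in> \<int>" using eq[of a b 1 2] that by (simp add: R_def)
      from half_add_Int[OF half this] show ?thesis by simp
    qed
    then show ?thesis using xW by auto
  qed
next
  assume x: "x \<in> W \<and> ((\<forall>i. x i \<in> \<int>) \<or> (\<forall>a\<in>V. \<forall>b\<in>V. a \<noteq> b \<longrightarrow> x (a, b) \<in> half_Ints))"
  then have xW: "x \<in> W" ..
  have d: "x (a, b) - x (p, q) \<in> \<int>" if "a \<noteq> b" "p \<noteq> q" "{a, b, p, q} \<subseteq> V" for a b p q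
    using x that by (auto intro: half_diff Ints_diff)
  have "quad_sum x a b c d \<in> \<int>" if "distinct [a, b, c, d]" "{a, b, c, d} \<subseteq> V" for a b c d
  proof -
    have "quad_sum x a b c d = (x (a, b) - x (c, b)) + (x (c, d) - x (a, d))"
      using W_anti[OF xW, of c b] W_anti[OF xW, of a d] by (simp add: quad_sum_def)
    then show ?thesis using that by (auto intro!: Ints_add d)
  qed
  moreover have "x (a, c) - x (b, c) \<in> \<int>" if "distinct [a, b, c]" "{a, b, c} \<subseteq> V" for a b c
    by (rule d) (use that in auto)
  ultimately show "x \<in> H0" using xW unfolding H0_def Mst_def by blast
qed

lemma L0_subset_H0: "L0 \<subseteq> H0"
  by (auto simp: H0_iff L0_def)

lemma H0_double: "x \<in> H0 \<Longrightarrow> scale 2 x \<in> L0"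
proof -
  assume x: "x \<in> H0"
  then have xW: "x \<in> W" by (simp add: H0_iff)
  have "2 * x (a, b) \<in> \<int>" for a b
  proof (cases "a \<in> V \<and> b \<in> V \<and> a \<noteq> b")
    case True
    then consider "x (a, b) \<in> \<int>" | "x (a, b) - 1/2 \<in> \<int>"
      using x by (auto simp: H0_iff half_Ints_def)
    then show ?thesis
    proof cases
      case 2
      then have "2 * (x (a, b) - 1/2) + 1 \<in> \<int>" by (metis Ints_1 Ints_add Ints_mult Ints_numeral)
      then show ?thesis by simp
    qed simp
  qed (auto simp: W_out[OF xW] W_out'[OF xW] W_diag[OF xW])
  then show ?thesis using W_scale[OF xW] by (auto simp: L0_def)
qed

lemma H0_quadruple: "x \<in> H0 \<Longrightarrow> scale 4 x \<in> M1"
  using double_L0_M1[OF H0_double, of x] by simp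

text \<open>A row has \<open>n - 1\<close> entries off the diagonal, and an odd number of
  half-integers cannot add up to 0.\<close>

lemma H0_eq_L0:
  assumes "even n"
  shows "H0 = L0"
proof (intro equalityI L0_subset_H0 subsetI)
  fix x assume x: "x \<in> H0"
  then have xW: "x \<in> W" by (simp add: H0_iff)
  have "\<not> (\<forall>a\<in>V. \<forall>b\<in>V. a \<noteq> b \<longrightarrow> x (a, b) \<in> half_Ints)"
  proof
    assume "\<forall>a\<in>V. \<forall>b\<in>V. a \<noteq> b \<longrightarrow> x (a, b) \<in> half_Ints"
    moreover have "odd (card (V - {1}))" using assms n_ge by (simp add: card_Diff_subset)
    ultimately have "(\<Sum>b\<in>V - {1}. x (1, b)) \<in> half_Ints"
      by (intro half_sum) auto
    moreover have "(\<Sum>b\<in>V. x (1, b)) = x (1, 1) + (\<Sum>b\<in>V - {1}. x (1, b))"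
      by (intro sum.remove) simp_all
    ultimately have "0 \<in> half_Ints"
      by (simp only: W_row[OF xW] W_diag[OF xW]) simp
    then show False using half_not_Int[of 0] by simp
  qed
  then show "x \<in> L0" using x by (auto simp: H0_iff L0_def)
qed

subsection \<open>Classification of the invariant lattices\<close>

text \<open>An entry at \<open>v\<close> is minus the sum of the \<open>n - 2\<close> other entries
  off the diagonal in its row. For odd \<open>n\<close>, an odd number of half-integers adds up to a
  half-integer.\<close>

lemma W_off_vertex:
  assumes x: "x \<in> W" and v: "v \<in> V"
  shows "(\<And>i j. i \<in> V \<Longrightarrow> j \<in> V \<Longrightarrow> i \<noteq> j \<Longrightarrow> i \<noteq> v \<Longrightarrow> j \<noteq> v \<Longrightarrow> x (i, j) \<in> \<int>) \<Longrightarrow> x \<in> L0"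
    and "odd n \<Longrightarrow> (\<And>i j. i \<in> V \<Longrightarrow> j \<in> V \<Longrightarrow> i \<noteq> j \<Longrightarrow> i \<noteq> v \<Longrightarrow> j \<noteq> v \<Longrightarrow> x (i, j) \<in> half_Ints)
      \<Longrightarrow> x \<in> H0"
proof -
  have sum: "x (i, v) = - (\<Sum>j\<in>V - {v, i}. x (i, j))" if "i \<in> V" "i \<noteq> v" for i
  proof -
    have "(\<Sum>j\<in>V. x (i, j)) = x (i, v) + (\<Sum>j\<in>V - {v}. x (i, j))"
      using v by (intro sum.remove) simp_all
    also have "(\<Sum>j\<in>V - {v}. x (i, j)) = (\<Sum>j\<in>V - {v, i}. x (i, j))"
      by (rule sum.mono_neutral_right) (auto simp: W_diag[OF x])
    finally show ?thesis by (simp add: W_row[OF x] eq_neg_iff_add_eq_0)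
  qed
  show "x \<in> L0"
    if int: "\<And>i j. i \<in> V \<Longrightarrow> j \<in> V \<Longrightarrow> i \<noteq> j \<Longrightarrow> i \<noteq> v \<Longrightarrow> j \<noteq> v \<Longrightarrow> x (i, j) \<in> \<int>"
  proof -
    have iv: "x (i, v) \<in> \<int>" if "i \<in> V" "i \<noteq> v" for i
      unfolding sum[OF that] using that
      by (intro Ints_minus zsubmodule_sum zsubmodule_Ints int) auto
    have "x (i, j) \<in> \<int>" for i j
    proof (cases "i \<in> V \<and> j \<in> V \<and> i \<noteq> j")
      case True
      then show ?thesis
        using int[of i j] iv[of i] iv[of j] W_anti[OF x, of i j] Ints_minus[of "x (j, i)"]
        by (cases "i = v"; cases "j = v") auto
    qed (auto simp: W_out[OF x] W_out'[OF x] W_diag[OF x])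
    then show ?thesis using x by (auto simp: L0_def)
  qed
  show "x \<in> H0"
    if n: "odd n" and half: "\<And>i j. i \<in> V \<Longrightarrow> j \<in> V \<Longrightarrow> i \<noteq> j \<Longrightarrow> i \<noteq> v \<Longrightarrow> j \<noteq> v \<Longrightarrow> x (i, j) \<in> half_Ints"
  proof -
    have iv: "x (i, v) \<in> half_Ints" if "i \<in> V" "i \<noteq> v" for i
      unfolding sum[OF that]
    proof (intro half_minus half_sum)
      have "card (V - {v, i}) = n - 2" using that v by (simp add: card_Diff_subset)
      then show "odd (card (V - {v, i}))" using n n_ge by simp
    qed (use that half in auto)
    have "x (i, j) \<in> half_Ints" if "i \<in> V" "j \<in> V" "i \<noteq> j" for i j
      using that half[of i j] iv[of i] iv[of j] W_anti[OF x, of i j] half_minus[of "x (j, i)"]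
      by (cases "i = v"; cases "j = v") auto
    then show ?thesis using x unfolding H0_iff by blast
  qed
qed

text \<open>
  The entries of \<open>star_defect v x\<close> away from \<open>v\<close> are negated triangle sums of \<open>x\<close>.  Hence, up to
  elements of \<open>H0\<close>, a flow is the sum of its commutators with the transpositions moving \<open>v\<close>.
\<close>

definition star_defect :: "nat \<Rightarrow> (nat \<times> nat \<Rightarrow> rat) \<Rightarrow> nat \<times> nat \<Rightarrow> rat" where
  "star_defect v x = x - (\<Sum>b\<in>V - {v}. x - pull (transpose v b) x)"

text \<open>The triangle sums are all integral or all half-integral; in the second case it takes an
  odd \<open>n\<close> for \<open>W_off_vertex\<close> to extend this to the entries at
  \<open>v\<close>.\<close>

lemma star_defect_in_H0:
  assumes x: "x \<in> Mst" and v: "v \<in> V" and n: "odd n \<or> x \<in> P"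
  shows "star_defect v x \<in> H0"
proof -
  let ?E = "star_defect v x"
  have xW: "x \<in> W" using x by (rule Mst_W)
  have EW: "?E \<in> W"
    unfolding star_defect_def
    by (intro zsubmodule_diff zsubmodule_sum W_zsubmodule xW invariantD[OF W_invariant] permutes_swap_id v) auto
  have E: "?E (c, d) = - tri_sum x c d v" if cd: "c \<in> V" "d \<in> V" "c \<noteq> d" "c \<noteq> v" "d \<noteq> v" for c d
  proof -
    \<comment> \<open>Only the transpositions of \<open>v\<close> with \<open>c\<close> and with
      \<open>d\<close> move the entry \<open>(c, d)\<close>.\<close>
    let ?g = "\<lambda>b. x (c, d) - x (transpose v b c, transpose v b d)"
    have "(\<Sum>b\<in>V - {v}. ?g b) = (\<Sum>b\<in>{c, d}. ?g b)"
      using cd by (intro sum.mono_neutral_right) (auto simp: transpose_def)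
    also have "\<dots> = 2 * x (c, d) - x (v, d) - x (c, v)"
      using cd by (simp add: transpose_def)
    finally show ?thesis
      using W_anti[OF xW, of d v] W_anti[OF xW, of c v]
      by (simp add: star_defect_def sum_fun_apply tri_sum_def)
  qed
  show ?thesis
  proof (cases "x \<in> P")
    case True
    have "?E \<in> L0"
      by (rule W_off_vertex(1)[OF EW v]) (use v in \<open>auto simp: E intro!: PD[OF True]\<close>)
    then show ?thesis using L0_subset_H0 by blast
  next
    case False
    show ?thesis
    proof (rule W_off_vertex(2)[OF EW v])
      show "odd n" using n False by blast
    qed (use v in \<open>auto simp: E intro!: half_minus Mst_not_P[OF x False]\<close>)
  qed
qed

text \<open>\<open>fan a b\<close> is \<open>n\<close> times the orthogonal projection of \<open>arc a b\<close> to the flows.\<close>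

definition fan :: "nat \<Rightarrow> nat \<Rightarrow> nat \<times> nat \<Rightarrow> rat" where
  "fan a b = (\<Sum>c\<in>V. tri a b c)"

lemma fan_eq: "fan a b = scale (of_nat n) (arc a b) + (\<Sum>c\<in>V. arc b c) - (\<Sum>c\<in>V. arc a c)"
proof -
  have "fan a b = (\<Sum>c\<in>V. arc a b) + (\<Sum>c\<in>V. arc b c) + (\<Sum>c\<in>V. arc c a)"
    by (simp add: fan_def tri_def sum.distrib)
  moreover have "(\<Sum>c\<in>V. arc c a) = - (\<Sum>c\<in>V. arc a c)"
    unfolding sum_negf[symmetric] by (intro sum.cong refl arc_swap)
  moreover have "(\<Sum>c\<in>V. arc a b) = scale (of_nat n) (arc a b)"
    by (rule ext) (simp add: sum_fun_apply)
  ultimately show ?thesis by simp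
qed

lemma sum_arc_apply:
  assumes "i \<in> V" "j \<in> V"
  shows "(\<Sum>c\<in>V. arc b c) (i, j) = of_bool (i = b) - of_bool (j = b)"
proof -
  have "(\<Sum>c\<in>V. of_bool ((y, z) = (b, c)) :: rat) = of_bool (y = b)" if "z \<in> V" for y z
    using that by (simp add: of_bool_def)
  moreover have "(\<Sum>c\<in>V. of_bool ((i, j) = (c, b)) :: rat) = (\<Sum>c\<in>V. of_bool ((j, i) = (b, c)))"
    by (intro sum.cong) auto
  ultimately show ?thesis
    using assms by (simp add: sum_fun_apply arc_def sum_subtractf del: prod.inject)
qed

lemma fan_apply:
  assumes "i \<in> V" "j \<in> V"
  shows "fan a b (i, j) = of_nat n * arc a b (i, j) + (of_bool (i = b) - of_bool (j = b))
    - (of_bool (i = a) - of_bool (j = a))"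
  using sum_arc_apply[OF assms] by (simp add: fan_eq)

lemma fan_in_L0: "a \<in> V \<Longrightarrow> b \<in> V \<Longrightarrow> fan a b \<in> L0"
  unfolding fan_def by (intro zsubmodule_sum L0_zsubmodule tri_in_L0) auto

lemma pull_fan:
  assumes p: "p permutes V"
  shows "pull p (fan a b) = fan (inv_into UNIV p a) (inv_into UNIV p b)"
proof -
  have q: "inv_into UNIV p permutes V" using p by (rule permutes_inv)
  have "pull p (fan a b) = (\<Sum>c\<in>V. tri (inv_into UNIV p a) (inv_into UNIV p b) (inv_into UNIV p c))"
    by (simp add: fan_def pull_linear pull_tri[OF p])
  also have "\<dots> = fan (inv_into UNIV p a) (inv_into UNIV p b)"
    unfolding fan_def by (rule sum.reindex_bij_betw[OF permutes_imp_bij[OF q]])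
  finally show ?thesis .
qed

text \<open>The star terms of \<open>fan_eq\<close> cancel around the triangle. This is how
  triangles are recovered from fans.\<close>

lemma fan_cycle: "fan a b + fan b c + fan c a = scale (of_nat n) (tri a b c)"
  by (simp add: fan_eq tri_def scale_distrib)

text \<open>The star of arcs at \<open>a\<close> is orthogonal to all flows because their rows sum
  to 0, so its projection vanishes.\<close>

lemma sum_fan:
  assumes "a \<in> V"
  shows "(\<Sum>b\<in>V - {a}. fan a b) = 0"
proof -
  have "(\<Sum>b\<in>V - {a}. fan a b) = (\<Sum>b\<in>V. fan a b)"
    by (rule sum.mono_neutral_left) (auto simp: fan_eq)
  also have "\<dots> = (\<Sum>b\<in>V. \<Sum>c\<in>V. arc b c)"
  proof -
    have "(\<Sum>b\<in>V. scale (of_nat n) (arc a b)) = (\<Sum>b\<in>V. \<Sum>c\<in>V. arc a c)"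
      by (rule ext) (simp add: sum_fun_apply sum_distrib_left)
    then show ?thesis by (simp add: fan_eq sum.distrib sum_subtractf)
  qed
  also have "\<dots> = 0"
  proof -
    have "(\<Sum>b\<in>V. \<Sum>c\<in>V. arc b c) = (\<Sum>c\<in>V. \<Sum>b\<in>V. arc b c)" by (rule sum.swap)
    also have "\<dots> = - (\<Sum>c\<in>V. \<Sum>b\<in>V. arc c b)"
      unfolding sum_negf[symmetric] by (intro sum.cong refl arc_swap)
    finally show ?thesis by (simp add: fun_eq_iff)
  qed
  finally show ?thesis .
qed

text \<open>By \<open>Mst_diff\<close>, off \<open>a\<close> and \<open>b\<close> the commutator
  has, modulo the integers, a constant row at \<open>a\<close> and the negative constant at
  \<open>b\<close>, exactly like a multiple of \<open>fan a b\<close>. \<open>W_off_vertex\<close>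
  takes care of the entries at \<open>a\<close>.\<close>

lemma commutator_mod_L0:
  assumes x: "x \<in> Mst" and abc: "distinct [a, b, c]" "{a, b, c} \<subseteq> V"
  shows "x - pull (transpose a b) x + scale (x (a, c) - x (b, c)) (fan a b) \<in> L0"
proof (rule W_off_vertex(1)[of _ a])
  let ?z = "x - pull (transpose a b) x + scale (x (a, c) - x (b, c)) (fan a b)"
  have xW: "x \<in> W" using x by (rule Mst_W)
  show zW: "?z \<in> W"
    by (intro zsubmodule_diff zsubmodule_add W_zsubmodule xW W_scale L0_W fan_in_L0
        invariantD[OF W_invariant] permutes_swap_id) (use abc in auto)
  show "a \<in> V" using abc by simp
  have bj: "?z (b, j) \<in> \<int>" if j: "j \<in> V" "j \<noteq> a" "j \<noteq> b" for j
  proof -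
    have eq: "?z (b, j) = - ((x (a, j) - x (b, j)) - (x (a, c) - x (b, c)))"
      using abc j by (simp add: transpose_def fan_apply arc_def)
    have "(x (a, j) - x (b, j)) - (x (a, c) - x (b, c)) \<in> \<int>"
      using Mst_diff[OF x, of a b j c] abc j by (cases "j = c") simp_all
    then show ?thesis unfolding eq by (rule Ints_minus)
  qed
  fix i j assume ij: "i \<in> V" "j \<in> V" "i \<noteq> j" "i \<noteq> a" "j \<noteq> a"
  consider "i = b" | "j = b" | "i \<noteq> b" "j \<noteq> b" by blast
  then show "?z (i, j) \<in> \<int>"
  proof cases
    case 1 then show ?thesis using bj[of j] ij by simp
  next
    case 2
    then have "- ?z (b, i) \<in> \<int>" using bj[of i] ij by (intro Ints_minus) simp
    then show ?thesis using 2 W_anti[OF zW, of i b] by simp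
  next
    case 3
    then have "?z (i, j) = 0"
      using abc ij by (simp add: transpose_def fan_apply arc_def)
    then show ?thesis by simp
  qed
qed

text \<open>
  The range from \<open>M1\<close> to \<open>Mst\<close> normalizes the scaling: it says that the sums around 4-cycles of
  the elements of \<open>L\<close> are exactly the integers.
\<close>

definition Lattices :: "(nat \<times> nat \<Rightarrow> rat) set set" where
  "Lattices = {L. zsubmodule L \<and> invariant L \<and> M1 \<subseteq> L \<and> L \<subseteq> Mst}"

lemma LatticesD:
  assumes "L \<in> Lattices"
  shows "zsubmodule L" "invariant L" "M1 \<subseteq> L" "L \<subseteq> Mst"
  using assms by (simp_all add: Lattices_def)

text \<open>By invariance, 1, 2, 3 stand for any three distinct vertices; see
  \<open>level_Ints\<close> and \<open>level_attained\<close>.\<close>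

definition level :: "(nat \<times> nat \<Rightarrow> rat) set \<Rightarrow> nat \<Rightarrow> bool" where
  "level L e \<longleftrightarrow> e > 0 \<and> (\<lambda>x. x (1, 3) - x (2, 3)) ` L = range (\<lambda>k. of_int k / of_nat e)"

lemma exists_permutes3:
  assumes "distinct [a, b, c]" "{a, b, c} \<subseteq> V" "distinct [p, q, r]" "{p, q, r} \<subseteq> V"
  obtains f where "f permutes V" "f a = p" "f b = q" "f c = r"
  using exists_permutes_map[of "[a, b, c]" "[p, q, r]" V] assms by auto

lemma exists_permutes4:
  assumes "distinct [a, b, c, d]" "{a, b, c, d} \<subseteq> V" "distinct [p, q, r, s]" "{p, q, r, s} \<subseteq> V"
  obtains f where "f permutes V" "f a = p" "f b = q" "f c = r" "f d = s"
  using exists_permutes_map[of "[a, b, c, d]" "[p, q, r, s]" V] assms by auto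

text \<open>A 4-cycle through the arc from 1 to 3 that avoids 2. It shows that 1 is a difference in
  every lattice.\<close>

lemma quad_1345:
  fixes q :: "nat \<times> nat \<Rightarrow> rat"
  defines "q \<equiv> quad 1 3 4 5"
  shows "q \<in> M1" "q (1, 3) - q (2, 3) = 1"
proof -
  show "q \<in> M1" unfolding q_def by (rule quad_in_M1) simp_all
  show "q (1, 3) - q (2, 3) = 1" by (simp add: q_def quad_def arc_def)
qed

text \<open>The differences form a group between the integers and the multiples of
  \<open>1 / n\<close>. Such a group consists of the multiples of \<open>1 / e\<close> for a divisor
  \<open>e\<close> of \<open>n\<close>.\<close>

lemma exists_level:
  assumes L: "L \<in> Lattices"
  obtains e where "level L e" "e dvd n"
proof -
  let ?D = "(\<lambda>x. x (1, 3) - x (2, 3)) ` L"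
  note L' = LatticesD[OF L]
  have "zsubmodule ?D" using L'(1) by (rule zsubmodule_image) simp
  moreover have "n > 0" using n_ge by simp
  moreover have nD: "of_nat n * y \<in> \<int>" if "y \<in> ?D" for y
    using that L'(4) Mst_n_diff[of _ 1 2 3] by auto
  ultimately obtain g where g: "g \<ge> 0" "?D = range (\<lambda>k. g * of_int k)"
    by (rule zsubmodule_rat_principal)
  have "1 \<in> ?D" 
  proof (rule image_eqI[where x = "quad 1 3 4 5"])
    show "1 = quad 1 3 4 5 (1, 3 :: nat) - (quad 1 3 4 5 (2, 3 :: nat) :: rat)"
      by (rule quad_1345(2)[symmetric])
  qed (use quad_1345(1) L'(3) in blast)
  then obtain k where k: "1 = g * of_int k" using g(2) by auto
  have "k > 0"
  proof (rule ccontr)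
    assume "\<not> k > 0"
    then have "g * of_int k \<le> 0" using g(1) by (simp add: mult_nonneg_nonpos)
    with k show False by simp
  qed
  define e where "e = nat k"
  have e: "e > 0" "g = 1 / of_nat e" using k \<open>k > 0\<close> by (simp_all add: e_def field_simps)
  have "level L e" unfolding level_def g(2) using e by simp
  moreover have "e dvd n"
  proof -
    have "g \<in> ?D" unfolding g(2) by (intro image_eqI[of _ _ 1]) simp_all
    then obtain m where "of_nat n * g = of_int m" using nD by (elim Ints_cases[OF nD])
    then have "(of_int (int n) :: rat) = of_int (m * int e)" using e by (simp add: field_simps)
    then have "int n = m * int e" by (simp only: of_int_eq_iff)
    then have "int e dvd int n" by simp
    then show ?thesis by simp
  qed
  ultimately show ?thesis by (rule that)
qed

lemma level_unique: "level L e \<Longrightarrow> level L e' \<Longrightarrow> e = e'"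
proof -
  have *: "e' dvd e" if "level L e" "level L e'" for e e'
  proof -
    have "1 / of_nat e' \<in> range (\<lambda>k. of_int k / of_nat e' :: rat)"
      by (intro image_eqI[of _ _ 1]) simp_all
    then have "1 / of_nat e' \<in> range (\<lambda>k. of_int k / of_nat e :: rat)"
      using that by (simp add: level_def)
    then obtain k where "1 / of_nat e' = (of_int k / of_nat e :: rat)" by blast
    then have "(of_int (int e) :: rat) = of_int (k * int e')"
      using that by (simp add: level_def field_simps)
    then have "int e = k * int e'" by (simp only: of_int_eq_iff)
    then have "int e' dvd int e" by simp
    then show ?thesis by simp
  qed
  then show "level L e \<Longrightarrow> level L e' \<Longrightarrow> e = e'" by (simp add: dvd_antisym)
qed

lemma level_Ints:
  assumes L: "L \<in> Lattices" "level L e" and x: "x \<in> L" and abc: "distinct [a, b, c]" "{a, b, c} \<subseteq> V"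
  shows "of_nat e * (x (a, c) - x (b, c)) \<in> \<int>"
proof -
  obtain f where f: "f permutes V" "f 1 = a" "f 2 = b" "f 3 = c"
    by (rule exists_permutes3[of 1 2 3 a b c]) (use abc in simp_all)
  have "pull f x \<in> L" using invariantD[OF LatticesD(2)[OF L(1)] f(1) x] .
  then have "x (a, c) - x (b, c) \<in> range (\<lambda>k. of_int k / of_nat e)"
    using L(2) f unfolding level_def by (force intro: image_eqI[of _ _ "pull f x"])
  then show ?thesis using L(2) by (auto simp: level_def)
qed

lemma level_attained:
  assumes L: "L \<in> Lattices" "level L e" and abc: "distinct [a, b, c]" "{a, b, c} \<subseteq> V"
  obtains x where "x \<in> L" "x (a, c) - x (b, c) = 1 / of_nat e"
proof -
  have "1 / of_nat e \<in> range (\<lambda>k. of_int k / of_nat e :: rat)"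
    by (intro image_eqI[of _ _ 1]) simp_all
  then have "1 / of_nat e \<in> (\<lambda>x. x (1, 3) - x (2, 3)) ` L"
    using L(2) by (simp add: level_def)
  then obtain x where x: "x \<in> L" "x (1, 3) - x (2, 3) = 1 / of_nat e" by auto
  obtain f where f: "f permutes V" "f a = 1" "f b = 2" "f c = 3"
    by (rule exists_permutes3[of a b c 1 2 3]) (use abc in simp_all)
  have "pull f x \<in> L" using invariantD[OF LatticesD(2)[OF L(1)] f(1) x(1)] .
  then show ?thesis using x f by (intro that[of "pull f x"]) simp_all
qed

lemma obtain_third:
  assumes "a \<in> V" "b \<in> V" "a \<noteq> b"
  obtains c where "distinct [a, b, c]" "{a, b, c} \<subseteq> V"
proof -
  have "card {a, b} < card V" using n_ge by (auto simp: card_insert_if)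
  then have "\<not> V \<subseteq> {a, b}" by (metis card_mono finite.emptyI finite_insert leD)
  then obtain c where "c \<in> V" "c \<notin> {a, b}" by blast
  then show ?thesis using assms by (intro that[of c]) auto
qed

text \<open>\<open>commutator_mod_L0\<close> is applied to an element with the difference
  \<open>1 / e\<close>; its commutator lies in the lattice.\<close>

lemma fan_mod_L0:
  assumes L: "L \<in> Lattices" "level L e" and ab: "a \<in> V" "b \<in> V" "a \<noteq> b"
  obtains y where "y \<in> L0" "scale (1 / of_nat e) (fan a b) + y \<in> L"
proof -
  obtain c where abc: "distinct [a, b, c]" "{a, b, c} \<subseteq> V" by (rule obtain_third[OF ab])
  obtain x where x: "x \<in> L" "x (a, c) - x (b, c) = 1 / of_nat e"
    by (rule level_attained[OF L abc])
  note L' = LatticesD[OF L(1)]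
  let ?z = "x - pull (transpose a b) x + scale (x (a, c) - x (b, c)) (fan a b)"
  have "?z \<in> L0" by (rule commutator_mod_L0[OF _ abc]) (use x L'(4) in auto)
  then have "- ?z \<in> L0" by (rule zsubmodule_minus[OF L0_zsubmodule])
  moreover have "pull (transpose a b) x - x \<in> L"
    by (intro zsubmodule_diff L'(1) x invariantD[OF L'(2)] permutes_swap_id ab)
  then have "scale (1 / of_nat e) (fan a b) + (- ?z) \<in> L"
    by (simp add: x(2))
  ultimately show ?thesis by (rule that)
qed

section \<open>How the level determines a lattice\<close>

lemma coprime_4_odd: "odd e \<Longrightarrow> coprime 4 (int e)"
  using coprime_power_left_iff[of 2 2 "int e"] by simp

text \<open>An even divisor takes up the only factor 2 of \<open>n\<close>; here it matters that 4
  does not divide \<open>n\<close>.\<close>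

lemma odd_quotient:
  assumes "n mod 4 = 2" "even e" "n = e * r"
  shows "odd (r :: nat)"
proof
  assume "even r"
  with assms(2) have "2 * 2 dvd n" unfolding assms(3) by (rule mult_dvd_mono)
  then show False using assms(1) by presburger
qed

text \<open>For odd \<open>e\<close>, this is inverse to intersecting with \<open>H0\<close>; see
  \<open>lattice_of_odd_level\<close> and \<open>Lat_Int_H0\<close>.\<close>

definition Lat :: "nat \<Rightarrow> (nat \<times> nat \<Rightarrow> rat) set \<Rightarrow> (nat \<times> nat \<Rightarrow> rat) set" where
  "Lat e K = {x \<in> Mst. scale (of_nat e) x \<in> K}"

lemma M1_lattice: "M1 \<in> Lattices" and L0_lattice: "L0 \<in> Lattices" and H0_lattice: "H0 \<in> Lattices"
  using M1_zsubmodule M1_invariant L0_zsubmodule L0_invariant H0_zsubmodule H0_invariant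
    M1_subset_L0 L0_subset_P P_subset_Mst L0_subset_H0 H0_Mst
  unfolding Lattices_def by blast+

lemma Int_lattice: "K \<in> Lattices \<Longrightarrow> L \<in> Lattices \<Longrightarrow> K \<inter> L \<in> Lattices"
  unfolding Lattices_def invariant_def using zsubmodule_Int[of K L] by blast

lemma P_lattice: "P \<in> Lattices"
  using P_zsubmodule P_invariant M1_subset_L0 L0_subset_P P_subset_Mst
  unfolding Lattices_def by blast

lemma Lat_lattice:
  assumes K: "K \<in> Lattices"
  shows "Lat e K \<in> Lattices"
proof -
  note K' = LatticesD[OF K]
  have "zsubmodule (Lat e K)"
    using zsubmodule_0[OF Mst_zsubmodule] zsubmodule_0[OF K'(1)]
      zsubmodule_diff[OF Mst_zsubmodule] zsubmodule_diff[OF K'(1)]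
    by (simp add: zsubmodule_def Lat_def scale_distrib)
  moreover have "invariant (Lat e K)"
    using invariantD[OF Mst_invariant] invariantD[OF K'(2)]
    by (simp add: invariant_def Lat_def pull_linear[symmetric])
  moreover have "M1 \<subseteq> Lat e K"
    using zsubmodule_scale_nat[OF M1_zsubmodule] K'(3) LatticesD(4)[OF M1_lattice]
    by (auto simp: Lat_def)
  ultimately show ?thesis by (simp add: Lattices_def Lat_def)
qed

lemma scale_level_H0:
  assumes L: "L \<in> Lattices" "level L e" and x: "x \<in> L"
  shows "scale (of_nat e) x \<in> H0"
proof -
  have "scale (of_nat e) x \<in> Mst"
    by (intro zsubmodule_scale_nat Mst_zsubmodule) (use x LatticesD(4)[OF L(1)] in auto)
  moreover have "scale (of_nat e) x (a, c) - scale (of_nat e) x (b, c) \<in> \<int>"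
    if "distinct [a, b, c]" "{a, b, c} \<subseteq> V" for a b c
    using level_Ints[OF L x that] by (simp add: algebra_simps)
  ultimately show ?thesis unfolding H0_def by blast
qed

lemma level_I:
  assumes L: "L \<in> Lattices" and e: "e > 0"
    and int: "\<And>x. x \<in> L \<Longrightarrow> scale (of_nat e) x \<in> H0"
    and x: "x \<in> L" "x (1, 3) - x (2, 3) = 1 / of_nat e"
  shows "level L e"
  unfolding level_def
proof (intro conjI e equalityI subsetI)
  fix y assume "y \<in> (\<lambda>x. x (1, 3) - x (2, 3)) ` L"
  then obtain u where u: "u \<in> L" "y = u (1, 3) - u (2, 3)" by blast
  have "scale (of_nat e) u (1, 3) - scale (of_nat e) u (2, 3) \<in> \<int>"
    by (intro H0D int u) simp_all
  then obtain k where "scale (of_nat e) u (1, 3) - scale (of_nat e) u (2, 3) = of_int k"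
    by (elim Ints_cases)
  then have "of_nat e * y = of_int k" unfolding u(2) by (simp add: right_diff_distrib)
  then have "y = of_int k / of_nat e" using e by (simp add: eq_divide_eq mult.commute)
  then show "y \<in> range (\<lambda>k. of_int k / of_nat e)" by blast
next
  fix y :: rat assume "y \<in> range (\<lambda>k. of_int k / of_nat e)"
  then obtain k where "y = of_int k * (1 / of_nat e)" by auto
  then have "y = scale (of_int k) x (1, 3) - scale (of_int k) x (2, 3)"
    unfolding x(2)[symmetric] by (simp add: algebra_simps)
  then show "y \<in> (\<lambda>x. x (1, 3) - x (2, 3)) ` L"
    using zsubmodule_scale_int[OF LatticesD(1)[OF L] x(1)]
    by (rule image_eqI[where x = "scale (of_int k) x"])
qed

text \<open>For even \<open>n\<close>, \<open>H0\<close> is \<open>L0\<close>, so the triangle sums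
  of \<open>e\<close> times \<open>x\<close> are integers, whereas an odd multiple of a half-integer
  is not. This provides the hypothesis of \<open>star_defect_in_H0\<close>.\<close>

lemma odd_n_or_P:
  assumes x: "x \<in> Mst" and e: "odd e" "scale (of_nat e) x \<in> H0"
  shows "odd n \<or> x \<in> P"
proof (rule ccontr)
  assume "\<not> (odd n \<or> x \<in> P)"
  then have "even n" and xP: "x \<notin> P" by auto
  then have "scale (of_nat e) x \<in> P" using e H0_eq_L0 L0_subset_P by blast
  then have "tri_sum (scale (of_nat e) x) 1 2 3 \<in> \<int>" by (rule PD) simp_all
  moreover have "of_int (int e) * tri_sum x 1 2 3 \<in> half_Ints"
    by (intro half_odd_mult Mst_not_P x xP) (use e in simp_all)
  ultimately show False using half_not_Int by (simp add: tri_sum_linear)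
qed

lemma H0_scaled_diff:
  assumes "scale (of_nat e) x \<in> H0" "e > 0" "distinct [a, b, c]" "{a, b, c} \<subseteq> V"
  obtains k where "x (a, c) - x (b, c) = of_int k / of_nat e"
proof -
  have "scale (of_nat e) x (a, c) - scale (of_nat e) x (b, c) \<in> \<int>"
    using H0D[OF assms(1,3,4)] .
  then obtain k where "scale (of_nat e) x (a, c) - scale (of_nat e) x (b, c) = of_int k"
    by (elim Ints_cases)
  then have "of_nat e * (x (a, c) - x (b, c)) = of_int k" by (simp add: right_diff_distrib)
  then have "x (a, c) - x (b, c) = of_int k / of_nat e"
    using assms(2) by (simp only: eq_divide_eq mult.commute) simp
  then show ?thesis by (rule that)
qed

text \<open>The factor \<open>m\<close> moves the part in \<open>L0\<close> into \<open>L\<close>: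
  it is 2 where only \<open>M1\<close> is known to lie in \<open>L\<close>, and 1 where all of
  \<open>L0\<close> does.\<close>

lemma commutator_in_lattice:
  assumes L: "L \<in> Lattices" and e: "e > 0"
    and fan: "scale (of_nat m / of_nat e) (fan a b) \<in> L"
    and m: "\<And>z. z \<in> L0 \<Longrightarrow> scale (of_nat m) z \<in> L"
    and x: "x \<in> Mst" "scale (of_nat e) x \<in> H0" and ab: "a \<in> V" "b \<in> V" "a \<noteq> b"
  shows "scale (of_nat m) (x - pull (transpose a b) x) \<in> L"
proof -
  obtain c where abc: "distinct [a, b, c]" "{a, b, c} \<subseteq> V" by (rule obtain_third[OF ab])
  let ?z = "x - pull (transpose a b) x + scale (x (a, c) - x (b, c)) (fan a b)"
  obtain k where k: "x (a, c) - x (b, c) = of_int k / of_nat e"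
    by (rule H0_scaled_diff[OF x(2) e abc])
  have "?z \<in> L0" by (rule commutator_mod_L0[OF x(1) abc])
  then have "scale (of_nat m) ?z - scale (of_int k) (scale (of_nat m / of_nat e) (fan a b)) \<in> L"
    using LatticesD(1)[OF L] by (intro zsubmodule_diff zsubmodule_scale_int m fan)
  also have "scale (of_nat m) ?z - scale (of_int k) (scale (of_nat m / of_nat e) (fan a b))
      = scale (of_nat m) (x - pull (transpose a b) x)"
    unfolding k by (simp add: scale_distrib mult.commute)
  finally show ?thesis .
qed

lemma star_defect_eq: "x = star_defect v x + (\<Sum>b\<in>V - {v}. x - pull (transpose v b) x)"
  by (simp add: star_defect_def)

text \<open>It remains to undo the multiplication by \<open>e\<close>. The multiple
  \<open>4 x\<close> lies in \<open>L\<close>, as 4 maps the star defect from \<open>H0\<close> into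
  \<open>M1\<close> and twice each commutator lies in \<open>L\<close>. Since \<open>e x\<close>
  lies in \<open>L\<close> too and \<open>e\<close> is odd, so does \<open>x\<close>.\<close>

lemma lattice_of_odd_level:
  assumes L: "L \<in> Lattices" "level L e" and e: "odd e"
  shows "L = Lat e (L \<inter> H0)"
proof (intro equalityI subsetI)
  note L' = LatticesD[OF L(1)]
  fix x assume "x \<in> L"
  then show "x \<in> Lat e (L \<inter> H0)"
    using L' scale_level_H0[OF L] zsubmodule_scale_nat[OF L'(1)] by (auto simp: Lat_def)
next
  note L' = LatticesD[OF L(1)]
  fix x assume "x \<in> Lat e (L \<inter> H0)"
  then have x: "x \<in> Mst" "scale (of_nat e) x \<in> L" "scale (of_nat e) x \<in> H0"
    by (simp_all add: Lat_def)
  have e0: "e > 0" using e by (cases e) simp_all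
  have m: "scale (of_nat 2) z \<in> L" if "z \<in> L0" for z
    using double_L0_M1[OF that] L'(3) by auto
  have comm: "scale (of_nat 2) (x - pull (transpose 1 b) x) \<in> L" if b: "b \<in> V" "b \<noteq> 1" for b
  proof (rule commutator_in_lattice[OF L(1) e0 _ m x(1,3)])
    obtain y where y: "y \<in> L0" "scale (1 / of_nat e) (fan 1 b) + y \<in> L"
      by (rule fan_mod_L0[OF L, of 1 b]) (use b in auto)
    \<comment> \<open>Doubling removes the unknown part \<open>y\<close>, because twice an element
      of \<open>L0\<close> lies in \<open>M1\<close>.\<close>
    have "scale (of_nat 2) (scale (1 / of_nat e) (fan 1 b) + y) - scale (of_nat 2) y \<in> L"
      by (intro zsubmodule_diff L'(1) zsubmodule_scale_nat y m)
    then show "scale (of_nat 2 / of_nat e) (fan 1 b) \<in> L"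
      by (simp add: scale_distrib)
  qed (use b in auto)
  have "scale 4 (star_defect 1 x) \<in> L"
    using H0_quadruple star_defect_in_H0[OF x(1) V_small(1) odd_n_or_P[OF x(1) e x(3)]] L'(3) by blast
  moreover have "(\<Sum>b\<in>V - {1}. scale (of_nat 2) (scale (of_nat 2) (x - pull (transpose 1 b) x))) \<in> L"
    by (intro zsubmodule_sum L'(1) zsubmodule_scale_nat comm) auto
  ultimately have "scale 4 (star_defect 1 x)
      + (\<Sum>b\<in>V - {1}. scale (of_nat 2) (scale (of_nat 2) (x - pull (transpose 1 b) x))) \<in> L"
    by (rule zsubmodule_add[OF L'(1)])
  also have "scale 4 (star_defect 1 x)
      + (\<Sum>b\<in>V - {1}. scale (of_nat 2) (scale (of_nat 2) (x - pull (transpose 1 b) x))) = scale 4 x"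
    by (subst (4) star_defect_eq[of x 1]) (simp only: scale_distrib scale_sum scale_simps, simp)
  finally have "scale 4 x \<in> L" .
  then have "scale (of_int 4) x \<in> L" by simp
  moreover have "scale (of_int (int e)) x \<in> L" using x(2) by simp
  moreover have "coprime 4 (int e)" using e by (rule coprime_4_odd)
  ultimately show "x \<in> L" by (rule zsubmodule_scale_coprime[OF L'(1)])
qed

text \<open>The quotient of \<open>L0\<close> by \<open>M1\<close> has order 2, so permutations act
  trivially on it.\<close>

lemma pull_mod_M1:
  assumes p: "p permutes V" and y: "y \<in> L0"
  shows "pull p y - y \<in> M1"
proof (cases "y \<in> M1")
  case True
  then show ?thesis by (intro zsubmodule_diff M1_zsubmodule invariantD[OF M1_invariant p])
next
  case False
  have "pull p y \<notin> M1"
  proof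
    assume "pull p y \<in> M1"
    then have "pull (inv_into UNIV p) (pull p y) \<in> M1"
      by (rule invariantD[OF M1_invariant permutes_inv[OF p]])
    moreover have "pull (inv_into UNIV p) (pull p y) = y"
      by (rule ext) (simp add: pull_def permutes_inverses[OF p] split: prod.split)
    ultimately show False using False by simp
  qed
  then show ?thesis
    using L0_mod_M1[OF invariantD[OF L0_invariant p y] y False] by blast
qed

text \<open>The error term \<open>y\<close> of \<open>fan_mod_L0\<close> can be chosen the same for
  all pairs, since permutations act trivially on \<open>L0\<close> modulo \<open>M1\<close>. Summing
  over \<open>b\<close> kills the fans and leaves \<open>(n - 1) y\<close> with \<open>n - 1\<close>
  odd, so \<open>y\<close> lies in \<open>L\<close>. Then three fans around a triangle put
  \<open>n / e\<close> times the triangle into \<open>L\<close>, and \<open>n / e\<close> is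
  odd.\<close>

lemma even_level_contains:
  assumes n: "n mod 4 = 2" and L: "L \<in> Lattices" "level L e" and e: "even e" "e dvd n"
  shows "L0 \<subseteq> L" and "\<And>a b. a \<in> V \<Longrightarrow> b \<in> V \<Longrightarrow> a \<noteq> b \<Longrightarrow> scale (1 / of_nat e) (fan a b) \<in> L"
proof -
  note L' = LatticesD[OF L(1)]
  have e0: "e > 0" using L(2) by (simp add: level_def)
  obtain y where y: "y \<in> L0" "scale (1 / of_nat e) (fan 1 2) + y \<in> L"
    by (rule fan_mod_L0[OF L, of 1 2]) auto
  have dbl: "scale 2 z \<in> L" if "z \<in> L0" for z
    using double_L0_M1[OF that] L'(3) by blast
  have fan: "scale (1 / of_nat e) (fan a b) + y \<in> L" if ab: "a \<in> V" "b \<in> V" "a \<noteq> b" for a b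
  proof -
    obtain c where abc: "distinct [a, b, c]" "{a, b, c} \<subseteq> V" by (rule obtain_third[OF ab])
    obtain f where f: "f permutes V" "f a = 1" "f b = 2" "f c = 3"
      by (rule exists_permutes3[OF abc, of 1 2 3]) simp_all
    have inv: "inv_into UNIV f 1 = a" "inv_into UNIV f 2 = b"
      using f permutes_inv_eq[OF f(1)] by blast+
    have "pull f y - y \<in> L" using L'(3) pull_mod_M1[OF f(1) y(1)] by blast
    then have "pull f (scale (1 / of_nat e) (fan 1 2) + y) - (pull f y - y) \<in> L"
      by (rule zsubmodule_diff[OF L'(1) invariantD[OF L'(2) f(1) y(2)]])
    then show ?thesis unfolding pull_linear pull_fan[OF f(1)] inv by simp
  qed
  obtain r where r: "n = e * r" using e(2) by (elim dvdE)
  have "odd r" by (rule odd_quotient[OF n e(1) r])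
  then obtain s where s: "r = 2 * s + 1" by (elim oddE)
  let ?t = "tri 1 2 3 :: nat \<times> nat \<Rightarrow> rat"
  have t: "?t \<in> L0" "?t \<notin> M1" by (rule tri_in_L0, simp) (rule tri_not_in_M1, simp_all)
  have y_in: "y \<in> L"
  proof -
    have "(\<Sum>b\<in>V - {1}. scale (1 / of_nat e) (fan 1 b) + y) \<in> L"
      by (intro zsubmodule_sum L'(1) fan) auto
    also have "(\<Sum>b\<in>V - {1}. scale (1 / of_nat e) (fan 1 b) + y)
        = scale (1 / of_nat e) (\<Sum>b\<in>V - {1}. fan 1 b) + (\<Sum>b\<in>V - {1}. y)"
      by (simp add: sum.distrib scale_sum)
    also have "\<dots> = scale (of_int (int (n - 1))) y"
      unfolding sum_fan[OF V_small(1)] by (rule ext) (simp add: sum_fun_apply card_Diff_subset)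
    finally have "scale (of_int (int (n - 1))) y \<in> L" .
    moreover have "scale (of_int 2) y \<in> L" using dbl[OF y(1)] by simp
    moreover have "coprime (int (n - 1)) 2"
    proof -
      have "odd (n - 1)" using n n_ge by presburger
      then show ?thesis by simp
    qed
    ultimately show ?thesis by (rule zsubmodule_scale_coprime[OF L'(1)])
  qed
  have fan': "scale (1 / of_nat e) (fan a b) \<in> L" if "a \<in> V" "b \<in> V" "a \<noteq> b" for a b
    using zsubmodule_diff[OF L'(1) fan[OF that] y_in] by simp
  then show "\<And>a b. a \<in> V \<Longrightarrow> b \<in> V \<Longrightarrow> a \<noteq> b \<Longrightarrow> scale (1 / of_nat e) (fan a b) \<in> L" .
  have "?t \<in> L"
  proof -
    have "scale (1 / of_nat e) (fan 1 2) + scale (1 / of_nat e) (fan 2 3) + scale (1 / of_nat e) (fan 3 1)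
        - scale (of_nat s) (scale 2 ?t) \<in> L"
      by (intro zsubmodule_diff zsubmodule_add L'(1) fan' zsubmodule_scale_nat dbl t) simp_all
    also have "scale (1 / of_nat e) (fan 1 2) + scale (1 / of_nat e) (fan 2 3) + scale (1 / of_nat e) (fan 3 1)
        = scale (1 / of_nat e) (scale (of_nat n) ?t)"
      by (simp only: fan_cycle[symmetric] scale_distrib)
    also have "\<dots> = scale (of_nat r) ?t" using e0 by (simp add: r)
    also have "scale (of_nat r) ?t - scale (of_nat s) (scale 2 ?t) = ?t"
      by (rule ext) (simp add: s algebra_simps)
    finally show ?thesis .
  qed
  then show "L0 \<subseteq> L" by (rule L0_subset_if[OF L'(1,3) _ t])
qed

text \<open>Now the commutators lie in \<open>L\<close> without an additional factor, and for
  elements of \<open>P\<close> so does the star defect, because \<open>H0\<close> is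
  \<open>L0\<close> for even \<open>n\<close>. As \<open>P\<close> has index at most 2 in
  \<open>Mst\<close>, one element of \<open>L\<close> outside \<open>P\<close> yields the rest of
  \<open>Lat e L0\<close>.\<close>

lemma lattice_of_even_level:
  assumes n: "n mod 4 = 2" and L: "L \<in> Lattices" "level L e" and e: "even e" "e dvd n"
  shows "L = Lat e L0 \<or> L = Lat e L0 \<inter> P"
proof -
  note L' = LatticesD[OF L(1)] and L0L = even_level_contains[OF assms]
  have e0: "e > 0" using L(2) by (simp add: level_def)
  have "even n" using n by presburger
  then have H0: "H0 = L0" by (rule H0_eq_L0)
  have sub: "L \<subseteq> Lat e L0"
    using scale_level_H0[OF L] L'(4) by (auto simp: Lat_def H0)
  have P: "Lat e L0 \<inter> P \<subseteq> L"
  proof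
    fix x assume "x \<in> Lat e L0 \<inter> P"
    then have x: "x \<in> Mst" "scale (of_nat e) x \<in> H0" "x \<in> P" by (simp_all add: Lat_def H0)
    have "scale (of_nat 1) (x - pull (transpose 1 b) x) \<in> L" if b: "b \<in> V" "b \<noteq> 1" for b
      by (rule commutator_in_lattice[OF L(1) e0 _ _ x(1,2)]) (use L0L b in auto)
    then have "(\<Sum>b\<in>V - {1}. x - pull (transpose 1 b) x) \<in> L"
      by (intro zsubmodule_sum L'(1)) auto
    moreover have "star_defect 1 x \<in> L"
      using star_defect_in_H0[OF x(1) V_small(1)] x(3) L0L(1) by (auto simp: H0)
    ultimately show "x \<in> L"
      by (subst star_defect_eq[of x 1]) (intro zsubmodule_add L'(1))
  qed
  show ?thesis
  proof (cases "L \<subseteq> P")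
    case True
    then show ?thesis using sub P by blast
  next
    case False
    then obtain z where z: "z \<in> L" "z \<notin> P" by blast
    have "x \<in> L" if x: "x \<in> Lat e L0" for x
    proof (cases "x \<in> P")
      case False
      have lat: "Lat e L0 \<in> Lattices" by (rule Lat_lattice[OF L0_lattice])
      have "x - z \<in> Lat e L0"
        by (intro zsubmodule_diff LatticesD(1)[OF lat] x) (use z sub in auto)
      moreover have "x - z \<in> P"
        by (rule Mst_diff_P) (use x z False L' in \<open>auto simp: Lat_def\<close>)
      ultimately have "(x - z) + z \<in> L" using P z by (intro zsubmodule_add L'(1)) auto
      then show ?thesis by simp
    qed (use P x in auto)
    then show ?thesis using sub by blast
  qed
qed

section \<open>Every divisor of the degree occurs as a level\<close>

lemma tri_sum_fan:
  assumes "{p, q, r} \<subseteq> V"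
  shows "tri_sum (fan a b) p q r = of_nat n * tri_sum (arc a b) p q r"
  using assms by (simp add: tri_sum_def fan_apply algebra_simps)

text \<open>Triangle sums of a fan are multiples of \<open>n\<close> and remain integral after
  division by \<open>e\<close>.\<close>

lemma fan_over_level_in_P:
  assumes "e > 0" "e dvd n" "a \<in> V" "b \<in> V"
  shows "scale (1 / of_nat e) (fan a b) \<in> P"
proof -
  obtain r where r: "n = e * r" using assms(2) by (elim dvdE)
  have "tri_sum (scale (1 / of_nat e) (fan a b)) p q s \<in> \<int>"
    if "distinct [p, q, s]" "{p, q, s} \<subseteq> V" for p q s
  proof -
    have "tri_sum (scale (1 / of_nat e) (fan a b)) p q s = of_nat r * tri_sum (arc a b) p q s"
      unfolding tri_sum_linear tri_sum_fan[OF that(2)] using assms(1) by (simp add: r)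
    also have "\<dots> \<in> \<int>" by (simp add: tri_sum_def arc_Ints)
    finally show ?thesis .
  qed
  moreover have "scale (1 / of_nat e) (fan a b) \<in> W"
    by (intro W_scale L0_W fan_in_L0 assms)
  ultimately show ?thesis unfolding P_def by blast
qed

lemma fan_14: "fan 1 4 (1, 3) - fan 1 4 (2, 3) = - 1"
  using fan_apply[of 1 3 1 4] fan_apply[of 2 3 1 4] by (simp add: arc_def)

lemma level_Lat_odd:
  assumes K: "K \<in> Lattices" "K \<subseteq> H0" and e: "odd e" "e dvd n"
  shows "level (Lat e K) e"
proof -
  have e0: "e > 0" using e by (cases e) simp_all
  have lat: "Lat e K \<in> Lattices" by (rule Lat_lattice[OF K(1)])
  obtain j where j: "e = 2 * j + 1" using e(1) by (elim oddE)
  let ?q = "quad 1 3 4 5 :: nat \<times> nat \<Rightarrow> rat"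
  \<comment> \<open>The factor 2 brings the fan into \<open>M1\<close>, hence into every
    \<open>K\<close>. Each copy of \<open>?w\<close> contributes \<open>- 2 / e\<close>, so
    \<open>j\<close> copies reduce the difference 1 of \<open>?q\<close> to \<open>1 / e\<close>, as
    \<open>e = 2 * j + 1\<close>.\<close>
  let ?w = "scale 2 (scale (1 / of_nat e) (fan 1 4))"
  let ?x = "?q + scale (of_nat j) ?w"
  have "?w \<in> Mst"
    using zsubmodule_scale_nat[OF P_zsubmodule fan_over_level_in_P[OF e0 e(2), of 1 4], of 2]
      P_subset_Mst by auto
  moreover have "scale (of_nat e) ?w = scale 2 (fan 1 4)" using e0 by simp
  moreover have "scale 2 (fan 1 4) \<in> K"
    using double_L0_M1[OF fan_in_L0[of 1 4]] LatticesD(3)[OF K(1)] by auto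
  ultimately have "?w \<in> Lat e K" by (simp add: Lat_def)
  moreover have "?q \<in> Lat e K" using quad_1345 LatticesD(3)[OF lat] by blast
  ultimately have x: "?x \<in> Lat e K"
    by (intro zsubmodule_add zsubmodule_scale_nat LatticesD(1)[OF lat])
  have "?x (1, 3) - ?x (2, 3) = (?q (1, 3) - ?q (2, 3))
      + of_nat j * (2 * (1 / of_nat e * (fan 1 4 (1, 3) - fan 1 4 (2, 3))))"
    by (simp add: algebra_simps)
  also have "\<dots> = 1 - of_nat j * 2 / of_nat e"
    by (simp only: quad_1345 fan_14) simp
  also have "\<dots> = 1 / of_nat e" using e0 by (simp add: field_simps j)
  finally show ?thesis
    using K(2) by (intro level_I[OF lat e0 _ x]) (auto simp: Lat_def)
qed

lemma level_Lat_even: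
  assumes n: "even n" and e: "e > 0" "e dvd n"
  shows "level (Lat e L0) e" "level (Lat e L0 \<inter> P) e"
proof -
  have H0: "H0 = L0" using n by (rule H0_eq_L0)
  define w where "w = scale (- 1) (scale (1 / of_nat e) (fan 1 4))"
  have lat: "Lat e L0 \<in> Lattices" "Lat e L0 \<inter> P \<in> Lattices"
    by (intro Int_lattice Lat_lattice L0_lattice P_lattice)+
  have "w \<in> P"
    using zsubmodule_scale_int[OF P_zsubmodule fan_over_level_in_P[OF e, of 1 4], of "- 1"]
    by (simp add: w_def)
  moreover have "scale (of_nat e) w = scale (of_int (- 1)) (fan 1 4)" using e by (simp add: w_def)
  moreover have "scale (of_int (- 1)) (fan 1 4) \<in> L0"
    by (intro zsubmodule_scale_int L0_zsubmodule fan_in_L0) simp_all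
  ultimately have w: "w \<in> Lat e L0 \<inter> P" using P_subset_Mst by (auto simp: Lat_def)
  have "w (1, 3) - w (2, 3) = - (1 / of_nat e * (fan 1 4 (1, 3) - fan 1 4 (2, 3)))"
    by (simp add: w_def algebra_simps)
  also have "\<dots> = 1 / of_nat e" unfolding fan_14 by simp
  finally have v: "w (1, 3) - w (2, 3) = 1 / of_nat e" .
  show "level (Lat e L0) e"
    using w by (intro level_I[OF lat(1) e(1) _ _ v]) (auto simp: Lat_def H0)
  show "level (Lat e L0 \<inter> P) e"
    using w by (intro level_I[OF lat(2) e(1) _ _ v]) (auto simp: Lat_def H0)
qed

text \<open>Four times an element of \<open>H0\<close> lies in \<open>M1\<close>, hence in
  \<open>K\<close>, and 4 is coprime to \<open>e\<close>.\<close>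

lemma Lat_Int_H0:
  assumes K: "K \<in> Lattices" "K \<subseteq> H0" and e: "odd e"
  shows "Lat e K \<inter> H0 = K"
proof (intro equalityI subsetI)
  note K' = LatticesD[OF K(1)]
  fix x assume x: "x \<in> Lat e K \<inter> H0"
  then have "scale (of_int 4) x \<in> K" using H0_quadruple[of x] K'(3) by auto
  moreover have "scale (of_int (int e)) x \<in> K" using x by (simp add: Lat_def)
  moreover have "coprime 4 (int e)" using e by (rule coprime_4_odd)
  ultimately show "x \<in> K" by (rule zsubmodule_scale_coprime[OF K'(1)])
next
  note K' = LatticesD[OF K(1)]
  fix x assume "x \<in> K"
  then show "x \<in> Lat e K \<inter> H0"
    using K K' zsubmodule_scale_nat[OF K'(1)] by (auto simp: Lat_def)
qed

text \<open>It shows that a lattice with a half-integral flow contains an odd integral flow, hence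
  all of \<open>L0\<close>. The commutator is a combination of the triangles
  \<open>tri 1 c 2\<close>. Its coefficients are integers and add up, by the row sums, to
  \<open>- 2 * h (1, 2)\<close>, which is odd.\<close>

lemma half_commutator:
  assumes h: "h \<in> W" and half: "\<And>a b. a \<in> V \<Longrightarrow> b \<in> V \<Longrightarrow> a \<noteq> b \<Longrightarrow> h (a, b) \<in> half_Ints"
  shows "h - pull (transpose 1 2) h \<in> L0" "h - pull (transpose 1 2) h \<notin> M1"
proof -
  let ?y = "h - pull (transpose 1 2) h"
  let ?s = "\<Sum>c\<in>V - {1, 2}. scale (h (1, c) - h (2, c)) (tri 1 c 2)"
  have yW: "?y \<in> W"
    by (intro zsubmodule_diff W_zsubmodule h invariantD[OF W_invariant] permutes_swap_id) simp_all
  have sW: "?s \<in> W"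
    by (intro zsubmodule_sum W_zsubmodule W_scale tri_in_W) auto
  have eq: "?y = ?s"
  proof (rule W_eqI[OF yW sW, of 1])
    fix i j :: nat assume ij: "i < j" "i \<in> V - {1}" "j \<in> V - {1}"
    then have i: "i \<ge> 2" "j > 2" by (auto simp: V_def)
    have "?s (i, j) = (\<Sum>c\<in>V - {1, 2}. (h (1, c) - h (2, c)) * tri 1 c 2 (i, j))"
      by (simp add: sum_fun_apply)
    also have "\<dots> = (\<Sum>c\<in>V - {1, 2}. if c = j then (if i = 2 then h (2, j) - h (1, j) else 0) else 0)"
      using i ij by (intro sum.cong refl) (auto simp: tri_def arc_def)
    also have "\<dots> = (if i = 2 then h (2, j) - h (1, j) else 0)"
      using i ij by simp
    also have "\<dots> = ?y (i, j)"
      using i ij by (auto simp: transpose_def)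
    finally show "?y (i, j) = ?s (i, j)" ..
  qed
  show "?y \<in> L0"
    unfolding eq
    by (intro zsubmodule_sum L0_zsubmodule zsubmodule_scale tri_in_L0 half_diff half) auto
  have par: "parity (tri 1 c 2) = - 1" if "c \<in> V - {1, 2}" for c
  proof -
    have "c > 2" using that by (auto simp: V_def)
    then show ?thesis
      using that parity_arc[of 1 c] parity_arc[of c 2] parity_arc[of 2 1]
      by (simp add: tri_def parity_linear)
  qed
  have row: "(\<Sum>c\<in>V - {1, 2}. h (a, c)) = - h (a, 1) - h (a, 2)" if "a \<in> V" for a
  proof -
    have "(\<Sum>c\<in>V. h (a, c)) = h (a, 1) + (h (a, 2) + (\<Sum>c\<in>V - {1} - {2}. h (a, c)))"
      by (subst sum.remove[of V 1], simp, simp, subst sum.remove[of "V - {1}" 2]) simp_all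
    moreover have "V - {1} - {2} = V - {1, 2}" by auto
    ultimately show ?thesis using W_row[OF h, of a] by (simp add: algebra_simps)
  qed
  have "parity ?s = (\<Sum>c\<in>V - {1, 2}. (h (1, c) - h (2, c)) * parity (tri 1 c 2))"
  proof -
    have "parity (\<Sum>c\<in>A. f c) = (\<Sum>c\<in>A. parity (f c))" for A :: "nat set" and f
      unfolding parity_def sum_fun_apply by (rule sum.swap)
    then show ?thesis by (simp add: parity_linear)
  qed
  also have "\<dots> = (\<Sum>c\<in>V - {1, 2}. h (2, c) - h (1, c))"
    by (intro sum.cong refl) (simp add: par del: One_nat_def)
  also have "\<dots> = 2 * h (1, 2)"
    using W_anti[OF h, of 2 1] by (simp add: sum_subtractf row W_diag[OF h] del: One_nat_def)
  finally have "parity ?y / 2 = h (1, 2)" unfolding eq by simp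
  moreover have "h (1, 2) \<notin> \<int>" by (intro half_not_Int half) simp_all
  ultimately show "?y \<notin> M1" by (simp add: M1_def)
qed

text \<open>Each step of the chain \<open>M1\<close>, \<open>L0\<close>, \<open>H0\<close> has index
  at most 2. By \<open>half_commutator\<close>, a lattice that is not contained in \<open>L0\<close>
  contains \<open>L0\<close>, so nothing lies beside the chain.\<close>

lemma lattices_in_H0:
  assumes K: "K \<in> Lattices" "K \<subseteq> H0"
  shows "K = M1 \<or> K = L0 \<or> K = H0"
proof (cases "K \<subseteq> L0")
  case True
  note K' = LatticesD[OF K(1)]
  show ?thesis
  proof (cases "K \<subseteq> M1")
    case False
    then obtain y where y: "y \<in> K" "y \<notin> M1" by blast
    then have "L0 \<subseteq> K" using True by (intro L0_subset_if[OF K'(1,3)]) auto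
    then show ?thesis using True by blast
  qed (use K' in auto)
next
  case False
  note K' = LatticesD[OF K(1)]
  obtain h where h: "h \<in> K" "h \<notin> L0" using False by blast
  have H0: "y \<in> L0 \<or> (y \<in> W \<and> (\<forall>a\<in>V. \<forall>b\<in>V. a \<noteq> b \<longrightarrow> y (a, b) \<in> half_Ints))"
    if "y \<in> H0" for y
    using that unfolding H0_iff L0_def by blast
  have hW: "h \<in> W" and half: "\<And>a b. a \<in> V \<Longrightarrow> b \<in> V \<Longrightarrow> a \<noteq> b \<Longrightarrow> h (a, b) \<in> half_Ints"
    using H0[of h] h K(2) by blast+
  have "h - pull (transpose 1 2) h \<in> K"
    by (intro zsubmodule_diff K'(1) h invariantD[OF K'(2)] permutes_swap_id) simp_all
  then have L0K: "L0 \<subseteq> K"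
    by (rule L0_subset_if[OF K'(1,3) _ half_commutator[OF hW half]])
  have "y \<in> K" if "y \<in> H0" for y
  proof (cases "y \<in> L0")
    case False
    then have half': "y (a, b) \<in> half_Ints" if "a \<in> V" "b \<in> V" "a \<noteq> b" for a b
      using H0[OF \<open>y \<in> H0\<close>] that by blast
    have "y - h \<in> W"
      by (intro zsubmodule_diff W_zsubmodule hW Mst_W H0_Mst that)
    moreover have "(y - h) (a, b) \<in> \<int>" for a b
    proof (cases "a \<in> V \<and> b \<in> V \<and> a \<noteq> b")
      case True
      then show ?thesis using half_diff[OF half'[of a b] half[of a b]] by simp
    next
      case False
      then show ?thesis
        using W_out[OF \<open>y - h \<in> W\<close>, of a b] W_out'[OF \<open>y - h \<in> W\<close>, of b a] W_diag[OF \<open>y - h \<in> W\<close>, of a]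
        by fastforce
    qed
    ultimately have "y - h \<in> L0" by (auto simp: L0_def)
    then have "(y - h) + h \<in> K" using L0K by (intro zsubmodule_add K'(1) h) auto
    then show ?thesis by simp
  qed (use L0K in auto)
  then show ?thesis using K(2) by blast
qed

lemma M1_neq_L0: "M1 \<noteq> L0"
proof -
  have "tri 1 2 3 \<in> L0" by (rule tri_in_L0) simp
  moreover have "tri 1 2 3 \<notin> M1" by (rule tri_not_in_M1) simp_all
  ultimately show ?thesis by blast
qed

text \<open>The witness is half the projection to the flows of the transitive tournament.\<close>

lemma Mst_neq_P: "\<exists>h\<in>Mst. h \<notin> P"
proof -
  let ?A = "{(a, b). a \<in> V \<and> b \<in> V \<and> a < b}"
  define h where "h = scale (1 / of_nat (2 * n)) (\<Sum>(a, b)\<in>?A. fan a b)"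
  define u :: "nat \<Rightarrow> nat \<Rightarrow> int" where "u i j = (if i < j then 1 else - 1)" for i j
  have fin: "finite ?A" by (rule finite_subset[of _ "V \<times> V"]) auto
  have hW: "h \<in> W"
    unfolding h_def by (intro W_scale zsubmodule_sum W_zsubmodule) (auto intro: L0_W fan_in_L0)
  have tour: "(\<Sum>(a, b)\<in>?A. arc a b (i, j)) = of_int (u i j)" if "i \<in> V" "j \<in> V" "i \<noteq> j" for i j
  proof -
    have "arc a b (i, j) = of_bool ((a, b) = (i, j)) - of_bool ((a, b) = (j, i))" for a b
      unfolding arc_def by (intro arg_cong2[where f = minus] arg_cong[where f = of_bool]) auto
    then have "(\<Sum>(a, b)\<in>?A. arc a b (i, j)) = (\<Sum>z\<in>?A. of_bool (z = (i, j)) - of_bool (z = (j, i)))"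
      by (simp only: split_def prod.collapse)
    also have "\<dots> = of_bool ((i, j) \<in> ?A) - of_bool ((j, i) \<in> ?A)"
      using fin by (simp add: sum_subtractf of_bool_def)
    also have "\<dots> = of_int (u i j)" using that by (auto simp: u_def)
    finally show ?thesis .
  qed
  have tri: "tri_sum h p q r = of_int (u p q + u q r + u r p) / 2"
    if pqr: "distinct [p, q, r]" "{p, q, r} \<subseteq> V" for p q r
  proof -
    have "tri_sum h p q r = 1 / of_nat (2 * n) * (\<Sum>(a, b)\<in>?A. tri_sum (fan a b) p q r)"
      by (simp add: h_def tri_sum_def sum_fun_apply sum.distrib[symmetric] sum_distrib_left
          split_def algebra_simps)
    also have "(\<Sum>(a, b)\<in>?A. tri_sum (fan a b) p q r) = (\<Sum>(a, b)\<in>?A. of_nat n * tri_sum (arc a b) p q r)"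
      by (intro sum.cong refl) (simp add: tri_sum_fan[OF pqr(2)] split_def)
    also have "\<dots> = of_nat n * ((\<Sum>(a, b)\<in>?A. arc a b (p, q)) + (\<Sum>(a, b)\<in>?A. arc a b (q, r))
        + (\<Sum>(a, b)\<in>?A. arc a b (r, p)))"
      by (simp add: tri_sum_def sum.distrib[symmetric] sum_distrib_left split_def)
    also have "\<dots> = of_nat n * of_int (u p q + u q r + u r p)"
      using pqr by (simp add: tour)
    finally show ?thesis using n_ge by simp
  qed
  \<comment> \<open>A sum of three terms 1 or -1 is odd, so the triangle sums are half-integers; a
    4-cycle consists of two triangles, and its sum is an integer.\<close>
  have odd: "odd (u p q + u q r + u r p)" for p q r by (simp add: u_def)
  have "quad_sum h a b c d \<in> \<int>" if "distinct [a, b, c, d]" "{a, b, c, d} \<subseteq> V" for a b c d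
  proof -
    have "quad_sum h a b c d = of_int ((u a b + u b c + u c a) + (u a c + u c d + u d a)) / 2"
      unfolding quad_sum_eq_tri_sum[OF hW] using that tri[of a b c] tri[of a c d]
      by (simp add: add_divide_distrib)
    moreover have "even ((u a b + u b c + u c a) + (u a c + u c d + u d a))" using odd by simp
    ultimately show ?thesis by (simp only: Ints_half_even)
  qed
  then have "h \<in> Mst" using hW unfolding Mst_def by blast
  moreover have eq: "tri_sum h 1 2 3 = of_int (u 1 2 + u 2 3 + u 3 1) / 2"
    by (rule tri) simp_all
  have "tri_sum h 1 2 3 \<notin> \<int>"
    unfolding eq by (rule Ints_half_odd[OF odd])
  then have "h \<notin> P" using PD[of h 1 2 3] by auto
  ultimately show ?thesis by blast
qed

section \<open>Distinctness and number of the lattices\<close>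

lemma scale_n_Mst: "h \<in> Mst \<Longrightarrow> scale (of_nat n) h \<in> H0"
proof -
  assume h: "h \<in> Mst"
  have "scale (of_nat n) h \<in> Mst" by (intro zsubmodule_scale_nat Mst_zsubmodule h)
  moreover have "scale (of_nat n) h (a, c) - scale (of_nat n) h (b, c) \<in> \<int>"
    if "distinct [a, b, c]" "{a, b, c} \<subseteq> V" for a b c
    using Mst_n_diff[OF h that] by (simp add: algebra_simps)
  ultimately show ?thesis unfolding H0_def by blast
qed

lemma scale_odd_not_P:
  assumes "h \<in> Mst" "h \<notin> P" "odd r"
  shows "scale (of_nat r) h \<notin> P"
proof
  assume "scale (of_nat r) h \<in> P"
  then have "tri_sum (scale (of_nat r) h) 1 2 3 \<in> \<int>" by (rule PD) simp_all
  moreover have "of_int (int r) * tri_sum h 1 2 3 \<in> half_Ints"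
    by (intro half_odd_mult Mst_not_P assms) (use assms in simp_all)
  ultimately show False using half_not_Int by (simp add: tri_sum_linear)
qed

text \<open>For \<open>h\<close> in \<open>Mst\<close> but not in \<open>P\<close>, \<open>n\<close>
  times \<open>h\<close> lies in \<open>H0\<close> and, \<open>n\<close> being odd, still outside
  \<open>P\<close>.\<close>

lemma L0_neq_H0: "odd n \<Longrightarrow> L0 \<noteq> H0"
  using Mst_neq_P scale_n_Mst scale_odd_not_P L0_subset_P by blast

text \<open>With \<open>n = e * r\<close> and \<open>r\<close> odd, \<open>r\<close> times an
  element of \<open>Mst\<close> outside \<open>P\<close> stays outside \<open>P\<close>, while
  \<open>n\<close> times it lies in \<open>L0\<close>.\<close>

lemma Lat_not_subset_P:
  assumes n: "n mod 4 = 2" and e: "even e" "e dvd n"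
  shows "Lat e L0 \<noteq> Lat e L0 \<inter> P"
proof -
  obtain h where h: "h \<in> Mst" "h \<notin> P" using Mst_neq_P by blast
  obtain r where r: "n = e * r" using e(2) by (elim dvdE)
  have "odd r" by (rule odd_quotient[OF n e(1) r])
  then have "scale (of_nat r) h \<notin> P" by (intro scale_odd_not_P h)
  moreover have "scale (of_nat r) h \<in> Lat e L0"
    unfolding Lat_def
  proof (intro CollectI conjI)
    show "scale (of_nat r) h \<in> Mst" by (intro zsubmodule_scale_nat Mst_zsubmodule h)
    show "scale (of_nat e) (scale (of_nat r) h) \<in> L0"
    proof -
      have "even n" using n by presburger
      then show ?thesis using scale_n_Mst[OF h(1)] H0_eq_L0 by (simp add: r)
    qed
  qed
  ultimately show ?thesis by blast
qed

text \<open>The level recovers \<open>e\<close> from \<open>Lat e K\<close>, and the intersection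
  with \<open>H0\<close> recovers \<open>K\<close>.\<close>

lemma card_Lattices_odd:
  assumes n: "odd n"
  shows "card Lattices = 3 * card {m. m > 0 \<and> m dvd n}"
proof -
  let ?D = "{m. m > 0 \<and> m dvd n}" and ?K = "{M1, L0, H0}"
  let ?F = "\<lambda>(e, K). Lat e K"
  have K: "K \<in> Lattices" "K \<subseteq> H0" if "K \<in> ?K" for K
    using that M1_lattice L0_lattice H0_lattice M1_subset_L0 L0_subset_H0 by auto
  have odd: "odd e" if "e dvd n" for e using that n by (meson dvd_trans)
  have inj: "inj_on ?F (?D \<times> ?K)"
  proof (rule inj_onI, clarify)
    fix e K e' K' assume *: "e > 0" "e dvd n" "e' > 0" "e' dvd n" "K \<in> ?K" "K' \<in> ?K" "Lat e K = Lat e' K'"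
    have "level (Lat e K) e" by (intro level_Lat_odd K odd *)
    moreover have "level (Lat e' K') e'" by (intro level_Lat_odd K odd *)
    ultimately have "e = e'" using *(7) level_unique by simp
    moreover have "Lat e K \<inter> H0 = K" by (intro Lat_Int_H0 K odd *)
    moreover have "Lat e' K' \<inter> H0 = K'" by (intro Lat_Int_H0 K odd *)
    ultimately show "e = e' \<and> K = K'" using *(7) by blast
  qed
  have img: "?F ` (?D \<times> ?K) = Lattices"
  proof (intro equalityI subsetI)
    fix L assume L: "L \<in> Lattices"
    obtain e where e: "level L e" "e dvd n" by (rule exists_level[OF L])
    have "L = Lat e (L \<inter> H0)" by (rule lattice_of_odd_level[OF L e(1) odd[OF e(2)]])
    moreover have "L \<inter> H0 \<in> ?K"
      using lattices_in_H0[OF Int_lattice[OF L H0_lattice]] by blast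
    ultimately show "L \<in> ?F ` (?D \<times> ?K)"
      using e unfolding level_def by (intro image_eqI[of _ _ "(e, L \<inter> H0)"]) auto
  next
    fix L assume "L \<in> ?F ` (?D \<times> ?K)"
    then show "L \<in> Lattices" using Lat_lattice K(1) by auto
  qed
  have "card Lattices = card (?D \<times> ?K)" unfolding img[symmetric] by (rule card_image[OF inj])
  moreover have "M1 \<noteq> H0" using L0_neq_H0[OF n] M1_subset_L0 L0_subset_H0 by blast
  then have "card ?K = 3" using M1_neq_L0 L0_neq_H0[OF n] by simp
  ultimately show ?thesis by (simp add: card_cartesian_product)
qed

lemma card_Lattices_even:
  assumes n: "n mod 4 = 2"
  shows "card Lattices = 2 * card {m. m > 0 \<and> m dvd n}"
proof -
  let ?D = "{m. m > 0 \<and> m dvd n}"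
  \<comment> \<open>There are two lattices for each level, also for odd \<open>e\<close> because
    \<open>H0\<close> is \<open>L0\<close> here; \<open>b\<close> selects the larger one.\<close>
  let ?F = "\<lambda>(e, b). if odd e then Lat e (if b then L0 else M1)
    else if b then Lat e L0 else Lat e L0 \<inter> P"
  have even: "even n" using n by presburger
  have H0: "H0 = L0" using even by (rule H0_eq_L0)
  have lat: "?F (e, b) \<in> Lattices" for e b
    using Lat_lattice Int_lattice P_lattice M1_lattice L0_lattice by simp
  have level: "level (?F (e, b)) e" if "e > 0" "e dvd n" for e b
    using that level_Lat_odd[OF M1_lattice, of e] level_Lat_odd[OF L0_lattice, of e]
      level_Lat_even[OF even] M1_subset_L0 H0 by simp
  have inj: "inj_on ?F (?D \<times> UNIV)"
  proof (rule inj_onI)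
    fix z z' assume z: "z \<in> ?D \<times> UNIV" "z' \<in> ?D \<times> UNIV" "?F z = ?F z'"
    obtain e b e' b' where z_eq: "z = (e, b)" "z' = (e', b')" by (cases z; cases z') blast
    then have *: "e > 0" "e dvd n" "e' > 0" "e' dvd n" and eq: "?F (e, b) = ?F (e', b')"
      using z by auto
    have e: "e = e'" using level_unique[OF level[OF *(1,2), of b]] level[OF *(3,4), of b'] eq by simp
    have "?F (e, True) \<noteq> ?F (e, False)"
    proof (cases "odd e")
      case True
      have "Lat e L0 \<inter> H0 = L0" "Lat e M1 \<inter> H0 = M1"
        using True M1_subset_L0 H0 by (intro Lat_Int_H0 L0_lattice M1_lattice; simp)+
      then show ?thesis using True M1_neq_L0 by auto
    next
      case False
      then show ?thesis using Lat_not_subset_P[OF n _ *(2)] by simp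
    qed
    then have "b = b'" using eq unfolding e[symmetric] by (cases b; cases b') auto
    with e show "z = z'" by (simp add: z_eq)
  qed
  have img: "?F ` (?D \<times> UNIV) = Lattices"
  proof (intro equalityI subsetI)
    fix L assume L: "L \<in> Lattices"
    obtain e where e: "level L e" "e dvd n" by (rule exists_level[OF L])
    have "\<exists>b. L = ?F (e, b)"
    proof (cases "odd e")
      case True
      have "L = Lat e (L \<inter> H0)" by (rule lattice_of_odd_level[OF L e(1) True])
      moreover have "L \<inter> H0 = L0 \<or> L \<inter> H0 = M1"
        using lattices_in_H0[OF Int_lattice[OF L H0_lattice]] H0 by blast
      ultimately have "L = ?F (e, True) \<or> L = ?F (e, False)" using True by auto
      then show ?thesis by blast
    next
      case False
      then have "L = ?F (e, True) \<or> L = ?F (e, False)"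
        using lattice_of_even_level[OF n L e(1) _ e(2)] by simp
      then show ?thesis by blast
    qed
    then obtain b where "L = ?F (e, b)" ..
    then show "L \<in> ?F ` (?D \<times> UNIV)"
      using e unfolding level_def by (intro image_eqI[of _ _ "(e, b)"]) auto
  next
    fix L assume "L \<in> ?F ` (?D \<times> UNIV)"
    then show "L \<in> Lattices" using lat by auto
  qed
  have "card Lattices = card (?D \<times> (UNIV :: bool set))"
    unfolding img[symmetric] by (rule card_image[OF inj])
  then show ?thesis by (simp add: card_cartesian_product)
qed

subsection \<open>Schur's lemma and normalization\<close>

lemma quad_sum_quad:
  "distinct [a, b, c, d] \<Longrightarrow> quad_sum (quad a b c d) a b c d = 4"
  by (auto simp: quad_sum_def quad_def arc_def)

text \<open>A 4-cycle that shares a single arc with the cycle 1, 2, 3, 4, so that the sum 1 is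
  attained on \<open>M1\<close>.\<close>

lemma quad_sum_1253: "quad_sum (quad 1 2 5 3) 1 2 3 (4::nat) = 1"
  by (simp add: quad_sum_def quad_def arc_def)

lemma quad_transitive:
  assumes L: "invariant L" "scale c (quad p q r s) \<in> L" and pqrs: "distinct [p, q, r, s]" "{p, q, r, s} \<subseteq> V"
    and abcd: "distinct [a, b, c', d]" "{a, b, c', d} \<subseteq> V"
  shows "scale c (quad a b c' d) \<in> L"
proof -
  obtain f where f: "f permutes V" "f a = p" "f b = q" "f c' = r" "f d = s"
    by (rule exists_permutes4[OF abcd pqrs])
  have "inv_into UNIV f p = a" "inv_into UNIV f q = b" "inv_into UNIV f r = c'" "inv_into UNIV f s = d"
    using f permutes_inv_eq[OF f(1)] by blast+
  then have "pull f (scale c (quad p q r s)) = scale c (quad a b c' d)"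
    by (simp only: pull_linear pull_quad[OF f(1)])
  then show ?thesis using invariantD[OF L(1) f(1) L(2)] by simp
qed

text \<open>The sums around 4-cycles form a cyclic group with a generator \<open>g\<close>, which is
  not 0 by \<open>W_eq_0I\<close>, and division by \<open>g\<close> puts \<open>L\<close> into
  \<open>Mst\<close>. By \<open>quad_symmetrizer\<close>, an element with the sum \<open>g\<close>
  yields \<open>g\<close> times a 4-cycle in \<open>L\<close>; so after the division the lattice
  contains \<open>M1\<close>.\<close>

lemma normalize_lattice:
  assumes L: "zsubmodule L" "invariant L" "L \<subseteq> W" and x: "x \<in> L" "x \<noteq> 0"
    and N: "N > 0" "\<And>y. y \<in> L \<Longrightarrow> scale (of_nat N) y \<in> L0"
  obtains c where "c \<noteq> 0" "scale c ` L \<in> Lattices"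
proof -
  let ?U = "(\<lambda>y. quad_sum y 1 2 3 4) ` L"
  have "zsubmodule ?U" using L(1) by (rule zsubmodule_image) (rule quad_sum_linear)
  moreover note N(1)
  moreover have "of_nat N * y \<in> \<int>" if U: "y \<in> ?U" for y
  proof -
    obtain u where u: "u \<in> L" "y = quad_sum u 1 2 3 4" using U by blast
    have "quad_sum (scale (of_nat N) u) 1 2 3 4 \<in> \<int>"
      using N(2)[OF u(1)] unfolding L0_def quad_sum_def by (intro Ints_add) auto
    then show ?thesis by (simp add: u(2) quad_sum_linear)
  qed
  ultimately obtain g where g: "g \<ge> 0" "?U = range (\<lambda>k. g * of_int k)"
    by (rule zsubmodule_rat_principal)
  have quadU: "quad_sum y a b c d \<in> ?U" if y: "y \<in> L" and abcd: "distinct [a, b, c, d]" "{a, b, c, d} \<subseteq> V" for y a b c d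
  proof -
    obtain f where f: "f permutes V" "f 1 = a" "f 2 = b" "f 3 = c" "f 4 = d"
      by (rule exists_permutes4[of 1 2 3 4 a b c d]) (use abcd in simp_all)
    have "quad_sum y a b c d = quad_sum (pull f y) 1 2 3 4" by (simp only: quad_sum_linear f)
    then show ?thesis using invariantD[OF L(2) f(1) y] by (rule image_eqI)
  qed
  have "g \<noteq> 0"
  proof
    assume "g = 0"
    then have "?U = {0}" using g(2) by auto
    then have "quad_sum x a b c d = 0" if "distinct [a, b, c, d]" "{a, b, c, d} \<subseteq> V" for a b c d
      using quadU[OF x(1) that] by simp
    then have "x = 0" using x(1) L(3) by (intro W_eq_0I) auto
    with x show False by simp
  qed
  let ?L = "scale (1 / g) ` L"
  have L': "zsubmodule ?L" using L(1) by (rule zsubmodule_image) (rule scale_distrib)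
  moreover have inv: "invariant ?L"
    unfolding invariant_def
  proof (intro allI impI)
    fix p y assume p: "p permutes V" and "y \<in> ?L"
    then obtain u where "u \<in> L" "y = scale (1 / g) u" by blast
    then show "pull p y \<in> ?L"
      by (intro image_eqI[of _ _ "pull p u"] invariantD[OF L(2) p]) (simp_all add: pull_linear)
  qed
  moreover have "?L \<subseteq> Mst"
  proof
    fix y assume "y \<in> ?L"
    then obtain u where u: "u \<in> L" "y = scale (1 / g) u" by blast
    have "quad_sum y a b c d \<in> \<int>" if abcd: "distinct [a, b, c, d]" "{a, b, c, d} \<subseteq> V" for a b c d
    proof -
      obtain k where "quad_sum u a b c d = g * of_int k"
        using quadU[OF u(1) abcd] g(2) by auto
      then show ?thesis using \<open>g \<noteq> 0\<close> by (simp add: u(2) quad_sum_linear)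
    qed
    moreover have "y \<in> W" using u L(3) by (auto intro: W_scale)
    ultimately show "y \<in> Mst" unfolding Mst_def by blast
  qed
  moreover have "M1 \<subseteq> ?L"
  proof (rule M1_generated[OF L'])
    fix a b c d :: nat assume abcd: "distinct [a, b, c, d]" "{a, b, c, d} \<subseteq> V"
    have "g \<in> ?U" unfolding g(2) by (intro image_eqI[of _ _ 1]) simp_all
    then obtain u where u: "u \<in> L" "quad_sum u 1 2 3 4 = g" by auto
    have d: "distinct [1, 2, 3, 4 :: nat]" by simp
    have "u - pull (transpose 1 3) u - pull (transpose 2 4) u + pull (transpose 1 3 \<circ> transpose 2 4) u \<in> L"
      by (intro zsubmodule_add zsubmodule_diff L(1) u(1) invariantD[OF L(2)] permutes_swap_id permutes_compose)
        simp_all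
    then have "scale g (quad 1 2 3 4) \<in> L"
      using quad_symmetrizer[OF _ d, of u] u L(3) by auto
    then have "scale 1 (quad 1 2 3 4) \<in> ?L"
      using \<open>g \<noteq> 0\<close> by (intro image_eqI[of _ _ "scale g (quad 1 2 3 4)"]) simp_all
    then have "scale 1 (quad a b c d) \<in> ?L"
      by (rule quad_transitive[OF inv _ d _ abcd]) simp
    then show "quad a b c d \<in> ?L" by simp
  qed
  ultimately have "?L \<in> Lattices" by (simp add: Lattices_def)
  then show ?thesis using \<open>g \<noteq> 0\<close> by (intro that[of "1 / g"]) simp_all
qed

text \<open>
  Schur's lemma: an equivariant map is a scalar on the 4-cycle \<open>quad 1 2 3 4\<close> because that
  vector spans the image of the operator in \<open>quad_symmetrizer\<close>.
\<close>

lemma equivariant_scalar: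
  assumes L: "L \<in> Lattices"
    and gW: "\<And>x. x \<in> L \<Longrightarrow> g x \<in> W"
    and add: "\<And>x y. x \<in> L \<Longrightarrow> y \<in> L \<Longrightarrow> g (x + y) = g x + g y"
    and pull: "\<And>p x. p permutes V \<Longrightarrow> x \<in> L \<Longrightarrow> g (pull p x) = pull p (g x)"
  obtains c where "\<And>x. x \<in> L \<Longrightarrow> g x = scale c x"
proof -
  note L' = LatticesD[OF L]
  have g0: "g 0 = 0" using add[of 0 0] zsubmodule_0[OF L'(1)] by simp
  have diff: "g (x - y) = g x - g y" if "x \<in> L" "y \<in> L" for x y
    using add[OF zsubmodule_diff[OF L'(1) that] that(2)] by simp
  have nat: "g (scale (of_nat k) x) = scale (of_nat k) (g x)" if "x \<in> L" for k x
  proof (induction k)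
    case 0
    then show ?case by (simp only: of_nat_0 scale_simps g0)
  next
    case (Suc k)
    have "g (scale (of_nat (Suc k)) x) = g (x + scale (of_nat k) x)"
      by (simp only: of_nat_Suc scale_distrib scale_simps)
    also have "\<dots> = g x + scale (of_nat k) (g x)"
      by (simp only: add that zsubmodule_scale_nat[OF L'(1)] Suc.IH)
    also have "\<dots> = scale (of_nat (Suc k)) (g x)"
      by (simp only: of_nat_Suc scale_distrib scale_simps)
    finally show ?case .
  qed
  let ?q = "quad 1 2 3 4 :: nat \<times> nat \<Rightarrow> rat"
  define c where "c = quad_sum (g ?q) 1 2 3 4 / 4"
  have d: "distinct [1, 2, 3, 4 :: nat]" and dV: "{1, 2, 3, 4} \<subseteq> V" by simp_all
  have q: "?q \<in> L" using quad_in_M1[OF d dV] L'(3) by blast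
  have perm: "transpose 1 3 permutes V" "transpose 2 4 permutes V"
    "transpose 1 3 \<circ> transpose 2 4 permutes V"
    by (intro permutes_swap_id permutes_compose; simp)+
  have qW: "?q \<in> W" using q L'(4) Mst_W by blast
  \<comment> \<open>On \<open>?q\<close> the operator of \<open>quad_symmetrizer\<close> is
    multiplication by 4, and it commutes with \<open>g\<close>.\<close>
  have "scale (of_nat 4) (g ?q) = g (scale (of_nat 4) ?q)" by (rule nat[OF q, symmetric])
  also have "scale (of_nat 4) ?q = ?q - pull (transpose 1 3) ?q - pull (transpose 2 4) ?q
      + pull (transpose 1 3 \<circ> transpose 2 4) ?q"
    unfolding quad_symmetrizer[OF qW d] quad_sum_quad[OF d] by simp
  also have "g \<dots> = g ?q - pull (transpose 1 3) (g ?q) - pull (transpose 2 4) (g ?q)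
      + pull (transpose 1 3 \<circ> transpose 2 4) (g ?q)"
    using q invariantD[OF L'(2) perm(1) q] invariantD[OF L'(2) perm(2) q] invariantD[OF L'(2) perm(3) q]
    by (simp only: add diff zsubmodule_diff[OF L'(1)] pull[OF perm(1) q] pull[OF perm(2) q] pull[OF perm(3) q])
  also have "\<dots> = scale (quad_sum (g ?q) 1 2 3 4) ?q"
    by (rule quad_symmetrizer[OF gW[OF q] d])
  finally have "g ?q = scale (1 / of_nat 4) (scale (quad_sum (g ?q) 1 2 3 4) ?q)"
    by (subst (asm) scale_eq_iff) simp_all
  then have gq: "g ?q = scale c ?q"
    by (simp only: scale_simps c_def) simp
  let ?Z = "{x \<in> L. g x = scale c x}"
  have Z: "zsubmodule ?Z"
    using zsubmodule_0[OF L'(1)] zsubmodule_diff[OF L'(1)]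
    by (simp add: zsubmodule_def g0 diff scale_distrib)
  have Zinv: "invariant ?Z"
    using invariantD[OF L'(2)] by (simp add: invariant_def pull pull_linear)
  have "M1 \<subseteq> ?Z"
  proof (rule M1_generated[OF Z])
    fix a b c' d' :: nat assume abcd: "distinct [a, b, c', d']" "{a, b, c', d'} \<subseteq> V"
    have "scale 1 ?q \<in> ?Z" using q gq by simp
    then have "scale 1 (quad a b c' d') \<in> ?Z" by (rule quad_transitive[OF Zinv _ d dV abcd])
    then show "quad a b c' d' \<in> ?Z" by simp
  qed
  have "g x = scale c x" if x: "x \<in> L" for x
  proof -
    \<comment> \<open>The multiple of \<open>x\<close> by \<open>4 * n\<close> lies in
      \<open>M1\<close>, so the scalar found on the 4-cycles is valid on all of
      \<open>L\<close>.\<close>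
    have "scale (of_nat (2 * n)) x \<in> L0" using x L'(4) Mst_multiple by blast
    then have "scale 2 (scale (of_nat (2 * n)) x) \<in> ?Z" using double_L0_M1 \<open>M1 \<subseteq> ?Z\<close> by blast
    then have "g (scale (of_nat (4 * n)) x) = scale c (scale (of_nat (4 * n)) x)" by simp
    then have "scale (of_nat (4 * n)) (g x) = scale (of_nat (4 * n)) (scale c x)"
      unfolding nat[OF x] by (simp add: mult.commute)
    then have "scale (1 / of_nat (4 * n)) (scale (of_nat (4 * n)) (g x))
        = scale (1 / of_nat (4 * n)) (scale (of_nat (4 * n)) (scale c x))" by simp
    then show ?thesis using n_ge by simp
  qed
  then show ?thesis by (rule that)
qed

text \<open>By Schur's lemma \<open>g\<close> is multiplication by some \<open>c\<close>. On both
  lattices the sums around 4-cycles are exactly the integers, so \<open>c\<close> and its inverse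
  are integers.\<close>

lemma isomorphic_lattices_eq:
  assumes L: "L \<in> Lattices" and K: "K \<in> Lattices"
    and g: "g ` L = K"
    and add: "\<And>x y. x \<in> L \<Longrightarrow> y \<in> L \<Longrightarrow> g (x + y) = g x + g y"
    and pull: "\<And>p x. p permutes V \<Longrightarrow> x \<in> L \<Longrightarrow> g (pull p x) = pull p (g x)"
  shows "L = K"
proof -
  note L' = LatticesD[OF L] and K' = LatticesD[OF K]
  have "g x \<in> W" if "x \<in> L" for x using that g K'(4) Mst_W by blast
  then obtain c where c: "\<And>x. x \<in> L \<Longrightarrow> g x = scale c x"
    using equivariant_scalar[OF L _ add pull] by blast
  then have Kc: "K = scale c ` L" using g by force
  let ?q = "quad 1 2 5 3 :: nat \<times> nat \<Rightarrow> rat"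
  have q: "?q \<in> M1" by (rule quad_in_M1) simp_all
  have int: "quad_sum x 1 2 3 4 \<in> \<int>" if "x \<in> Mst" for x
    by (rule MstD[OF that]) simp_all
  have "scale c ?q \<in> Mst" using q L'(3) Kc K'(4) by blast
  then have "c \<in> \<int>" using int[of "scale c ?q"] by (simp add: quad_sum_linear quad_sum_1253 del: One_nat_def)
  then obtain k where k: "c = of_int k" by (elim Ints_cases)
  obtain x where x: "x \<in> L" "?q = scale c x" using q K'(3) Kc by blast
  have "quad_sum x 1 2 3 4 \<in> \<int>" using x L'(4) int by blast
  then obtain l where "quad_sum x 1 2 3 4 = of_int l" by (elim Ints_cases)
  then have "(of_int (k * l) :: rat) = 1"
    using x(2) quad_sum_1253 by (simp add: quad_sum_linear k del: One_nat_def)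
  then have "k * l = 1" by (simp only: of_int_eq_1_iff)
  then have "k = 1 \<or> k = - 1" by (metis zmult_eq_1_iff)
  then show ?thesis
  proof
    assume "k = 1"
    then show ?thesis using Kc by (simp add: k)
  next
    assume "k = - 1"
    then have "K = uminus ` L" using Kc by (simp add: k scale_distrib)
    moreover have "uminus ` L = L"
      using zsubmodule_minus[OF L'(1)] by (force intro: image_eqI[of _ _ "- _"])
    ultimately show ?thesis by simp
  qed
qed

end

section \<open>The rational tensor product\<close>

definition tensor_generators :: "(int, 'm, 'y) module_scheme \<Rightarrow> ((rat \<times> 'm) \<Rightarrow>\<^sub>0 int) set" where
  "tensor_generators M =
     {frag_of (p + q, x) - frag_of (p, x) - frag_of (q, x) | p q x. x \<in> carrier M} \<union>
     {frag_of (q, x \<oplus>\<^bsub>M\<^esub> y) - frag_of (q, x) - frag_of (q, y) | q x y.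
        x \<in> carrier M \<and> y \<in> carrier M} \<union>
     {frag_of (q * of_int a, x) - frag_of (q, a \<odot>\<^bsub>M\<^esub> x) | q a x. x \<in> carrier M}"

lemma tensor_relations_eq: "tensor_relations M = generate (tensor_free M) (tensor_generators M)"
  by (simp add: tensor_relations_def tensor_generators_def)

text \<open>The additive map that sends a pair \<open>(q, x)\<close> to \<open>q\<close> times
  \<open>\<phi> x\<close>. It realizes the tensor product as a space of rational functions.\<close>

definition tensor_eval ::
    "('m \<Rightarrow> 'i \<Rightarrow> rat) \<Rightarrow> ((rat \<times> 'm) \<Rightarrow>\<^sub>0 int) \<Rightarrow> 'i \<Rightarrow> rat" where
  "tensor_eval \<phi> u = (\<Sum>z\<in>Poly_Mapping.keys u.
     scale (of_int (Poly_Mapping.lookup u z) * fst z) (\<phi> (snd z)))"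

lemma tensor_eval_superset:
  assumes "finite S" "Poly_Mapping.keys u \<subseteq> S"
  shows "tensor_eval \<phi> u = (\<Sum>z\<in>S. scale (of_int (Poly_Mapping.lookup u z) * fst z) (\<phi> (snd z)))"
  unfolding tensor_eval_def
  by (rule sum.mono_neutral_left) (use assms in \<open>auto simp: in_keys_iff\<close>)

lemma tensor_eval_diff: "tensor_eval \<phi> (u - v) = tensor_eval \<phi> u - tensor_eval \<phi> v"
proof -
  let ?S = "Poly_Mapping.keys u \<union> Poly_Mapping.keys v"
  have "tensor_eval \<phi> (u - v)
      = (\<Sum>z\<in>?S. scale (of_int (Poly_Mapping.lookup (u - v) z) * fst z) (\<phi> (snd z)))"
    by (rule tensor_eval_superset) (use keys_diff[of u v] in auto)
  also have "\<dots> = (\<Sum>z\<in>?S. scale (of_int (Poly_Mapping.lookup u z) * fst z) (\<phi> (snd z)))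
      - (\<Sum>z\<in>?S. scale (of_int (Poly_Mapping.lookup v z) * fst z) (\<phi> (snd z)))"
    unfolding sum_subtractf[symmetric]
    by (intro sum.cong refl) (simp add: lookup_minus left_diff_distrib scale_distrib)
  also have "\<dots> = tensor_eval \<phi> u - tensor_eval \<phi> v"
    by (intro arg_cong2[where f = minus] tensor_eval_superset[symmetric]) auto
  finally show ?thesis .
qed

lemma tensor_eval_0 [simp]: "tensor_eval \<phi> 0 = 0"
  by (simp add: tensor_eval_def)

lemma tensor_eval_frag_of: "tensor_eval \<phi> (frag_of (q, x)) = scale q (\<phi> x)"
  by (simp add: tensor_eval_def)

lemma tensor_eval_add: "tensor_eval \<phi> (u + v) = tensor_eval \<phi> u + tensor_eval \<phi> v"
  using tensor_eval_diff[of \<phi> u "0 - v"] tensor_eval_diff[of \<phi> 0 v] by simp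

text \<open>It serves both the scalar multiplication and the group action: \<open>h\<close> is the
  effect on pairs and \<open>\<rho>\<close> the effect on functions.\<close>

lemma tensor_eval_push:
  assumes u: "Poly_Mapping.keys u \<subseteq> S"
    and add: "\<And>x y. \<rho> (x + y) = \<rho> x + \<rho> y"
    and h: "\<And>q x. (q, x) \<in> S \<Longrightarrow> tensor_eval \<phi> (frag_of (h (q, x))) = \<rho> (scale q (\<phi> x))"
  shows "tensor_eval \<phi> (frag_extend (\<lambda>z. frag_of (h z)) u) = \<rho> (tensor_eval \<phi> u)"
proof -
  have 0: "\<rho> 0 = 0" using add[of 0 0] by simp
  have diff: "\<rho> (x - y) = \<rho> x - \<rho> y" for x y using add[of "x - y" y] by simp
  show ?thesis
    using u
  proof (induction u rule: frag_induction)
    case (one z)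
    then show ?case
      by (cases z) (simp only: frag_extend_of h tensor_eval_frag_of)
  qed (simp_all only: frag_extend_0 tensor_eval_0 0 frag_extend_diff tensor_eval_diff diff)
qed

definition int_embedding :: "(int, 'm, 'y) module_scheme \<Rightarrow> ('m \<Rightarrow> 'i \<Rightarrow> rat) \<Rightarrow> bool" where
  "int_embedding M \<phi> \<longleftrightarrow> inj_on \<phi> (carrier M) \<and>
     (\<forall>x\<in>carrier M. \<forall>y\<in>carrier M. \<phi> (x \<oplus>\<^bsub>M\<^esub> y) = \<phi> x + \<phi> y) \<and>
     (\<forall>a. \<forall>x\<in>carrier M. \<phi> (a \<odot>\<^bsub>M\<^esub> x) = scale (of_int a) (\<phi> x))"

definition tensor_coset :: "(int, 'm, 'y) module_scheme \<Rightarrow> ((rat \<times> 'm) \<Rightarrow>\<^sub>0 int) \<Rightarrow> ((rat \<times> 'm) \<Rightarrow>\<^sub>0 int) set" where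
  "tensor_coset M u = tensor_relations M #>\<^bsub>tensor_free M\<^esub> u"

context
  fixes M :: "(int, 'm, 'g) gmodule"
  assumes M: "Module.module \<Z> M"
begin

interpretation M: Module.module "\<Z>" M by (rule M)

lemma tensor_generators_carrier: "tensor_generators M \<subseteq> carrier (tensor_free M)"
proof -
  have "frag_of z \<in> carrier (tensor_free M) \<longleftrightarrow> snd z \<in> carrier M" for z :: "rat \<times> 'm"
    by (cases z) (simp add: tensor_free_def)
  moreover have "u - v \<in> carrier (tensor_free M)"
    if "u \<in> carrier (tensor_free M)" "v \<in> carrier (tensor_free M)" for u v
    using that keys_diff[of u v] by (auto simp: tensor_free_def)
  ultimately show ?thesis
    unfolding tensor_generators_def by auto
qed

lemma tensor_relations_subgroup: "subgroup (tensor_relations M) (tensor_free M)"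
  unfolding tensor_relations_eq
  by (rule group.generate_is_subgroup[OF _ tensor_generators_carrier]) (simp add: tensor_free_def)

lemma tensor_relations_keys: "u \<in> tensor_relations M \<Longrightarrow> Poly_Mapping.keys u \<subseteq> UNIV \<times> carrier M"
  using subgroup.mem_carrier[OF tensor_relations_subgroup] by (simp add: tensor_free_def)

lemma tensor_relations_zsubmodule: "zsubmodule (tensor_relations M)"
  unfolding zsubmodule_def
proof (intro conjI ballI)
  show "0 \<in> tensor_relations M"
    using subgroup.one_closed[OF tensor_relations_subgroup] by (simp add: tensor_free_def)
  fix u v assume uv: "u \<in> tensor_relations M" "v \<in> tensor_relations M"
  then have "- v \<in> tensor_relations M"
    using subgroup.m_inv_closed[OF tensor_relations_subgroup uv(2)] tensor_relations_keys[OF uv(2)]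
    by (simp add: tensor_free_def)
  then show "u - v \<in> tensor_relations M"
    using subgroup.m_closed[OF tensor_relations_subgroup uv(1), of "- v"] by (simp add: tensor_free_def)
qed

lemma tensor_relations_least:
  assumes K: "zsubmodule K" and gen: "tensor_generators M \<subseteq> K"
  shows "tensor_relations M \<subseteq> K"
proof
  fix u assume "u \<in> tensor_relations M"
  then show "u \<in> K"
    unfolding tensor_relations_eq
  proof (induction rule: generate.induct)
    case one
    show ?case using zsubmodule_0[OF K] by (simp add: tensor_free_def)
  next
    case (incl h)
    then show ?case using gen by blast
  next
    case (inv h)
    then have "h \<in> carrier (tensor_free M)" using tensor_generators_carrier by blast
    then have "inv\<^bsub>tensor_free M\<^esub> h = - h" by (simp add: tensor_free_def)
    moreover have "- h \<in> K" using zsubmodule_minus[OF K] gen inv by blast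
    ultimately show ?case by simp
  next
    case (eng h1 h2)
    then show ?case using zsubmodule_add[OF K] by (simp add: tensor_free_def)
  qed
qed

lemma tensor_gen:
  assumes "x \<in> carrier M"
  shows "frag_of (p + q, x) - frag_of (p, x) - frag_of (q, x) \<in> tensor_relations M"
    and "y \<in> carrier M \<Longrightarrow> frag_of (q, x \<oplus>\<^bsub>M\<^esub> y) - frag_of (q, x) - frag_of (q, y) \<in> tensor_relations M"
    and "frag_of (q * of_int a, x) - frag_of (q, a \<odot>\<^bsub>M\<^esub> x) \<in> tensor_relations M"
proof -
  have gen: "u \<in> tensor_relations M" if "u \<in> tensor_generators M" for u
    unfolding tensor_relations_eq using that by (rule generate.incl)
  show "frag_of (p + q, x) - frag_of (p, x) - frag_of (q, x) \<in> tensor_relations M"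
    by (rule gen) (use assms in \<open>unfold tensor_generators_def, blast\<close>)
  show "y \<in> carrier M \<Longrightarrow> frag_of (q, x \<oplus>\<^bsub>M\<^esub> y) - frag_of (q, x) - frag_of (q, y) \<in> tensor_relations M"
    by (rule gen) (use assms in \<open>unfold tensor_generators_def, blast\<close>)
  show "frag_of (q * of_int a, x) - frag_of (q, a \<odot>\<^bsub>M\<^esub> x) \<in> tensor_relations M"
    by (rule gen) (use assms in \<open>unfold tensor_generators_def, blast\<close>)
qed

lemma tensor_coset_eq: "tensor_coset M u = {w. w - u \<in> tensor_relations M}"
proof -
  have "w \<in> tensor_coset M u \<longleftrightarrow> w - u \<in> tensor_relations M" for w
  proof
    assume "w \<in> tensor_coset M u"
    then show "w - u \<in> tensor_relations M"
      by (auto simp: tensor_coset_def r_coset_def tensor_free_def)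
  next
    assume "w - u \<in> tensor_relations M"
    moreover have "w = (w - u) + u" by simp
    ultimately show "w \<in> tensor_coset M u"
      unfolding tensor_coset_def r_coset_def by (auto simp: tensor_free_def intro!: bexI[of _ "w - u"])
  qed
  then show ?thesis by blast
qed

lemma tensor_coset_eq_iff: "tensor_coset M u = tensor_coset M v \<longleftrightarrow> u - v \<in> tensor_relations M"
proof
  assume "tensor_coset M u = tensor_coset M v"
  moreover have "u \<in> tensor_coset M u"
    using zsubmodule_0[OF tensor_relations_zsubmodule] by (simp add: tensor_coset_eq)
  ultimately show "u - v \<in> tensor_relations M" by (simp add: tensor_coset_eq)
next
  assume uv: "u - v \<in> tensor_relations M"
  have "w - u \<in> tensor_relations M \<longleftrightarrow> w - v \<in> tensor_relations M" for w
    using zsubmodule_add[OF tensor_relations_zsubmodule, of "w - u" "u - v"]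
      zsubmodule_diff[OF tensor_relations_zsubmodule, of "w - v" "u - v"] uv by auto
  then show "tensor_coset M u = tensor_coset M v" by (simp add: tensor_coset_eq)
qed

lemma tensor_coset_self: "u \<in> tensor_coset M u"
  using zsubmodule_0[OF tensor_relations_zsubmodule] by (simp add: tensor_coset_eq)

text \<open>Common denominators gather a sum of pairs into a single pair. Statements about the
  tensor product thus reduce to elementary tensors.\<close>

lemma tensor_simple:
  assumes "Poly_Mapping.keys u \<subseteq> UNIV \<times> carrier M"
  obtains N :: nat and x where "N > 0" "x \<in> carrier M"
    "u - frag_of (1 / of_nat N, x) \<in> tensor_relations M"
proof -
  define R where "R u v \<longleftrightarrow> u - v \<in> tensor_relations M" for u v
  note Z = tensor_relations_zsubmodule
  have trans: "R u v \<Longrightarrow> R v w \<Longrightarrow> R u w" for u v w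
    using zsubmodule_add[OF Z, of "u - v" "v - w"] by (simp add: R_def)
  have sym: "R u v \<Longrightarrow> R v u" for u v
    using zsubmodule_minus[OF Z, of "u - v"] by (simp add: R_def)
  have rel_diff: "R u v \<Longrightarrow> R u' v' \<Longrightarrow> R (u - u') (v - v')" for u v u' v'
    using zsubmodule_diff[OF Z, of "u - v" "u' - v'"] by (simp add: R_def algebra_simps)
  have move: "R (frag_of (q * of_int a, x)) (frag_of (q, a \<odot>\<^bsub>M\<^esub> x))" if "x \<in> carrier M" for q a x
    using tensor_gen(3)[OF that] by (simp add: R_def)
  have rel_zero: "R 0 (frag_of (q, \<zero>\<^bsub>M\<^esub>))" for q
    using tensor_gen(2)[of "\<zero>\<^bsub>M\<^esub>" "\<zero>\<^bsub>M\<^esub>" q] by (simp add: R_def)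
  have minus: "R (frag_of (q, x) - frag_of (q, y)) (frag_of (q, x \<oplus>\<^bsub>M\<^esub> (\<ominus>\<^bsub>M\<^esub> y)))"
    if "x \<in> carrier M" "y \<in> carrier M" for q x y
  proof -
    let ?z = "x \<oplus>\<^bsub>M\<^esub> (\<ominus>\<^bsub>M\<^esub> y)"
    have "frag_of (q, ?z \<oplus>\<^bsub>M\<^esub> y) - frag_of (q, ?z) - frag_of (q, y) \<in> tensor_relations M"
      by (rule tensor_gen(2)) (use that in simp_all)
    moreover have "?z \<oplus>\<^bsub>M\<^esub> y = x" using that by (simp add: M.add.m_assoc M.l_neg)
    ultimately show ?thesis by (simp add: R_def algebra_simps)
  qed
  have "\<exists>N x. N > (0::nat) \<and> x \<in> carrier M \<and> R u (frag_of (1 / of_nat N, x))"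
    using assms
  proof (induction u rule: frag_induction)
    case zero
    have "R 0 (frag_of (1 / of_nat 1, \<zero>\<^bsub>M\<^esub>))" by (rule rel_zero)
    then show ?case using M.zero_closed zero_less_one by blast
  next
    case (one z)
    then obtain q x where z: "z = (q, x)" "x \<in> carrier M" by auto
    obtain a b where ab: "b > 0" "q = of_int a / of_int b"
      by (metis quotient_of_denom_pos' quotient_of_div surjective_pairing)
    have "q = 1 / of_nat (nat b) * of_int a" using ab by simp
    then have "R (frag_of z) (frag_of (1 / of_nat (nat b), a \<odot>\<^bsub>M\<^esub> x))"
      using move[OF z(2), of "1 / of_nat (nat b)" a] z(1) by simp
    then show ?case using ab z by (intro exI[of _ "nat b"] exI[of _ "a \<odot>\<^bsub>M\<^esub> x"]) simp
  next
    case (diff u v)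
    obtain N x where x: "N > (0::nat)" "x \<in> carrier M" "R u (frag_of (1 / of_nat N, x))"
      using diff.IH(1) by blast
    obtain K y where y: "K > (0::nat)" "y \<in> carrier M" "R v (frag_of (1 / of_nat K, y))"
      using diff.IH(2) by blast
    let ?q = "1 / of_nat (N * K) :: rat"
    have "1 / of_nat N = ?q * of_int (int K)" "1 / of_nat K = ?q * of_int (int N)"
      using x(1) y(1) by simp_all
    then have "R u (frag_of (?q, int K \<odot>\<^bsub>M\<^esub> x))" "R v (frag_of (?q, int N \<odot>\<^bsub>M\<^esub> y))"
      using trans[OF x(3)] trans[OF y(3)] move[OF x(2), of ?q "int K"] move[OF y(2), of ?q "int N"] by simp_all
    then have "R (u - v) (frag_of (?q, int K \<odot>\<^bsub>M\<^esub> x) - frag_of (?q, int N \<odot>\<^bsub>M\<^esub> y))"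
      by (rule rel_diff)
    then have "R (u - v) (frag_of (?q, int K \<odot>\<^bsub>M\<^esub> x \<oplus>\<^bsub>M\<^esub> (\<ominus>\<^bsub>M\<^esub> (int N \<odot>\<^bsub>M\<^esub> y))))"
      by (rule trans) (rule minus; use x y in simp)
    then show ?case
      using x y by (intro exI[of _ "N * K"] exI[of _ "int K \<odot>\<^bsub>M\<^esub> x \<oplus>\<^bsub>M\<^esub> (\<ominus>\<^bsub>M\<^esub> (int N \<odot>\<^bsub>M\<^esub> y))"]) simp
  qed
  then show ?thesis using that unfolding R_def by blast
qed

lemma tensor_eval_relations:
  assumes \<phi>: "int_embedding M \<phi>" and u: "u \<in> tensor_relations M"
  shows "tensor_eval \<phi> u = 0"
proof -
  have "zsubmodule {u. tensor_eval \<phi> u = 0}"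
    by (simp add: zsubmodule_def tensor_eval_diff)
  moreover have "tensor_generators M \<subseteq> {u. tensor_eval \<phi> u = 0}"
    using \<phi> unfolding int_embedding_def
    by (auto simp: tensor_generators_def tensor_eval_diff tensor_eval_frag_of scale_distrib
        simp del: scale_apply)
  ultimately show ?thesis using tensor_relations_least u by blast
qed

text \<open>By \<open>tensor_simple\<close> it suffices to consider a single pair
  \<open>(1 / N, x)\<close>, for which \<open>\<phi> x = 0\<close> forces \<open>x\<close> to be
  zero.\<close>

lemma tensor_eval_kernel:
  assumes \<phi>: "int_embedding M \<phi>" and u: "Poly_Mapping.keys u \<subseteq> UNIV \<times> carrier M" "tensor_eval \<phi> u = 0"
  shows "u \<in> tensor_relations M"
proof -
  obtain N :: nat and x where x: "N > 0" "x \<in> carrier M"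
    "u - frag_of (1 / of_nat N, x) \<in> tensor_relations M"
    by (rule tensor_simple[OF u(1)])
  have "scale (1 / of_nat N) (\<phi> x) = 0"
    using tensor_eval_relations[OF \<phi> x(3)] u(2) by (simp add: tensor_eval_diff tensor_eval_frag_of del: scale_apply)
  then have "scale (of_nat N) (scale (1 / of_nat N) (\<phi> x)) = scale (of_nat N) 0" by (simp only:)
  then have x0: "\<phi> x = 0" using x(1) by (simp del: scale_apply)
  have "\<phi> \<zero>\<^bsub>M\<^esub> = \<phi> \<zero>\<^bsub>M\<^esub> + \<phi> \<zero>\<^bsub>M\<^esub>"
    using \<phi> M.zero_closed M.l_zero[OF M.zero_closed] unfolding int_embedding_def by metis
  then have "\<phi> \<zero>\<^bsub>M\<^esub> = 0" by simp
  then have "x = \<zero>\<^bsub>M\<^esub>"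
    using \<phi> x0 x(2) M.zero_closed unfolding int_embedding_def inj_on_def by metis
  then have "frag_of (1 / of_nat N, x) \<in> tensor_relations M"
    using zsubmodule_minus[OF tensor_relations_zsubmodule tensor_gen(2)[of "\<zero>\<^bsub>M\<^esub>" "\<zero>\<^bsub>M\<^esub>" "1 / of_nat N"]]
    by simp
  from zsubmodule_add[OF tensor_relations_zsubmodule x(3) this] show ?thesis by simp
qed

text \<open>If \<open>h\<close> sends the generating relations to relations, it does so for all
  relations, and then the cosets in the union that defines \<open>tensor_map\<close>
  coincide.\<close>

lemma tensor_map_coset:
  assumes gen: "\<And>u. u \<in> tensor_generators M \<Longrightarrow> frag_extend (\<lambda>z. frag_of (h z)) u \<in> tensor_relations M"
  shows "tensor_map M h (tensor_coset M u) = tensor_coset M (frag_extend (\<lambda>z. frag_of (h z)) u)"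
proof -
  let ?h = "frag_extend (\<lambda>z. frag_of (h z))"
  have "zsubmodule {u. ?h u \<in> tensor_relations M}"
    using tensor_relations_zsubmodule by (simp add: zsubmodule_def frag_extend_diff)
  then have rel: "tensor_relations M \<subseteq> {u. ?h u \<in> tensor_relations M}"
    by (rule tensor_relations_least) (use gen in blast)
  have "tensor_coset M (?h w) = tensor_coset M (?h u)" if "w \<in> tensor_coset M u" for w
    using that rel unfolding tensor_coset_eq_iff
    by (auto simp: tensor_coset_eq frag_extend_diff[symmetric])
  then show ?thesis
    unfolding tensor_map_def tensor_coset_def[symmetric] using tensor_coset_self by blast
qed

lemma tensor_smult_coset:
  "tensor_map M (\<lambda>(q, x). (r * q, x)) (tensor_coset M u)
    = tensor_coset M (frag_extend (\<lambda>z. frag_of ((\<lambda>(q, x). (r * q, x)) z)) u)"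
proof (rule tensor_map_coset)
  fix u assume "u \<in> tensor_generators M"
  then show "frag_extend (\<lambda>z. frag_of ((\<lambda>(q, x). (r * q, x)) z)) u \<in> tensor_relations M"
    unfolding tensor_generators_def
    using tensor_gen(1)[where p = "r * _" and q = "r * _"] tensor_gen(2)[where q = "r * _"]
      tensor_gen(3)[where q = "r * _"]
    by (auto simp: frag_extend_diff distrib_left mult.assoc)
qed

lemma rational_tensor_simps:
  "carrier (rational_tensor M) = tensor_coset M ` {u. Poly_Mapping.keys u \<subseteq> UNIV \<times> carrier M}"
  "tensor_coset M u \<oplus>\<^bsub>rational_tensor M\<^esub> tensor_coset M v = tensor_coset M (u + v)"
  "r \<odot>\<^bsub>rational_tensor M\<^esub> tensor_coset M u
    = tensor_coset M (frag_extend (\<lambda>z. frag_of ((\<lambda>(q, x). (r * q, x)) z)) u)"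
proof -
  show "carrier (rational_tensor M) = tensor_coset M ` {u. Poly_Mapping.keys u \<subseteq> UNIV \<times> carrier M}"
    by (auto simp: rational_tensor_def Let_def FactGroup_def RCOSETS_def tensor_coset_def tensor_free_def)
  show "r \<odot>\<^bsub>rational_tensor M\<^esub> tensor_coset M u
    = tensor_coset M (frag_extend (\<lambda>z. frag_of ((\<lambda>(q, x). (r * q, x)) z)) u)"
    using tensor_smult_coset[of r u] by (simp add: rational_tensor_def Let_def)
  have "w - (u + v) \<in> tensor_relations M \<longleftrightarrow>
      (\<exists>a b. a - u \<in> tensor_relations M \<and> b - v \<in> tensor_relations M \<and> w = a + b)" for w
  proof
    assume "w - (u + v) \<in> tensor_relations M"
    moreover have "v - v \<in> tensor_relations M"
      using zsubmodule_0[OF tensor_relations_zsubmodule] by simp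
    ultimately show "\<exists>a b. a - u \<in> tensor_relations M \<and> b - v \<in> tensor_relations M \<and> w = a + b"
      by (intro exI[of _ "w - v"] exI[of _ v]) (simp add: algebra_simps)
  next
    assume "\<exists>a b. a - u \<in> tensor_relations M \<and> b - v \<in> tensor_relations M \<and> w = a + b"
    then obtain a b where "a - u \<in> tensor_relations M" "b - v \<in> tensor_relations M" "w = a + b" by blast
    then show "w - (u + v) \<in> tensor_relations M"
      using zsubmodule_add[OF tensor_relations_zsubmodule, of "a - u" "b - v"] by (simp add: algebra_simps)
  qed
  then show "tensor_coset M u \<oplus>\<^bsub>rational_tensor M\<^esub> tensor_coset M v = tensor_coset M (u + v)"
    by (auto simp: rational_tensor_def Let_def FactGroup_def set_mult_def tensor_coset_eq tensor_free_def)
qed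

end

section \<open>Modules of rational vectors and their isomorphisms\<close>

definition rat_vectors ::
    "('g \<Rightarrow> ('i \<Rightarrow> rat) \<Rightarrow> 'i \<Rightarrow> rat) \<Rightarrow> ('i \<Rightarrow> rat) set \<Rightarrow> (rat, 'i \<Rightarrow> rat, 'g) gmodule" where
  "rat_vectors \<rho> W = \<lparr>carrier = W, monoid.mult = undefined, one = undefined,
     ring.zero = 0, ring.add = (+), module.smult = scale, act = \<rho>\<rparr>"

definition int_vectors ::
    "('g \<Rightarrow> ('i \<Rightarrow> rat) \<Rightarrow> 'i \<Rightarrow> rat) \<Rightarrow> ('i \<Rightarrow> rat) set \<Rightarrow> (int, 'i \<Rightarrow> rat, 'g) gmodule" where
  "int_vectors \<rho> L = \<lparr>carrier = L, monoid.mult = undefined, one = undefined,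
     ring.zero = 0, ring.add = (+), module.smult = (\<lambda>k. scale (of_int k)), act = \<rho>\<rparr>"

text \<open>For a subgroup \<open>L\<close> this is the rational vector space that it spans, as the
  denominators of a combination can be cleared at once.\<close>

definition rational_span :: "('i \<Rightarrow> rat) set \<Rightarrow> ('i \<Rightarrow> rat) set" where
  "rational_span L = {x. \<exists>N::nat. N > 0 \<and> scale (of_nat N) x \<in> L}"

lemma group_ring_isomorphic_trans:
  assumes "group_ring_isomorphic G R A B" "group_ring_isomorphic G R B C"
  shows "group_ring_isomorphic G R A C"
proof -
  obtain f where f: "bij_betw f (carrier A) (carrier B)"
    "\<And>x y. x \<in> carrier A \<Longrightarrow> y \<in> carrier A \<Longrightarrow> f (x \<oplus>\<^bsub>A\<^esub> y) = f x \<oplus>\<^bsub>B\<^esub> f y"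
    "\<And>r x. r \<in> carrier R \<Longrightarrow> x \<in> carrier A \<Longrightarrow> f (r \<odot>\<^bsub>A\<^esub> x) = r \<odot>\<^bsub>B\<^esub> f x"
    "\<And>g x. g \<in> carrier G \<Longrightarrow> x \<in> carrier A \<Longrightarrow> f (act A g x) = act B g (f x)"
    using assms(1) unfolding group_ring_isomorphic_def by blast
  obtain h where h: "bij_betw h (carrier B) (carrier C)"
    "\<And>x y. x \<in> carrier B \<Longrightarrow> y \<in> carrier B \<Longrightarrow> h (x \<oplus>\<^bsub>B\<^esub> y) = h x \<oplus>\<^bsub>C\<^esub> h y"
    "\<And>r x. r \<in> carrier R \<Longrightarrow> x \<in> carrier B \<Longrightarrow> h (r \<odot>\<^bsub>B\<^esub> x) = r \<odot>\<^bsub>C\<^esub> h x"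
    "\<And>g x. g \<in> carrier G \<Longrightarrow> x \<in> carrier B \<Longrightarrow> h (act B g x) = act C g (h x)"
    using assms(2) unfolding group_ring_isomorphic_def by blast
  have fB: "f x \<in> carrier B" if "x \<in> carrier A" for x
    using that f(1) by (rule bij_betw_apply[rotated])
  have "bij_betw (h \<circ> f) (carrier A) (carrier C)" using f(1) h(1) by (rule bij_betw_trans)
  then show ?thesis
    unfolding group_ring_isomorphic_def by (intro exI[of _ "h \<circ> f"]) (simp add: f h fB)
qed

text \<open>The equations for \<open>f\<close> can be inverted because the operations of
  \<open>A\<close> do not leave its carrier; the notion of isomorphism itself does not include
  this.\<close>

lemma group_ring_isomorphic_sym:
  assumes iso: "group_ring_isomorphic G R A B"
    and add: "\<And>x y. x \<in> carrier A \<Longrightarrow> y \<in> carrier A \<Longrightarrow> x \<oplus>\<^bsub>A\<^esub> y \<in> carrier A"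
    and smult: "\<And>r x. r \<in> carrier R \<Longrightarrow> x \<in> carrier A \<Longrightarrow> r \<odot>\<^bsub>A\<^esub> x \<in> carrier A"
    and act: "\<And>g x. g \<in> carrier G \<Longrightarrow> x \<in> carrier A \<Longrightarrow> act A g x \<in> carrier A"
  shows "group_ring_isomorphic G R B A"
proof -
  obtain f where f: "bij_betw f (carrier A) (carrier B)"
    "\<And>x y. x \<in> carrier A \<Longrightarrow> y \<in> carrier A \<Longrightarrow> f (x \<oplus>\<^bsub>A\<^esub> y) = f x \<oplus>\<^bsub>B\<^esub> f y"
    "\<And>r x. r \<in> carrier R \<Longrightarrow> x \<in> carrier A \<Longrightarrow> f (r \<odot>\<^bsub>A\<^esub> x) = r \<odot>\<^bsub>B\<^esub> f x"
    "\<And>g x. g \<in> carrier G \<Longrightarrow> x \<in> carrier A \<Longrightarrow> f (act A g x) = act B g (f x)"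
    using iso unfolding group_ring_isomorphic_def by blast
  define h where "h = inv_into (carrier A) f"
  have inv: "h (f x) = x" if "x \<in> carrier A" for x
    unfolding h_def using that f(1) by (simp add: bij_betw_inv_into_left)
  have B: "\<exists>x\<in>carrier A. f x = y" if "y \<in> carrier B" for y
  proof -
    have "y \<in> f ` carrier A" using that f(1) by (simp add: bij_betw_def)
    then show ?thesis by blast
  qed
  have "h (y \<oplus>\<^bsub>B\<^esub> z) = h y \<oplus>\<^bsub>A\<^esub> h z" if "y \<in> carrier B" "z \<in> carrier B" for y z
    using B[OF that(1)] B[OF that(2)] f(2) inv add by metis
  moreover have "h (r \<odot>\<^bsub>B\<^esub> y) = r \<odot>\<^bsub>A\<^esub> h y" if "r \<in> carrier R" "y \<in> carrier B" for r y
    using B[OF that(2)] f(3) inv smult that(1) by metis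
  moreover have "h (act B g y) = act A g (h y)" if "g \<in> carrier G" "y \<in> carrier B" for g y
    using B[OF that(2)] f(4) inv act that(1) by metis
  moreover have "bij_betw h (carrier B) (carrier A)"
    unfolding h_def by (rule bij_betw_inv_into[OF f(1)])
  ultimately show ?thesis unfolding group_ring_isomorphic_def by blast
qed

lemma group_ring_module_closed:
  assumes "group_ring_module G R A"
  shows "x \<in> carrier A \<Longrightarrow> y \<in> carrier A \<Longrightarrow> x \<oplus>\<^bsub>A\<^esub> y \<in> carrier A"
    and "r \<in> carrier R \<Longrightarrow> x \<in> carrier A \<Longrightarrow> r \<odot>\<^bsub>A\<^esub> x \<in> carrier A"
    and "g \<in> carrier G \<Longrightarrow> x \<in> carrier A \<Longrightarrow> act A g x \<in> carrier A"
proof -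
  have "Module.module R A" using assms by (simp add: group_ring_module_def)
  then interpret Module.module R A .
  show "x \<in> carrier A \<Longrightarrow> y \<in> carrier A \<Longrightarrow> x \<oplus>\<^bsub>A\<^esub> y \<in> carrier A"
    and "r \<in> carrier R \<Longrightarrow> x \<in> carrier A \<Longrightarrow> r \<odot>\<^bsub>A\<^esub> x \<in> carrier A"
    by simp_all
  show "g \<in> carrier G \<Longrightarrow> x \<in> carrier A \<Longrightarrow> act A g x \<in> carrier A"
    using assms by (simp add: group_ring_module_def)
qed

lemma int_vectors_isoE:
  assumes "group_ring_isomorphic G \<Z> M (int_vectors \<rho> L)"
  obtains \<phi> where "int_embedding M \<phi>" "\<phi> ` carrier M = L"
    "\<And>g x. g \<in> carrier G \<Longrightarrow> x \<in> carrier M \<Longrightarrow> \<phi> (act M g x) = \<rho> g (\<phi> x)"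
proof -
  from assms obtain f where "bij_betw f (carrier M) L"
    "\<forall>x\<in>carrier M. \<forall>y\<in>carrier M. f (x \<oplus>\<^bsub>M\<^esub> y) = f x + f y"
    "\<forall>a. \<forall>x\<in>carrier M. f (a \<odot>\<^bsub>M\<^esub> x) = scale (of_int a) (f x)"
    "\<forall>g\<in>carrier G. \<forall>x\<in>carrier M. f (act M g x) = \<rho> g (f x)"
    unfolding group_ring_isomorphic_def int_vectors_def by auto
  then show ?thesis
    by (intro that[of f]) (simp_all add: int_embedding_def bij_betw_def)
qed

lemma int_vectors_isoI:
  assumes "int_embedding M \<phi>" "\<phi> ` carrier M = L"
    "\<And>g x. g \<in> carrier G \<Longrightarrow> x \<in> carrier M \<Longrightarrow> \<phi> (act M g x) = \<rho> g (\<phi> x)"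
  shows "group_ring_isomorphic G \<Z> M (int_vectors \<rho> L)"
  using assms unfolding group_ring_isomorphic_def int_vectors_def int_embedding_def bij_betw_def
  by (intro exI[of _ \<phi>]) auto

lemma int_embedding_image_zsubmodule:
  assumes M: "Module.module \<Z> M" and \<phi>: "int_embedding M \<phi>"
  shows "zsubmodule (\<phi> ` carrier M)"
proof -
  interpret Module.module \<Z> M by (rule M)
  have add: "\<And>x y. x \<in> carrier M \<Longrightarrow> y \<in> carrier M \<Longrightarrow> \<phi> (x \<oplus>\<^bsub>M\<^esub> y) = \<phi> x + \<phi> y"
    using \<phi> by (simp add: int_embedding_def)
  have "\<phi> \<zero>\<^bsub>M\<^esub> = \<phi> \<zero>\<^bsub>M\<^esub> + \<phi> \<zero>\<^bsub>M\<^esub>" using add[of "\<zero>\<^bsub>M\<^esub>" "\<zero>\<^bsub>M\<^esub>"] by simp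
  then have 0: "\<phi> \<zero>\<^bsub>M\<^esub> = 0" by simp
  have diff: "\<phi> (x \<oplus>\<^bsub>M\<^esub> (\<ominus>\<^bsub>M\<^esub> y)) = \<phi> x - \<phi> y" if "x \<in> carrier M" "y \<in> carrier M" for x y
    using add[of "x \<oplus>\<^bsub>M\<^esub> (\<ominus>\<^bsub>M\<^esub> y)" y] that by (simp add: M.add.m_assoc M.l_neg)
  show ?thesis
    unfolding zsubmodule_def
  proof (intro conjI ballI)
    show "0 \<in> \<phi> ` carrier M" using 0 by (metis imageI M.zero_closed)
    fix a b assume "a \<in> \<phi> ` carrier M" "b \<in> \<phi> ` carrier M"
    then obtain x y where xy: "x \<in> carrier M" "a = \<phi> x" "y \<in> carrier M" "b = \<phi> y" by blast
    then show "a - b \<in> \<phi> ` carrier M"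
      by (intro image_eqI[of _ _ "x \<oplus>\<^bsub>M\<^esub> (\<ominus>\<^bsub>M\<^esub> y)"]) (simp_all add: diff)
  qed
qed

section \<open>Tensor products of lattices as spaces of rational functions\<close>

context
  fixes G :: "('g, 'x) monoid_scheme" and M :: "(int, 'm, 'g) gmodule"
  assumes GM: "group_ring_module G \<Z> M"
begin

lemma GM_module: "Module.module \<Z> M"
  using GM by (simp add: group_ring_module_def)

lemma tensor_act_coset:
  assumes g: "g \<in> carrier G"
  shows "act (rational_tensor M) g (tensor_coset M u)
    = tensor_coset M (frag_extend (\<lambda>z. frag_of ((\<lambda>(q, x). (q, act M g x)) z)) u)"
proof -
  note closed = group_ring_module_closed[OF GM]
  have add: "act M g (x \<oplus>\<^bsub>M\<^esub> y) = act M g x \<oplus>\<^bsub>M\<^esub> act M g y" if "x \<in> carrier M" "y \<in> carrier M" for x y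
    using GM g that by (simp add: group_ring_module_def)
  have smult: "act M g (a \<odot>\<^bsub>M\<^esub> x) = a \<odot>\<^bsub>M\<^esub> act M g x" if "x \<in> carrier M" for a x
    using GM g that unfolding group_ring_module_def by blast
  have "frag_extend (\<lambda>z. frag_of ((\<lambda>(q, x). (q, act M g x)) z)) u \<in> tensor_relations M"
    if "u \<in> tensor_generators M" for u
    using that tensor_gen[OF GM_module] closed(3)[OF g] unfolding tensor_generators_def
    by (auto simp: frag_extend_diff add smult)
  from tensor_map_coset[OF GM_module this] show ?thesis
    by (simp add: rational_tensor_def Let_def)
qed

lemma keys_frag_push:
  assumes "Poly_Mapping.keys u \<subseteq> S" "\<And>z. z \<in> S \<Longrightarrow> h z \<in> T"
  shows "Poly_Mapping.keys (frag_extend (\<lambda>z. frag_of (h z)) u) \<subseteq> T"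
  using keys_frag_extend[of "\<lambda>z. frag_of (h z)" u] assms by (auto simp: keys_frag_of)

lemma rational_tensor_closed:
  shows "x \<in> carrier (rational_tensor M) \<Longrightarrow> y \<in> carrier (rational_tensor M)
      \<Longrightarrow> x \<oplus>\<^bsub>rational_tensor M\<^esub> y \<in> carrier (rational_tensor M)"
    and "x \<in> carrier (rational_tensor M) \<Longrightarrow> r \<odot>\<^bsub>rational_tensor M\<^esub> x \<in> carrier (rational_tensor M)"
    and "g \<in> carrier G \<Longrightarrow> x \<in> carrier (rational_tensor M)
      \<Longrightarrow> act (rational_tensor M) g x \<in> carrier (rational_tensor M)"
proof -
  note simps = rational_tensor_simps[OF GM_module]
  show "x \<oplus>\<^bsub>rational_tensor M\<^esub> y \<in> carrier (rational_tensor M)"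
    if xy: "x \<in> carrier (rational_tensor M)" "y \<in> carrier (rational_tensor M)"
  proof -
    obtain u v where uv: "x = tensor_coset M u" "Poly_Mapping.keys u \<subseteq> UNIV \<times> carrier M"
      "y = tensor_coset M v" "Poly_Mapping.keys v \<subseteq> UNIV \<times> carrier M"
      using xy unfolding simps by blast
    have "Poly_Mapping.keys (u + v) \<subseteq> UNIV \<times> carrier M" using keys_add[of u v] uv(2,4) by blast
    then show ?thesis unfolding uv simps by blast
  qed
  show "r \<odot>\<^bsub>rational_tensor M\<^esub> x \<in> carrier (rational_tensor M)" if x: "x \<in> carrier (rational_tensor M)"
  proof -
    obtain u where u: "x = tensor_coset M u" "Poly_Mapping.keys u \<subseteq> UNIV \<times> carrier M"
      using x unfolding simps by blast
    have "Poly_Mapping.keys (frag_extend (\<lambda>z. frag_of ((\<lambda>(q, x). (r * q, x)) z)) u) \<subseteq> UNIV \<times> carrier M"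
      by (rule keys_frag_push[OF u(2)]) auto
    then show ?thesis unfolding u simps by blast
  qed
  show "act (rational_tensor M) g x \<in> carrier (rational_tensor M)"
    if g: "g \<in> carrier G" and x: "x \<in> carrier (rational_tensor M)"
  proof -
    obtain u where u: "x = tensor_coset M u" "Poly_Mapping.keys u \<subseteq> UNIV \<times> carrier M"
      using x unfolding simps by blast
    have "Poly_Mapping.keys (frag_extend (\<lambda>z. frag_of ((\<lambda>(q, x). (q, act M g x)) z)) u) \<subseteq> UNIV \<times> carrier M"
      by (rule keys_frag_push[OF u(2)]) (use group_ring_module_closed(3)[OF GM g] in auto)
    then show ?thesis unfolding u tensor_act_coset[OF g] simps by blast
  qed
qed

text \<open>\<open>tensor_eval\<close> descends to the cosets, injectively by
  \<open>tensor_eval_kernel\<close>, and its image is read off from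
  \<open>tensor_simple\<close>.\<close>

lemma rational_tensor_iso:
  assumes iso: "group_ring_isomorphic G \<Z> M (int_vectors \<rho> L)"
    and \<rho>_add: "\<And>g x y. g \<in> carrier G \<Longrightarrow> \<rho> g (x + y) = \<rho> g x + \<rho> g y"
    and \<rho>_scale: "\<And>g c x. g \<in> carrier G \<Longrightarrow> \<rho> g (scale c x) = scale c (\<rho> g x)"
  shows "group_ring_isomorphic G rat_ring (rational_tensor M) (rat_vectors \<rho> (rational_span L))"
proof -
  note simps = rational_tensor_simps[OF GM_module]
  obtain \<phi> where \<phi>: "int_embedding M \<phi>" "\<phi> ` carrier M = L"
    "\<And>g x. g \<in> carrier G \<Longrightarrow> x \<in> carrier M \<Longrightarrow> \<phi> (act M g x) = \<rho> g (\<phi> x)"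
    by (rule int_vectors_isoE[OF iso]) (rule that)
  let ?C = "{u. Poly_Mapping.keys u \<subseteq> UNIV \<times> carrier M}"
  \<comment> \<open>The value does not depend on the representative, because relations evaluate to
    0.\<close>
  define F where "F A = tensor_eval \<phi> (SOME u. u \<in> A)" for A
  have F: "F (tensor_coset M u) = tensor_eval \<phi> u" for u
  proof -
    have "(SOME w. w \<in> tensor_coset M u) \<in> tensor_coset M u"
      using tensor_coset_self[OF GM_module] by (rule someI)
    then have "tensor_eval \<phi> ((SOME w. w \<in> tensor_coset M u) - u) = 0"
      by (intro tensor_eval_relations[OF GM_module \<phi>(1)]) (simp add: tensor_coset_eq[OF GM_module])
    then show ?thesis by (simp add: F_def tensor_eval_diff)
  qed
  have inj: "inj_on F (carrier (rational_tensor M))"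
  proof (rule inj_onI)
    fix A B assume "A \<in> carrier (rational_tensor M)" "B \<in> carrier (rational_tensor M)" and eq: "F A = F B"
    then obtain u v where uv: "A = tensor_coset M u" "B = tensor_coset M v" "u \<in> ?C" "v \<in> ?C"
      unfolding simps by blast
    have "tensor_eval \<phi> (u - v) = 0" using eq by (simp add: uv F tensor_eval_diff)
    moreover have "Poly_Mapping.keys (u - v) \<subseteq> UNIV \<times> carrier M"
      using uv(3,4) keys_diff[of u v] by blast
    ultimately have "u - v \<in> tensor_relations M"
      by (intro tensor_eval_kernel[OF GM_module \<phi>(1)])
    then show "A = B" by (simp add: uv tensor_coset_eq_iff[OF GM_module])
  qed
  have img: "F ` carrier (rational_tensor M) = rational_span L"
  proof (intro equalityI subsetI)
    fix y assume "y \<in> F ` carrier (rational_tensor M)"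
    then obtain u where u: "y = tensor_eval \<phi> u" "Poly_Mapping.keys u \<subseteq> UNIV \<times> carrier M"
      unfolding simps by (auto simp: F)
    obtain N :: nat and x where x: "N > 0" "x \<in> carrier M"
      "u - frag_of (1 / of_nat N, x) \<in> tensor_relations M"
      by (rule tensor_simple[OF GM_module u(2)])
    have "y = scale (1 / of_nat N) (\<phi> x)"
      using tensor_eval_relations[OF GM_module \<phi>(1) x(3)]
      by (simp add: tensor_eval_diff tensor_eval_frag_of u(1) del: scale_apply)
    then have "scale (of_nat N) y = \<phi> x" using x(1) by (simp del: scale_apply)
    then show "y \<in> rational_span L" using x \<phi>(2) unfolding rational_span_def by blast
  next
    fix y assume "y \<in> rational_span L"
    then obtain N :: nat where N: "N > 0" "scale (of_nat N) y \<in> L" unfolding rational_span_def by blast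
    then obtain x where x: "x \<in> carrier M" "\<phi> x = scale (of_nat N) y"
      unfolding \<phi>(2)[symmetric] by (metis imageE)
    have "F (tensor_coset M (frag_of (1 / of_nat N, x))) = y"
      using N(1) by (simp add: F tensor_eval_frag_of x(2) del: scale_apply)
    moreover have "tensor_coset M (frag_of (1 / of_nat N, x)) \<in> carrier (rational_tensor M)"
      unfolding simps using x(1) by (intro imageI) (simp add: keys_frag_of)
    ultimately show "y \<in> F ` carrier (rational_tensor M)" by blast
  qed
  have F_smult: "F (r \<odot>\<^bsub>rational_tensor M\<^esub> A) = scale r (F A)" if A: "A \<in> carrier (rational_tensor M)" for r A
  proof -
    obtain u where u: "A = tensor_coset M u" "Poly_Mapping.keys u \<subseteq> UNIV \<times> carrier M"
      using A unfolding simps by blast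
    show ?thesis unfolding u(1) simps F
      by (rule tensor_eval_push[OF u(2) scale_distrib(1)])
        (simp add: tensor_eval_frag_of del: scale_apply)
  qed
  have F_act: "F (act (rational_tensor M) g A) = \<rho> g (F A)"
    if g: "g \<in> carrier G" and A: "A \<in> carrier (rational_tensor M)" for g A
  proof -
    obtain u where u: "A = tensor_coset M u" "Poly_Mapping.keys u \<subseteq> UNIV \<times> carrier M"
      using A unfolding simps by blast
    show ?thesis unfolding u(1) tensor_act_coset[OF g] F
      by (rule tensor_eval_push[OF u(2) \<rho>_add[OF g]])
        (simp add: tensor_eval_frag_of \<phi>(3)[OF g] \<rho>_scale[OF g] del: scale_apply)
  qed
  have F_add: "F (A \<oplus>\<^bsub>rational_tensor M\<^esub> B) = F A + F B"
    if "A \<in> carrier (rational_tensor M)" "B \<in> carrier (rational_tensor M)" for A B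
    using that unfolding simps by (auto simp: F tensor_eval_add simps)
  show ?thesis
    unfolding group_ring_isomorphic_def rat_vectors_def
    using inj img F_add F_smult F_act by (intro exI[of _ F]) (simp add: bij_betw_def)
qed

text \<open>The coordinates with respect to a basis, viewed as functions on the type of
  \<open>M\<close> itself. They show that \<open>M\<close> embeds into its rational tensor
  product.\<close>

lemma int_embedding_of_basis:
  assumes "finitely_generated_free \<Z> M"
  shows "\<exists>\<psi> :: 'm \<Rightarrow> 'm \<Rightarrow> rat. int_embedding M \<psi>"
proof -
  interpret M: Module.module "\<Z>" M by (rule GM_module)
  obtain B where B: "finite B" "B \<subseteq> carrier M"
    and ex': "\<forall>x\<in>carrier M. \<exists>!c. c \<in> B \<rightarrow>\<^sub>E carrier \<Z> \<and> x = (\<Oplus>\<^bsub>M\<^esub>b\<in>B. c b \<odot>\<^bsub>M\<^esub> b)"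
    using assms unfolding finitely_generated_free_def by blast
  have ex: "\<exists>!c. c \<in> B \<rightarrow>\<^sub>E UNIV \<and> x = (\<Oplus>\<^bsub>M\<^esub>b\<in>B. c b \<odot>\<^bsub>M\<^esub> b)" if "x \<in> carrier M" for x
    using bspec[OF ex' that] by (simp only: partial_object.select_convs)
  define c where "c x = (THE c. c \<in> B \<rightarrow>\<^sub>E UNIV \<and> x = (\<Oplus>\<^bsub>M\<^esub>b\<in>B. c b \<odot>\<^bsub>M\<^esub> b))" for x
  have c: "c x \<in> B \<rightarrow>\<^sub>E UNIV" "x = (\<Oplus>\<^bsub>M\<^esub>b\<in>B. c x b \<odot>\<^bsub>M\<^esub> b)" if "x \<in> carrier M" for x
    using theI'[OF ex[OF that]] unfolding c_def by blast+
  have uniq: "c x b = k b" if "x \<in> carrier M" "x = (\<Oplus>\<^bsub>M\<^esub>b\<in>B. k b \<odot>\<^bsub>M\<^esub> b)" "b \<in> B" for x k b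
  proof -
    \<comment> \<open>The coefficients of an element are unique among extensional families, so
      \<open>k\<close> is restricted to \<open>B\<close>.\<close>
    have "(\<Oplus>\<^bsub>M\<^esub>b\<in>B. restrict k B b \<odot>\<^bsub>M\<^esub> b) = (\<Oplus>\<^bsub>M\<^esub>b\<in>B. k b \<odot>\<^bsub>M\<^esub> b)"
      using B by (intro M.M.finsum_cong') auto
    then have "restrict k B \<in> B \<rightarrow>\<^sub>E UNIV \<and> x = (\<Oplus>\<^bsub>M\<^esub>b\<in>B. restrict k B b \<odot>\<^bsub>M\<^esub> b)"
      using that(2) by simp
    then have "c x = restrict k B"
      unfolding c_def by (rule the1_equality[OF ex[OF that(1)]])
    then show ?thesis using that(3) by simp
  qed
  have fB: "(\<lambda>b. k b \<odot>\<^bsub>M\<^esub> b) \<in> B \<rightarrow> carrier M" for k using B by auto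
  have add: "c (x \<oplus>\<^bsub>M\<^esub> y) b = c x b + c y b" if "x \<in> carrier M" "y \<in> carrier M" "b \<in> B" for x y b
  proof (rule uniq)
    have "x \<oplus>\<^bsub>M\<^esub> y = (\<Oplus>\<^bsub>M\<^esub>b\<in>B. c x b \<odot>\<^bsub>M\<^esub> b) \<oplus>\<^bsub>M\<^esub> (\<Oplus>\<^bsub>M\<^esub>b\<in>B. c y b \<odot>\<^bsub>M\<^esub> b)"
      using c(2)[OF that(1)] c(2)[OF that(2)] by simp
    also have "\<dots> = (\<Oplus>\<^bsub>M\<^esub>b\<in>B. c x b \<odot>\<^bsub>M\<^esub> b \<oplus>\<^bsub>M\<^esub> c y b \<odot>\<^bsub>M\<^esub> b)"
      by (rule M.M.finsum_addf[symmetric]) (rule fB)+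
    also have "\<dots> = (\<Oplus>\<^bsub>M\<^esub>b\<in>B. (c x b + c y b) \<odot>\<^bsub>M\<^esub> b)"
      using B M.smult_l_distr by (intro M.M.finsum_cong') auto
    finally show "x \<oplus>\<^bsub>M\<^esub> y = (\<Oplus>\<^bsub>M\<^esub>b\<in>B. (c x b + c y b) \<odot>\<^bsub>M\<^esub> b)" .
  qed (use that in auto)
  have smult: "c (a \<odot>\<^bsub>M\<^esub> x) b = a * c x b" if "x \<in> carrier M" "b \<in> B" for a x b
  proof (rule uniq)
    have "a \<odot>\<^bsub>M\<^esub> x = a \<odot>\<^bsub>M\<^esub> (\<Oplus>\<^bsub>M\<^esub>b\<in>B. c x b \<odot>\<^bsub>M\<^esub> b)"
      using c(2)[OF that(1)] by simp
    also have "\<dots> = (\<Oplus>\<^bsub>M\<^esub>b\<in>B. a \<odot>\<^bsub>M\<^esub> (c x b \<odot>\<^bsub>M\<^esub> b))"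
      using B fB by (intro M.finsum_smult_ldistr) auto
    also have "\<dots> = (\<Oplus>\<^bsub>M\<^esub>b\<in>B. (a * c x b) \<odot>\<^bsub>M\<^esub> b)"
      using B M.smult_assoc1 by (intro M.M.finsum_cong') auto
    finally show "a \<odot>\<^bsub>M\<^esub> x = (\<Oplus>\<^bsub>M\<^esub>b\<in>B. (a * c x b) \<odot>\<^bsub>M\<^esub> b)" .
  qed (use that in auto)
  define \<psi> :: "'m \<Rightarrow> 'm \<Rightarrow> rat" where "\<psi> x = (\<lambda>b. if b \<in> B then of_int (c x b) else 0)" for x
  have "inj_on \<psi> (carrier M)"
  proof (rule inj_onI)
    fix x y assume xy: "x \<in> carrier M" "y \<in> carrier M" "\<psi> x = \<psi> y"
    have "c x b = c y b" if "b \<in> B" for b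
      using fun_cong[OF xy(3), of b] that by (simp add: \<psi>_def)
    then have "(\<Oplus>\<^bsub>M\<^esub>b\<in>B. c x b \<odot>\<^bsub>M\<^esub> b) = (\<Oplus>\<^bsub>M\<^esub>b\<in>B. c y b \<odot>\<^bsub>M\<^esub> b)"
      using B by (intro M.M.finsum_cong') auto
    then show "x = y" using c(2)[OF xy(1)] c(2)[OF xy(2)] by simp
  qed
  then have "int_embedding M \<psi>"
    unfolding int_embedding_def by (auto simp: \<psi>_def fun_eq_iff add smult)
  then show ?thesis by blast
qed

text \<open>The lattice is the image of the pairs \<open>(1, x)\<close> under the given isomorphism.
  It spans \<open>W\<close> because every tensor is a rational multiple of such a pair.\<close>

lemma lattice_of_rational_iso:
  assumes free: "finitely_generated_free \<Z> M"
    and iso: "group_ring_isomorphic G rat_ring (rational_tensor M) (rat_vectors \<rho> W)"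
  obtains L where "zsubmodule L" "rational_span L = W"
    "group_ring_isomorphic G \<Z> M (int_vectors \<rho> L)"
proof -
  interpret M: Module.module "\<Z>" M by (rule GM_module)
  note simps = rational_tensor_simps[OF GM_module] and eq_iff = tensor_coset_eq_iff[OF GM_module]
    and gen = tensor_gen[OF GM_module] and closed = rational_tensor_closed
  obtain f where "bij_betw f (carrier (rational_tensor M)) W"
    and f_add: "\<And>x y. x \<in> carrier (rational_tensor M) \<Longrightarrow> y \<in> carrier (rational_tensor M)
        \<Longrightarrow> f (x \<oplus>\<^bsub>rational_tensor M\<^esub> y) = f x + f y"
    and f_smult: "\<And>r x. x \<in> carrier (rational_tensor M)
        \<Longrightarrow> f (r \<odot>\<^bsub>rational_tensor M\<^esub> x) = scale r (f x)"
    and f_act: "\<And>g x. g \<in> carrier G \<Longrightarrow> x \<in> carrier (rational_tensor M)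
        \<Longrightarrow> f (act (rational_tensor M) g x) = \<rho> g (f x)"
    using iso unfolding group_ring_isomorphic_def rat_vectors_def ring_of_type_algebra_def by auto
  then have f: "inj_on f (carrier (rational_tensor M))" "f ` carrier (rational_tensor M) = W"
    by (simp_all add: bij_betw_def)
  obtain \<psi> :: "'m \<Rightarrow> 'm \<Rightarrow> rat" where \<psi>: "int_embedding M \<psi>"
    using int_embedding_of_basis[OF free] by blast
  define \<iota> where "\<iota> q x = tensor_coset M (frag_of (q, x))" for q x
  have \<iota>: "\<iota> q x \<in> carrier (rational_tensor M)" if "x \<in> carrier M" for q x
    unfolding \<iota>_def simps using that by (intro imageI) (simp add: keys_frag_of)
  have \<iota>_inj: "x = y" if "x \<in> carrier M" "y \<in> carrier M" "\<iota> 1 x = \<iota> 1 y" for x y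
  proof -
    have "frag_of (1, x) - frag_of (1, y) \<in> tensor_relations M"
      using that(3) by (simp add: \<iota>_def eq_iff)
    then have "tensor_eval \<psi> (frag_of (1, x) - frag_of (1, y)) = 0"
      by (rule tensor_eval_relations[OF GM_module \<psi>])
    then have "\<psi> x = \<psi> y" by (simp add: tensor_eval_diff tensor_eval_frag_of del: scale_apply)
    then show ?thesis using \<psi> that unfolding int_embedding_def inj_on_def by blast
  qed
  have \<iota>_add: "\<iota> q (x \<oplus>\<^bsub>M\<^esub> y) = \<iota> q x \<oplus>\<^bsub>rational_tensor M\<^esub> \<iota> q y"
    if "x \<in> carrier M" "y \<in> carrier M" for q x y
    unfolding \<iota>_def simps eq_iff using gen(2)[OF that(1,2), of q] by (simp add: diff_diff_eq)
  have \<iota>_smult: "r \<odot>\<^bsub>rational_tensor M\<^esub> \<iota> q x = \<iota> (r * q) x" for r q x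
    unfolding \<iota>_def simps by simp
  have \<iota>_int: "\<iota> 1 (a \<odot>\<^bsub>M\<^esub> x) = of_int a \<odot>\<^bsub>rational_tensor M\<^esub> \<iota> 1 x" if "x \<in> carrier M" for a x
  proof -
    have "\<iota> (1 * of_int a) x = \<iota> 1 (a \<odot>\<^bsub>M\<^esub> x)"
      unfolding \<iota>_def eq_iff by (rule gen(3)[OF that])
    then show ?thesis by (simp add: \<iota>_smult)
  qed
  have \<iota>_act: "\<iota> q (act M g x) = act (rational_tensor M) g (\<iota> q x)" if "g \<in> carrier G" for q g x
    unfolding \<iota>_def tensor_act_coset[OF that] by simp
  define \<phi> where "\<phi> x = f (\<iota> 1 x)" for x
  have \<phi>: "int_embedding M \<phi>"
    unfolding int_embedding_def
  proof (intro conjI ballI allI)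
    show "inj_on \<phi> (carrier M)"
      by (rule inj_onI) (auto simp: \<phi>_def intro: \<iota>_inj dest: inj_onD[OF f(1)] simp: \<iota>)
  qed (simp_all add: \<phi>_def \<iota>_add f_add \<iota> \<iota>_int f_smult)
  define L where "L = \<phi> ` carrier M"
  have L: "zsubmodule L" unfolding L_def by (rule int_embedding_image_zsubmodule[OF GM_module \<phi>])
  have "group_ring_isomorphic G \<Z> M (int_vectors \<rho> L)"
    by (rule int_vectors_isoI[OF \<phi>]) (simp_all add: L_def \<phi>_def \<iota>_act f_act \<iota>)
  moreover have "rational_span L = W"
  proof (intro equalityI subsetI)
    fix y assume "y \<in> rational_span L"
    then obtain N :: nat where N: "N > 0" "scale (of_nat N) y \<in> L" unfolding rational_span_def by blast
    then obtain x where x: "x \<in> carrier M" "\<phi> x = scale (of_nat N) y" by (auto simp: L_def)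
    have "f ((1 / of_nat N) \<odot>\<^bsub>rational_tensor M\<^esub> \<iota> 1 x) = scale (1 / of_nat N) (\<phi> x)"
      by (simp add: f_smult \<iota> x(1) \<phi>_def)
    also have "\<dots> = y" using N(1) by (simp add: x(2) del: scale_apply)
    finally show "y \<in> W" using f(2) closed(2)[OF \<iota>[OF x(1)]] by blast
  next
    fix w assume "w \<in> W"
    then obtain u where u: "w = f (tensor_coset M u)" "Poly_Mapping.keys u \<subseteq> UNIV \<times> carrier M"
      using f(2) unfolding simps by blast
    obtain N :: nat and x where x: "N > 0" "x \<in> carrier M"
      "u - frag_of (1 / of_nat N, x) \<in> tensor_relations M"
      by (rule tensor_simple[OF GM_module u(2)])
    have "tensor_coset M u = \<iota> (1 / of_nat N) x" unfolding \<iota>_def eq_iff by (rule x(3))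
    then have "w = f (\<iota> (1 / of_nat N) x)" by (simp add: u(1))
    then have "scale (of_nat N) w = f (of_nat N \<odot>\<^bsub>rational_tensor M\<^esub> \<iota> (1 / of_nat N) x)"
      by (simp add: f_smult \<iota> x(2))
    also have "\<dots> = \<phi> x" using x(1) by (simp add: \<iota>_smult \<phi>_def)
    finally show "w \<in> rational_span L" using x(1,2) unfolding rational_span_def L_def by blast
  qed
  ultimately show ?thesis using L by (intro that)
qed

end

section \<open>Integral forms as lattices of rational functions\<close>

definition int_basis :: "('i \<Rightarrow> rat) set \<Rightarrow> ('i \<Rightarrow> rat) set \<Rightarrow> bool" where
  "int_basis B L \<longleftrightarrow> finite B \<and> B \<subseteq> L \<and>
     (\<forall>x\<in>L. \<exists>c. x = (\<Sum>b\<in>B. scale (of_int (c b)) b)) \<and>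
     (\<forall>c. (\<Sum>b\<in>B. scale (of_int (c b)) b) = 0 \<longrightarrow> (\<forall>b\<in>B. c b = (0::int)))"

lemma int_basis_indep:
  assumes "int_basis B L" "(\<Sum>b\<in>B. scale (of_int (c b)) b) = 0"
  shows "\<forall>b\<in>B. c b = (0::int)"
proof -
  have "\<forall>c. (\<Sum>b\<in>B. scale (of_int (c b)) b) = 0 \<longrightarrow> (\<forall>b\<in>B. c b = (0::int))"
    using assms(1) unfolding int_basis_def by (elim conjE)
  from this[THEN spec, of c, THEN mp, OF assms(2)] show ?thesis .
qed

text \<open>Induction on the coordinates. The values at \<open>i\<close> form a cyclic group because
  the denominators are bounded, and an element with a generating value extends a basis of the
  subgroup that vanishes at \<open>i\<close>.\<close>

lemma exists_int_basis:
  assumes "finite I" and L: "zsubmodule L" and supp: "\<And>x i. x \<in> L \<Longrightarrow> i \<notin> I \<Longrightarrow> x i = 0"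
    and N: "(N::nat) > 0" "\<And>x i. x \<in> L \<Longrightarrow> of_nat N * x i \<in> \<int>"
  shows "\<exists>B. int_basis B L"
  using assms
proof (induction I arbitrary: L rule: finite_induct)
  case empty
  then have "L = {0}" using zsubmodule_0[OF empty.prems(1)] by (auto simp: fun_eq_iff)
  then have "int_basis {} L" by (simp add: int_basis_def)
  then show ?case ..
next
  case (insert i I)
  note L = insert.prems(1)
  define L' where "L' = {x \<in> L. x i = 0}"
  have L': "zsubmodule L'"
    using zsubmodule_0[OF L] zsubmodule_diff[OF L] by (auto simp: L'_def zsubmodule_def)
  have "\<exists>B. int_basis B L'"
  proof (rule insert.IH[OF L' _ N(1)])
    fix x j assume "x \<in> L'" "j \<notin> I"
    then show "x j = 0" using insert.prems(2)[of x j] by (cases "j = i") (auto simp: L'_def)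
  qed (auto simp: L'_def insert.prems(4))
  then obtain B where B: "int_basis B L'" ..
  let ?S = "(\<lambda>x. x i) ` L"
  have "zsubmodule ?S" using L by (rule zsubmodule_image) simp
  moreover note N(1)
  moreover have "of_nat N * y \<in> \<int>" if "y \<in> ?S" for y
    using that insert.prems(4) by blast
  ultimately obtain g where g: "g \<ge> 0" "?S = range (\<lambda>k. g * of_int k)"
    by (rule zsubmodule_rat_principal)
  show ?case
  proof (cases "g = 0")
    case True
    then have "L' = L" using g(2) by (auto simp: L'_def)
    then show ?thesis using B by blast
  next
    case False
    have "g \<in> ?S" unfolding g(2) by (intro image_eqI[of _ _ 1]) simp_all
    then obtain b0 where b0: "b0 \<in> L" "b0 i = g" by blast
    have fin: "finite B" and BL: "B \<subseteq> L'" using B by (simp_all add: int_basis_def)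
    have b0B: "b0 \<notin> B" using BL b0 False by (auto simp: L'_def)
    have ex: "\<exists>c. x = (\<Sum>b\<in>insert b0 B. scale (of_int (c b)) b)" if x: "x \<in> L" for x
    proof -
      have "x i \<in> range (\<lambda>k. g * of_int k)" unfolding g(2)[symmetric] using x by blast
      then obtain k where k: "x i = g * of_int k" by blast
      have "x - scale (of_int k) b0 \<in> L'"
        using zsubmodule_diff[OF L x zsubmodule_scale_int[OF L b0(1), of k]] b0(2) k
        by (simp add: L'_def)
      then obtain c where c: "x - scale (of_int k) b0 = (\<Sum>b\<in>B. scale (of_int (c b)) b)"
        using B unfolding int_basis_def by blast
      have "(\<Sum>b\<in>B. scale (of_int ((c(b0 := k)) b)) b) = (\<Sum>b\<in>B. scale (of_int (c b)) b)"
        using b0B by (intro sum.cong) auto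
      then have "x = (\<Sum>b\<in>insert b0 B. scale (of_int ((c(b0 := k)) b)) b)"
        using c fin b0B by (simp add: algebra_simps del: scale_apply)
      then show ?thesis by blast
    qed
    have indep: "c b = 0"
      if c: "(\<Sum>b\<in>insert b0 B. scale (of_int (c b)) b) = 0" and b: "b \<in> insert b0 B" for c :: "_ \<Rightarrow> int" and b
    proof -
      have "(\<Sum>b\<in>B. scale (of_int (c b)) b) i = 0"
        unfolding sum_fun_apply using BL by (intro sum.neutral) (auto simp: L'_def)
      moreover have "(scale (of_int (c b0)) b0 + (\<Sum>b\<in>B. scale (of_int (c b)) b)) i = 0"
        using c fin b0B by (simp del: scale_apply plus_fun_apply)
      ultimately have "c b0 = 0" using b0(2) False by simp
      moreover from this have "(\<Sum>b\<in>B. scale (of_int (c b)) b) = 0"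
        using c fin b0B by (simp del: scale_apply)
      then have "\<forall>b\<in>B. c b = 0" using B unfolding int_basis_def by blast
      ultimately show ?thesis using b by blast
    qed
    have "insert b0 B \<subseteq> L" using b0 BL by (auto simp: L'_def)
    then have "int_basis (insert b0 B) L"
      unfolding int_basis_def using fin ex indep by blast
    then show ?thesis ..
  qed
qed

text \<open>Countability allows a lattice to be copied into every infinite type, see
  \<open>exists_copy\<close>.\<close>

lemma int_basis_countable:
  assumes "int_basis B L"
  shows "countable L"
proof -
  have fin: "finite B" using assms by (simp add: int_basis_def)
  obtain bs where bs: "set bs = B" "distinct bs"
    using finite_distinct_list[OF fin] by blast
  have zip: "map2 (\<lambda>k b. scale (of_int k) b) (map c bs) bs = map (\<lambda>b. scale (of_int (c b)) b) bs"
    for c :: "('a \<Rightarrow> rat) \<Rightarrow> int"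
    by (induction bs) auto
  have "L \<subseteq> range (\<lambda>ks :: int list. sum_list (map2 (\<lambda>k b. scale (of_int k) b) ks bs))"
  proof
    fix x assume "x \<in> L"
    then obtain c where "x = (\<Sum>b\<in>B. scale (of_int (c b)) b)"
      using assms unfolding int_basis_def by blast
    also have "\<dots> = sum_list (map2 (\<lambda>k b. scale (of_int k) b) (map c bs) bs)"
      unfolding zip using bs by (simp add: sum_list_distinct_conv_sum_set)
    finally show "x \<in> range (\<lambda>ks :: int list. sum_list (map2 (\<lambda>k b. scale (of_int k) b) ks bs))"
      by (rule range_eqI)
  qed
  then show ?thesis by (rule countable_subset) simp
qed

section \<open>Freeness, bounded denominators and copies of lattices\<close>

lemma int_embedding_finsum:
  assumes M: "Module.module \<Z> M" and \<phi>: "int_embedding M \<phi>" and B: "finite B" "B \<subseteq> carrier M"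
  shows "\<phi> (\<Oplus>\<^bsub>M\<^esub>b\<in>B. c b \<odot>\<^bsub>M\<^esub> b) = (\<Sum>b\<in>B. scale (of_int (c b)) (\<phi> b))"
proof -
  interpret M: Module.module "\<Z>" M by (rule M)
  have add: "\<And>x y. x \<in> carrier M \<Longrightarrow> y \<in> carrier M \<Longrightarrow> \<phi> (x \<oplus>\<^bsub>M\<^esub> y) = \<phi> x + \<phi> y"
    and smult: "\<And>a x. x \<in> carrier M \<Longrightarrow> \<phi> (a \<odot>\<^bsub>M\<^esub> x) = scale (of_int a) (\<phi> x)"
    using \<phi> by (simp_all add: int_embedding_def)
  have "\<phi> \<zero>\<^bsub>M\<^esub> = \<phi> \<zero>\<^bsub>M\<^esub> + \<phi> \<zero>\<^bsub>M\<^esub>" using add[of "\<zero>\<^bsub>M\<^esub>" "\<zero>\<^bsub>M\<^esub>"] by simp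
  then have 0: "\<phi> \<zero>\<^bsub>M\<^esub> = 0" by simp
  show ?thesis
    using B
  proof (induction B rule: finite_induct)
    case (insert b B)
    have "(\<lambda>b. c b \<odot>\<^bsub>M\<^esub> b) \<in> B \<rightarrow> carrier M" using insert.prems by auto
    then have "\<phi> (\<Oplus>\<^bsub>M\<^esub>b\<in>insert b B. c b \<odot>\<^bsub>M\<^esub> b) = \<phi> (c b \<odot>\<^bsub>M\<^esub> b \<oplus>\<^bsub>M\<^esub> (\<Oplus>\<^bsub>M\<^esub>b\<in>B. c b \<odot>\<^bsub>M\<^esub> b))"
      using insert.hyps insert.prems by (subst M.M.finsum_insert) auto
    also have "\<dots> = scale (of_int (c b)) (\<phi> b) + \<phi> (\<Oplus>\<^bsub>M\<^esub>b\<in>B. c b \<odot>\<^bsub>M\<^esub> b)"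
      using insert.prems \<open>(\<lambda>b. c b \<odot>\<^bsub>M\<^esub> b) \<in> B \<rightarrow> carrier M\<close>
      by (subst add) (auto simp: smult intro!: M.M.finsum_closed)
    finally show ?case using insert by simp
  qed (simp add: 0)
qed

text \<open>The product of the multipliers of a finite basis works for all elements. It gives the
  bounded denominators that \<open>normalize_lattice\<close> asks for.\<close>

lemma uniform_multiple:
  assumes M: "Module.module \<Z> M" and free: "finitely_generated_free \<Z> M" and \<phi>: "int_embedding M \<phi>"
    and K: "zsubmodule K" and mult: "\<And>x. x \<in> carrier M \<Longrightarrow> \<exists>N::nat. N > 0 \<and> scale (of_nat N) (\<phi> x) \<in> K"
  shows "\<exists>N::nat. N > 0 \<and> (\<forall>x\<in>carrier M. scale (of_nat N) (\<phi> x) \<in> K)"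
proof -
  obtain B where B: "finite B" "B \<subseteq> carrier M"
    and ex: "\<forall>x\<in>carrier M. \<exists>!c. c \<in> B \<rightarrow>\<^sub>E carrier \<Z> \<and> x = (\<Oplus>\<^bsub>M\<^esub>b\<in>B. c b \<odot>\<^bsub>M\<^esub> b)"
    using free unfolding finitely_generated_free_def by blast
  obtain N where N: "\<And>b. b \<in> B \<Longrightarrow> N b > (0::nat) \<and> scale (of_nat (N b)) (\<phi> b) \<in> K"
    using mult B(2) by (metis subsetD)
  have *: "scale (of_nat (prod N B)) (\<phi> b) \<in> K" if b: "b \<in> B" for b
  proof -
    have "prod N B = prod N (B - {b}) * N b"
      using B(1) b by (simp add: prod.remove mult.commute)
    then have "scale (of_nat (prod N B)) (\<phi> b) = scale (of_nat (prod N (B - {b}))) (scale (of_nat (N b)) (\<phi> b))"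
      by (simp only: scale_simps of_nat_mult)
    also have "\<dots> \<in> K" by (rule zsubmodule_scale_nat[OF K]) (use N[OF b] in blast)
    finally show ?thesis .
  qed
  have "scale (of_nat (prod N B)) (\<phi> x) \<in> K" if x: "x \<in> carrier M" for x
  proof -
    obtain c where c: "x = (\<Oplus>\<^bsub>M\<^esub>b\<in>B. c b \<odot>\<^bsub>M\<^esub> b)" using ex x by blast
    have "\<phi> x = (\<Sum>b\<in>B. scale (of_int (c b)) (\<phi> b))"
      by (subst c) (rule int_embedding_finsum[OF M \<phi> B])
    then have "scale (of_nat (prod N B)) (\<phi> x)
        = (\<Sum>b\<in>B. scale (of_int (c b)) (scale (of_nat (prod N B)) (\<phi> b)))"
      by (simp only: scale_sum scale_simps mult.commute)
    also have "\<dots> \<in> K" by (intro zsubmodule_sum zsubmodule_scale_int K *)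
    finally show ?thesis .
  qed
  moreover have "prod N B > 0" using N by (simp add: prod_pos)
  ultimately show ?thesis by blast
qed

lemma finitely_generated_free_of_basis:
  assumes M: "Module.module \<Z> M" and \<phi>: "int_embedding M \<phi>" and B: "int_basis B (\<phi> ` carrier M)"
  shows "finitely_generated_free \<Z> M"
proof -
  interpret M: Module.module "\<Z>" M by (rule M)
  have inj: "inj_on \<phi> (carrier M)" using \<phi> by (simp add: int_embedding_def)
  have fin: "finite B" and BM: "B \<subseteq> \<phi> ` carrier M" using B by (simp_all add: int_basis_def)
  obtain A where A: "A \<subseteq> carrier M" "B = \<phi> ` A" using BM by (metis subset_imageE)
  have injA: "inj_on \<phi> A" using inj A(1) by (rule inj_on_subset)
  have finA: "finite A" using fin injA A(2) by (simp add: finite_image_iff)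
  have eval: "\<phi> (\<Oplus>\<^bsub>M\<^esub>a\<in>A. c a \<odot>\<^bsub>M\<^esub> a) = (\<Sum>a\<in>A. scale (of_int (c a)) (\<phi> a))" for c
    by (rule int_embedding_finsum[OF M \<phi> finA A(1)])
  have closed: "(\<Oplus>\<^bsub>M\<^esub>a\<in>A. c a \<odot>\<^bsub>M\<^esub> a) \<in> carrier M" for c
    using A(1) by (intro M.M.finsum_closed) auto
  have indep: "c a = 0" if "(\<Sum>a\<in>A. scale (of_int (c a)) (\<phi> a)) = 0" "a \<in> A" for c :: "_ \<Rightarrow> int" and a
  proof -
    let ?c = "\<lambda>b. c (inv_into A \<phi> b)"
    have "(\<Sum>b\<in>B. scale (of_int (?c b)) b) = (\<Sum>a\<in>A. scale (of_int (c a)) (\<phi> a))"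
      unfolding A(2) by (subst sum.reindex[OF injA]) (simp add: inv_into_f_f[OF injA] del: scale_apply)
    then have "\<forall>b\<in>B. ?c b = 0" unfolding that(1) by (rule int_basis_indep[OF B])
    then show ?thesis using that(2) A(2) inv_into_f_f[OF injA that(2)] by force
  qed
  have unique: "\<exists>!c. c \<in> A \<rightarrow>\<^sub>E carrier \<Z> \<and> x = (\<Oplus>\<^bsub>M\<^esub>a\<in>A. c a \<odot>\<^bsub>M\<^esub> a)" if x: "x \<in> carrier M" for x
  proof (rule ex_ex1I)
    obtain c where c: "\<phi> x = (\<Sum>b\<in>B. scale (of_int (c b)) b)"
      using B x unfolding int_basis_def by blast
    also have "\<dots> = (\<Sum>a\<in>A. scale (of_int (c (\<phi> a))) (\<phi> a))"
      unfolding A(2) by (subst sum.reindex[OF injA]) simp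
    also have "\<dots> = \<phi> (\<Oplus>\<^bsub>M\<^esub>a\<in>A. restrict (c \<circ> \<phi>) A a \<odot>\<^bsub>M\<^esub> a)"
      unfolding eval by (intro sum.cong refl) simp
    finally have "x = (\<Oplus>\<^bsub>M\<^esub>a\<in>A. restrict (c \<circ> \<phi>) A a \<odot>\<^bsub>M\<^esub> a)"
      by (rule inj_onD[OF inj _ x closed])
    moreover have "restrict (c \<circ> \<phi>) A \<in> A \<rightarrow>\<^sub>E carrier \<Z>" by simp
    ultimately show "\<exists>c. c \<in> A \<rightarrow>\<^sub>E carrier \<Z> \<and> x = (\<Oplus>\<^bsub>M\<^esub>a\<in>A. c a \<odot>\<^bsub>M\<^esub> a)" by blast
  next
    fix c d assume c: "c \<in> A \<rightarrow>\<^sub>E carrier \<Z> \<and> x = (\<Oplus>\<^bsub>M\<^esub>a\<in>A. c a \<odot>\<^bsub>M\<^esub> a)"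
      and d: "d \<in> A \<rightarrow>\<^sub>E carrier \<Z> \<and> x = (\<Oplus>\<^bsub>M\<^esub>a\<in>A. d a \<odot>\<^bsub>M\<^esub> a)"
    have "\<phi> x = (\<Sum>a\<in>A. scale (of_int (c a)) (\<phi> a))" using c eval by metis
    moreover have "\<phi> x = (\<Sum>a\<in>A. scale (of_int (d a)) (\<phi> a))" using d eval by metis
    ultimately have "(\<Sum>a\<in>A. scale (of_int (c a - d a)) (\<phi> a)) = 0"
      by (simp add: scale_distrib sum_subtractf del: scale_apply)
    then have "c a - d a = 0" if "a \<in> A" for a
      using indep[of "\<lambda>a. c a - d a"] that by blast
    then show "c = d"
      using c d by (intro extensionalityI[of c A d]) (auto simp: PiE_def)
  qed
  show ?thesis
    unfolding finitely_generated_free_def by (intro exI[of _ A] conjI ballI finA A(1) unique)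
qed

lemma subset_rational_span: "L \<subseteq> rational_span L"
proof
  fix x assume "x \<in> L"
  then show "x \<in> rational_span L" unfolding rational_span_def by (intro CollectI exI[of _ 1]) simp
qed

text \<open>A countable group fits into any infinite type; its structure is transported along
  \<open>j\<close> and the inverse \<open>k\<close>. So every lattice is represented in the type
  \<open>'m\<close> over which classes are formed.\<close>

lemma exists_copy:
  assumes G: "group G" and L: "zsubmodule L"
    and inv: "\<And>g x. g \<in> carrier G \<Longrightarrow> x \<in> L \<Longrightarrow> \<rho> g x \<in> L"
    and add: "\<And>g x y. g \<in> carrier G \<Longrightarrow> \<rho> g (x + y) = \<rho> g x + \<rho> g y"
    and scale: "\<And>g c x. g \<in> carrier G \<Longrightarrow> \<rho> g (scale c x) = scale c (\<rho> g x)"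
    and one: "\<And>x. x \<in> L \<Longrightarrow> \<rho> \<one>\<^bsub>G\<^esub> x = x"
    and mult: "\<And>g h x. g \<in> carrier G \<Longrightarrow> h \<in> carrier G \<Longrightarrow> x \<in> L \<Longrightarrow> \<rho> (g \<otimes>\<^bsub>G\<^esub> h) x = \<rho> g (\<rho> h x)"
    and B: "int_basis B L"
  shows "\<exists>M :: (int, 'm::infinite, 'g) gmodule. ZG_lattice G M \<and> group_ring_isomorphic G \<Z> M (int_vectors \<rho> L)"
proof -
  obtain f :: "nat \<Rightarrow> 'm" where f: "inj f"
    using infinite_countable_subset[OF infinite_UNIV] by blast
  define j where "j = f \<circ> to_nat_on L"
  have j: "inj_on j L"
    unfolding j_def using int_basis_countable[OF B] f
    by (intro comp_inj_on inj_on_to_nat_on) (auto intro: inj_on_subset)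
  define k where "k = inv_into L j"
  have kj: "k (j x) = x" if "x \<in> L" for x unfolding k_def using j that by (rule inv_into_f_f)
  define M :: "(int, 'm, 'g) gmodule" where "M = \<lparr>carrier = j ` L, monoid.mult = undefined, one = undefined,
    ring.zero = j 0, ring.add = (\<lambda>x y. j (k x + k y)), module.smult = (\<lambda>a x. j (scale (of_int a) (k x))),
    act = (\<lambda>g x. j (\<rho> g (k x)))\<rparr>"
  have sel: "carrier M = j ` L" "\<zero>\<^bsub>M\<^esub> = j 0" "x \<oplus>\<^bsub>M\<^esub> y = j (k x + k y)"
    "a \<odot>\<^bsub>M\<^esub> x = j (scale (of_int a) (k x))" "act M g x = j (\<rho> g (k x))" for x y a g
    by (simp_all add: M_def)
  note L_rules = zsubmodule_0[OF L] zsubmodule_add[OF L] zsubmodule_scale_int[OF L] zsubmodule_minus[OF L]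
  have "abelian_group M"
  proof (rule abelian_groupI)
    fix x assume "x \<in> carrier M"
    then obtain u where u: "u \<in> L" "x = j u" by (auto simp: sel)
    show "\<exists>y\<in>carrier M. y \<oplus>\<^bsub>M\<^esub> x = \<zero>\<^bsub>M\<^esub>"
      by (rule bexI[of _ "j (- u)"]) (simp_all add: sel u kj L_rules)
  qed (auto simp: sel kj L_rules add_ac)
  then have mod: "Module.module \<Z> M"
    using int_is_cring
    by (intro moduleI) (auto simp: sel kj L_rules scale_distrib simp del: scale_apply)
  have GM: "group_ring_module G \<Z> M"
    unfolding group_ring_module_def using G mod
    by (auto simp: sel kj L_rules inv add scale one mult simp del: scale_apply)
  have emb: "int_embedding M k"
    unfolding int_embedding_def by (auto simp: sel kj L_rules inj_on_def simp del: scale_apply)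
  have img: "k ` carrier M = L" by (auto simp: sel kj image_image)
  have "finitely_generated_free \<Z> M"
    by (rule finitely_generated_free_of_basis[OF mod emb, of B]) (simp add: img B)
  then have "ZG_lattice G M" using GM by (simp add: ZG_lattice_def)
  moreover have "group_ring_isomorphic G \<Z> M (int_vectors \<rho> L)"
    by (rule int_vectors_isoI[OF emb img]) (auto simp: sel kj inv)
  ultimately show ?thesis by blast
qed

section \<open>Classes of forms and representative lattices\<close>

lemma int_vectors_scale_iso:
  assumes c: "c \<noteq> 0" and scale: "\<And>g c x. g \<in> carrier G \<Longrightarrow> \<rho> g (scale c x) = scale c (\<rho> g x)"
  shows "group_ring_isomorphic G \<Z> (int_vectors \<rho> L) (int_vectors \<rho> (scale c ` L))"
proof -
  have "inj_on (scale c) L"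
  proof (rule inj_onI)
    fix x y assume "scale c x = scale c y"
    then have "scale (1 / c) (scale c x) = scale (1 / c) (scale c y)" by simp
    then show "x = y" using c by (simp del: scale_apply)
  qed
  then show ?thesis
    unfolding group_ring_isomorphic_def int_vectors_def
    by (intro exI[of _ "scale c"])
      (auto simp: bij_betw_def scale_distrib scale mult.commute simp del: scale_apply)
qed

lemma ZG_lattice_iso_sym:
  assumes "ZG_lattice G M" "group_ring_isomorphic G \<Z> M A"
  shows "group_ring_isomorphic G \<Z> A M"
proof -
  have "group_ring_module G \<Z> M" using assms(1) by (simp add: ZG_lattice_def)
  from group_ring_module_closed[OF this] show ?thesis
    by (intro group_ring_isomorphic_sym[OF assms(2)])
qed

text \<open>If every full invariant lattice has a multiple in \<open>LL\<close> and distinct members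
  of \<open>LL\<close> are not isomorphic, then sending a member to its class is a bijection.
  \<open>\<rho>\<close> is kept abstract to serve both partitions.\<close>

lemma card_Z_form_classes:
  fixes S :: "(int, 's, 'g) gmodule" and \<rho> :: "'g \<Rightarrow> ('i \<Rightarrow> rat) \<Rightarrow> 'i \<Rightarrow> rat"
  assumes S: "group_ring_module G \<Z> S" "group_ring_isomorphic G \<Z> S (int_vectors \<rho> LS)" "rational_span LS = W"
    and add: "\<And>g x y. g \<in> carrier G \<Longrightarrow> \<rho> g (x + y) = \<rho> g x + \<rho> g y"
    and scale: "\<And>g c x. g \<in> carrier G \<Longrightarrow> \<rho> g (scale c x) = scale c (\<rho> g x)"
    and one: "\<And>x. x \<in> W \<Longrightarrow> \<rho> \<one>\<^bsub>G\<^esub> x = x"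
    and mult: "\<And>g h x. g \<in> carrier G \<Longrightarrow> h \<in> carrier G \<Longrightarrow> x \<in> W \<Longrightarrow> \<rho> (g \<otimes>\<^bsub>G\<^esub> h) x = \<rho> g (\<rho> h x)"
    and K0: "zsubmodule K0" "rational_span K0 = W"
    and LL: "\<And>L. L \<in> LL \<Longrightarrow> zsubmodule L" "\<And>L g x. L \<in> LL \<Longrightarrow> g \<in> carrier G \<Longrightarrow> x \<in> L \<Longrightarrow> \<rho> g x \<in> L"
      "\<And>L. L \<in> LL \<Longrightarrow> rational_span L = W" "\<And>L. L \<in> LL \<Longrightarrow> \<exists>B. int_basis B L"
    and norm: "\<And>L. zsubmodule L \<Longrightarrow> (\<And>g x. g \<in> carrier G \<Longrightarrow> x \<in> L \<Longrightarrow> \<rho> g x \<in> L) \<Longrightarrow> rational_span L = W \<Longrightarrow>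
      \<exists>N::nat. N > 0 \<and> (\<forall>x\<in>L. scale (of_nat N) x \<in> K0) \<Longrightarrow> \<exists>c. c \<noteq> 0 \<and> scale c ` L \<in> LL"
    and uniq: "\<And>L K. L \<in> LL \<Longrightarrow> K \<in> LL \<Longrightarrow> group_ring_isomorphic G \<Z> (int_vectors \<rho> L) (int_vectors \<rho> K) \<Longrightarrow> L = K"
  shows "card (Z_form_classes G (rational_tensor S) :: (int, 'm::infinite, 'g) gmodule set set) = card LL"
proof -
  let ?V = "rational_tensor S"
  have G: "group G" using S(1) by (simp add: group_ring_module_def)
  have SW: "group_ring_isomorphic G rat_ring ?V (rat_vectors \<rho> W)"
    using rational_tensor_iso[OF S(1,2) add scale] S(3) by simp
  have WS: "group_ring_isomorphic G rat_ring (rat_vectors \<rho> W) ?V"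
    by (rule group_ring_isomorphic_sym[OF SW]) (rule rational_tensor_closed[OF S(1)]; assumption)+
  \<comment> \<open>This eliminates the tensor product: the forms are the lattices that are
    isomorphic to a subgroup with rational span \<open>W\<close>.\<close>
  have Z_form_iff: "Z_form G ?V M \<longleftrightarrow>
      ZG_lattice G M \<and> (\<exists>L. rational_span L = W \<and> group_ring_isomorphic G \<Z> M (int_vectors \<rho> L))"
    for M :: "(int, 'm, 'g) gmodule"
  proof
    assume M: "Z_form G ?V M"
    then have lat: "ZG_lattice G M" and iso: "group_ring_isomorphic G rat_ring (rational_tensor M) (rat_vectors \<rho> W)"
      using group_ring_isomorphic_trans[OF _ SW] by (auto simp: Z_form_def)
    then have GM: "group_ring_module G \<Z> M" and free: "finitely_generated_free \<Z> M"
      by (auto simp: ZG_lattice_def)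
    show "ZG_lattice G M \<and> (\<exists>L. rational_span L = W \<and> group_ring_isomorphic G \<Z> M (int_vectors \<rho> L))"
      using lattice_of_rational_iso[OF GM free iso] lat by metis
  next
    assume M: "ZG_lattice G M \<and> (\<exists>L. rational_span L = W \<and> group_ring_isomorphic G \<Z> M (int_vectors \<rho> L))"
    then obtain L where L: "rational_span L = W" "group_ring_isomorphic G \<Z> M (int_vectors \<rho> L)" by blast
    have GM: "group_ring_module G \<Z> M" using M by (simp add: ZG_lattice_def)
    have "group_ring_isomorphic G rat_ring (rational_tensor M) (rat_vectors \<rho> W)"
      using rational_tensor_iso[OF GM L(2) add scale] L(1) by simp
    then show "Z_form G ?V M"
      using M group_ring_isomorphic_trans[OF _ WS] by (simp add: Z_form_def)
  qed
  define cls where "cls L = {M :: (int, 'm, 'g) gmodule. ZG_lattice G M \<and> group_ring_isomorphic G \<Z> M (int_vectors \<rho> L)}" for L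
  have ne: "cls L \<noteq> {}" if L: "L \<in> LL" for L
  proof -
    have LW: "L \<subseteq> W" using subset_rational_span[of L] LL(3)[OF L] by simp
    obtain B where B: "int_basis B L" using LL(4)[OF L] by blast
    have "\<exists>M :: (int, 'm, 'g) gmodule. ZG_lattice G M \<and> group_ring_isomorphic G \<Z> M (int_vectors \<rho> L)"
      by (rule exists_copy[OF G LL(1)[OF L] LL(2)[OF L] add scale one mult B]) (use LW in auto)
    then show ?thesis by (simp add: cls_def)
  qed
  have inj: "inj_on cls LL"
  proof (rule inj_onI)
    fix L K assume LK: "L \<in> LL" "K \<in> LL" "cls L = cls K"
    then obtain M where M: "M \<in> cls L" "M \<in> cls K" using ne by blast
    then have "ZG_lattice G M" "group_ring_isomorphic G \<Z> M (int_vectors \<rho> L)" by (simp_all add: cls_def)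
    then have "group_ring_isomorphic G \<Z> (int_vectors \<rho> L) M" by (rule ZG_lattice_iso_sym)
    moreover have "group_ring_isomorphic G \<Z> M (int_vectors \<rho> K)" using M(2) by (simp add: cls_def)
    ultimately have "group_ring_isomorphic G \<Z> (int_vectors \<rho> L) (int_vectors \<rho> K)"
      by (rule group_ring_isomorphic_trans)
    then show "L = K" by (rule uniq[OF LK(1,2)])
  qed
  have lattice: "\<exists>L\<in>LL. M \<in> cls L" if M: "Z_form G ?V M" for M :: "(int, 'm, 'g) gmodule"
  proof -
    obtain L where L: "rational_span L = W" "group_ring_isomorphic G \<Z> M (int_vectors \<rho> L)"
      and lat: "ZG_lattice G M"
      using M Z_form_iff by blast
    then have GM: "group_ring_module G \<Z> M" and free: "finitely_generated_free \<Z> M"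
      by (auto simp: ZG_lattice_def)
    have mod: "Module.module \<Z> M" using GM by (simp add: group_ring_module_def)
    obtain \<phi> where \<phi>: "int_embedding M \<phi>" "\<phi> ` carrier M = L"
      "\<And>g x. g \<in> carrier G \<Longrightarrow> x \<in> carrier M \<Longrightarrow> \<phi> (act M g x) = \<rho> g (\<phi> x)"
      by (rule int_vectors_isoE[OF L(2)]) (rule that)
    have LW: "L \<subseteq> W" using subset_rational_span[of L] L(1) by simp
    have "\<exists>N::nat. N > 0 \<and> (\<forall>x\<in>carrier M. scale (of_nat N) (\<phi> x) \<in> K0)"
    proof (rule uniform_multiple[OF mod free \<phi>(1) K0(1)])
      fix x assume "x \<in> carrier M"
      then have "\<phi> x \<in> rational_span K0" using LW \<phi>(2) K0(2) by blast
      then show "\<exists>N::nat. N > 0 \<and> scale (of_nat N) (\<phi> x) \<in> K0" unfolding rational_span_def by blast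
    qed
    then have N: "\<exists>N::nat. N > 0 \<and> (\<forall>x\<in>L. scale (of_nat N) x \<in> K0)"
      unfolding \<phi>(2)[symmetric] by blast
    have zL: "zsubmodule L"
      using int_embedding_image_zsubmodule[OF mod \<phi>(1)] by (simp add: \<phi>(2))
    have inv: "\<rho> g x \<in> L" if g: "g \<in> carrier G" and x: "x \<in> L" for g x
    proof -
      obtain m where m: "m \<in> carrier M" "x = \<phi> m" using x \<phi>(2) by blast
      have "\<rho> g x = \<phi> (act M g m)" by (simp add: \<phi>(3)[OF g m(1)] m(2))
      then show ?thesis using group_ring_module_closed(3)[OF GM g m(1)] \<phi>(2) by blast
    qed
    obtain c where c: "c \<noteq> 0" "scale c ` L \<in> LL" using norm[OF zL inv L(1) N] by blast
    have "group_ring_isomorphic G \<Z> M (int_vectors \<rho> (scale c ` L))"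
      by (rule group_ring_isomorphic_trans[OF L(2) int_vectors_scale_iso[OF c(1) scale]])
    then show ?thesis using c(2) lat unfolding cls_def by blast
  qed
  have cls_Z_form: "Z_form G ?V M" if "L \<in> LL" "M \<in> cls L" for L M
    using that LL(3) unfolding Z_form_iff cls_def by blast
  let ?R = "{(M, N). Z_form G ?V M \<and> Z_form G ?V N \<and> group_ring_isomorphic G \<Z> M N}
    :: ((int, 'm, 'g) gmodule \<times> (int, 'm, 'g) gmodule) set"
  have R: "?R `` {M} = cls L" if L: "L \<in> LL" and M: "M \<in> cls L" for L M
  proof (intro equalityI subsetI)
    fix N assume "N \<in> ?R `` {M}"
    then have N: "Z_form G ?V N" "group_ring_isomorphic G \<Z> M N" by auto
    have "ZG_lattice G M" using M by (simp add: cls_def)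
    then have "group_ring_isomorphic G \<Z> N M" by (rule ZG_lattice_iso_sym[OF _ N(2)])
    moreover have "group_ring_isomorphic G \<Z> M (int_vectors \<rho> L)" using M by (simp add: cls_def)
    ultimately have "group_ring_isomorphic G \<Z> N (int_vectors \<rho> L)" by (rule group_ring_isomorphic_trans)
    then show "N \<in> cls L" using N(1) by (simp add: cls_def Z_form_def)
  next
    fix N assume N: "N \<in> cls L"
    then have "ZG_lattice G N" "group_ring_isomorphic G \<Z> N (int_vectors \<rho> L)" by (simp_all add: cls_def)
    then have "group_ring_isomorphic G \<Z> (int_vectors \<rho> L) N" by (rule ZG_lattice_iso_sym)
    then have "group_ring_isomorphic G \<Z> M N"
      using M by (intro group_ring_isomorphic_trans[of G \<Z> M "int_vectors \<rho> L" N]) (simp_all add: cls_def)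
    then show "N \<in> ?R `` {M}" using cls_Z_form[OF L M] cls_Z_form[OF L N] by simp
  qed
  have "(Z_form_classes G ?V :: (int, 'm, 'g) gmodule set set) = cls ` LL"
  proof (intro equalityI subsetI)
    fix C assume "C \<in> (Z_form_classes G ?V :: (int, 'm, 'g) gmodule set set)"
    then obtain M where M: "Z_form G ?V M" "C = ?R `` {M}"
      unfolding Z_form_classes_def by (elim quotientE) blast
    obtain L where "L \<in> LL" "M \<in> cls L" using lattice[OF M(1)] by blast
    then show "C \<in> cls ` LL" using R M(2) by blast
  next
    fix C assume "C \<in> cls ` LL"
    then obtain L where L: "L \<in> LL" "C = cls L" by blast
    obtain M where M: "M \<in> cls L" using ne[OF L(1)] by blast
    have "C = ?R `` {M}" using R[OF L(1) M] L(2) by simp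
    moreover have "?R `` {M} \<in> {M. Z_form G ?V M} // ?R"
      by (rule quotientI) (simp add: cls_Z_form[OF L(1) M])
    ultimately show "C \<in> Z_form_classes G ?V" unfolding Z_form_classes_def by simp
  qed
  then show ?thesis using card_image[OF inj] by simp
qed

section \<open>Specht modules\<close>

lemma permutes_0: "p permutes {1..n} \<Longrightarrow> p 0 = (0::nat)"
  by (simp add: permutes_def)

lemma tableaux_compose:
  assumes t: "t \<in> tableaux l" and p: "p permutes {1..sum_list l}"
  shows "p \<circ> t \<in> tableaux l"
proof -
  have "bij_betw (p \<circ> t) (young_diagram l) {1..sum_list l}"
    using t permutes_imp_bij[OF p] unfolding tableaux_def by (auto intro: bij_betw_trans)
  then show ?thesis using t permutes_0[OF p] by (auto simp: tableaux_def)
qed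

lemma inv_compose_cancel:
  assumes p: "p permutes S"
  shows "p \<circ> (inv_into UNIV p \<circ> t) = t" "inv_into UNIV p \<circ> (p \<circ> t) = t"
  using permutes_inverses[OF p] by (auto simp: fun_eq_iff)

lemma tableaux_bij:
  assumes p: "p permutes {1..sum_list l}"
  shows "bij_betw (\<lambda>t. p \<circ> t) (tableaux l) (tableaux l)"
  by (rule bij_betw_byWitness[of _ "\<lambda>t. inv_into UNIV p \<circ> t"])
    (use inv_compose_cancel[OF p] tableaux_compose[OF _ p] tableaux_compose[OF _ permutes_inv[OF p]] in auto)

lemma tabloid_self: "t \<in> tableaux l \<Longrightarrow> t \<in> tabloid l t"
  by (simp add: tabloid_def)

lemma tabloid_eq_iff:
  assumes "s \<in> tableaux l"
  shows "tabloid l s = tabloid l t \<longleftrightarrow> s \<in> tabloid l t"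
proof
  assume "tabloid l s = tabloid l t"
  then show "s \<in> tabloid l t" using tabloid_self[OF assms] by simp
next
  assume "s \<in> tabloid l t"
  then have "\<forall>i. s ` row l i = t ` row l i" by (simp add: tabloid_def)
  then show "tabloid l s = tabloid l t" by (simp add: tabloid_def)
qed

lemma tabloid_compose:
  assumes p: "p permutes {1..sum_list l}"
  shows "tabloid l (p \<circ> t) = (\<lambda>s. p \<circ> s) ` tabloid l t"
proof (intro equalityI subsetI)
  fix s assume "s \<in> tabloid l (p \<circ> t)"
  then have s: "s \<in> tableaux l" "\<And>i. s ` row l i = p ` t ` row l i"
    by (auto simp: tabloid_def image_comp)
  have "(inv_into UNIV p \<circ> s) ` row l i = t ` row l i" for i
  proof -
    have "(inv_into UNIV p \<circ> s) ` row l i = inv_into UNIV p ` p ` t ` row l i"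
      unfolding s(2)[symmetric] by (simp add: image_comp)
    also have "\<dots> = t ` row l i" using permutes_inverses(2)[OF p] by (simp add: image_image)
    finally show ?thesis .
  qed
  then have "inv_into UNIV p \<circ> s \<in> tabloid l t"
    using tableaux_compose[OF s(1) permutes_inv[OF p]] by (simp add: tabloid_def)
  then show "s \<in> (\<lambda>s. p \<circ> s) ` tabloid l t"
    using inv_compose_cancel(1)[OF p, of s] by (intro image_eqI[of _ _ "inv_into UNIV p \<circ> s"]) simp_all
next
  fix s assume "s \<in> (\<lambda>s. p \<circ> s) ` tabloid l t"
  then obtain u where u: "s = p \<circ> u" "u \<in> tableaux l" "\<And>i. u ` row l i = t ` row l i"
    by (auto simp: tabloid_def)
  have "(p \<circ> u) ` row l i = (p \<circ> t) ` row l i" for i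
    unfolding image_comp[symmetric] u(3) ..
  then show "s \<in> tabloid l (p \<circ> t)"
    using tableaux_compose[OF u(2) p] by (simp add: tabloid_def u(1))
qed

lemma act_permutation_lattice:
  assumes "p permutes {1..sum_list l}"
  shows "act (permutation_lattice l) p f = (\<lambda>T. f ((\<lambda>t. inv_into UNIV p \<circ> t) ` T))"
  using assms by (simp add: permutation_lattice_def sym_group_carrier)

lemma image_compose_cancel:
  assumes p: "p permutes S"
  shows "(\<lambda>t. p \<circ> t) ` (\<lambda>t. inv_into UNIV p \<circ> t) ` T = T"
    and "(\<lambda>t. inv_into UNIV p \<circ> t) ` (\<lambda>t. p \<circ> t) ` T = T"
  by (simp_all add: image_image inv_compose_cancel[OF p])

text \<open>Conjugation by \<open>p\<close> maps the column stabilizer of \<open>t\<close> to that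
  of \<open>p \<circ> t\<close> and preserves signs.\<close>

lemma polytabloid_act:
  assumes t: "t \<in> tableaux l" and p: "p permutes {1..sum_list l}"
  shows "act (permutation_lattice l) p (polytabloid l t) = polytabloid l (p \<circ> t)"
proof
  fix T
  let ?q = "inv_into UNIV p"
  let ?C = "column_stabilizer l"
  have q: "?q permutes {1..sum_list l}" using p by (rule permutes_inv)
  have perm: "permutation p" "permutation ?q"
    using p q by (auto intro: permutation_permutes[THEN iffD2])
  have C: "r \<circ> \<sigma> \<circ> inv_into UNIV r \<in> ?C (r \<circ> t)" if "\<sigma> \<in> ?C t" "r permutes {1..sum_list l}" for \<sigma> r t
  proof -
    have \<sigma>: "\<sigma> permutes {1..sum_list l}" "\<And>j. \<sigma> ` t ` column l j = t ` column l j"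
      using that(1) by (auto simp: column_stabilizer_def sym_group_carrier)
    have "r \<circ> \<sigma> \<circ> inv_into UNIV r permutes {1..sum_list l}"
      by (intro permutes_compose permutes_inv \<sigma>(1) that(2))
    moreover have "(r \<circ> \<sigma> \<circ> inv_into UNIV r) ` (r \<circ> t) ` column l j = (r \<circ> t) ` column l j" for j
    proof -
      have "inv_into UNIV r ` r ` A = A" for A using permutes_inverses(2)[OF that(2)] by (simp add: image_image)
      then show ?thesis by (simp only: image_comp[symmetric] \<sigma>(2))
    qed
    ultimately show ?thesis
      unfolding column_stabilizer_def sym_group_carrier mem_Collect_eq by blast
  qed
  have bij: "bij_betw (\<lambda>\<sigma>. p \<circ> \<sigma> \<circ> ?q) (?C t) (?C (p \<circ> t))"
  proof (rule bij_betw_byWitness[of _ "\<lambda>\<sigma>. ?q \<circ> \<sigma> \<circ> p"])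
    show "(\<lambda>\<sigma>. p \<circ> \<sigma> \<circ> ?q) ` ?C t \<subseteq> ?C (p \<circ> t)" using C p by blast
    have "?q \<circ> \<sigma> \<circ> p \<in> ?C t" if "\<sigma> \<in> ?C (p \<circ> t)" for \<sigma>
      using C[OF that q] inv_compose_cancel(2)[OF p, of t] by (simp add: permutes_inv_inv[OF p])
    then show "(\<lambda>\<sigma>. ?q \<circ> \<sigma> \<circ> p) ` ?C (p \<circ> t) \<subseteq> ?C t" by blast
  qed (use permutes_inverses[OF p] in \<open>auto simp: fun_eq_iff\<close>)
  have sgn: "sign (p \<circ> \<sigma> \<circ> ?q) = sign \<sigma>" if "\<sigma> \<in> ?C t" for \<sigma>
  proof -
    have "permutation \<sigma>"
      using that by (auto simp: column_stabilizer_def intro: sym_group_carrier')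
    then have "sign (p \<circ> \<sigma> \<circ> ?q) = sign p * sign \<sigma> * sign p"
      using perm by (simp add: sign_compose permutation_compose sign_inverse)
    also have "\<dots> = sign \<sigma>" by (simp add: mult.left_commute mult.commute[of "sign \<sigma>"] sign_idempotent)
    finally show ?thesis .
  qed
  have eq: "(\<lambda>t. ?q \<circ> t) ` T = tabloid l (\<sigma> \<circ> t) \<longleftrightarrow> T = tabloid l (p \<circ> \<sigma> \<circ> ?q \<circ> (p \<circ> t))" for \<sigma>
  proof -
    have "p \<circ> \<sigma> \<circ> ?q \<circ> (p \<circ> t) = p \<circ> (\<sigma> \<circ> t)"
      using inv_compose_cancel(2)[OF p, of t] by (simp add: comp_assoc)
    then have "tabloid l (p \<circ> \<sigma> \<circ> ?q \<circ> (p \<circ> t)) = (\<lambda>s. p \<circ> s) ` tabloid l (\<sigma> \<circ> t)"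
      by (simp only: tabloid_compose[OF p])
    then show ?thesis using image_compose_cancel[OF p] by metis
  qed
  show "act (permutation_lattice l) p (polytabloid l t) T = polytabloid l (p \<circ> t) T"
    unfolding act_permutation_lattice[OF p] polytabloid_def
      sum.reindex_bij_betw[OF bij, symmetric]
    by (intro sum.cong refl) (simp add: sgn eq)
qed

section \<open>The Specht lattice as a module\<close>

lemma specht_Z_simps:
  "\<zero>\<^bsub>specht_Z l\<^esub> = (\<lambda>T. 0)" "f \<oplus>\<^bsub>specht_Z l\<^esub> g = (\<lambda>T. f T + g T)"
  "a \<odot>\<^bsub>specht_Z l\<^esub> f = (\<lambda>T. a * f T)" "act (specht_Z l) = act (permutation_lattice l)"
  "carrier (specht_Z l) = {(\<lambda>T. \<Sum>t\<in>tableaux l. c t * polytabloid l t T) | c. True}"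
  by (simp_all add: specht_Z_def permutation_lattice_def)

lemma specht_Z_I: "(\<lambda>T. \<Sum>t\<in>tableaux l. c t * polytabloid l t T) \<in> carrier (specht_Z l)"
  unfolding specht_Z_simps by (intro CollectI exI[of _ c] conjI TrueI refl)

lemma specht_Z_E:
  assumes "f \<in> carrier (specht_Z l)"
  obtains c where "f = (\<lambda>T. \<Sum>t\<in>tableaux l. c t * polytabloid l t T)"
  using assms unfolding specht_Z_simps by (elim CollectE exE conjE)

lemma specht_Z_act:
  assumes f: "f \<in> carrier (specht_Z l)" and p: "p permutes {1..sum_list l}"
  shows "act (specht_Z l) p f \<in> carrier (specht_Z l)"
proof -
  let ?q = "inv_into UNIV p"
  obtain c where c: "f = (\<lambda>T. \<Sum>t\<in>tableaux l. c t * polytabloid l t T)"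
    using f by (rule specht_Z_E)
  have "act (specht_Z l) p f T = (\<Sum>t\<in>tableaux l. c (?q \<circ> t) * polytabloid l t T)" for T
  proof -
    have "act (specht_Z l) p f T = (\<Sum>t\<in>tableaux l. c t * act (permutation_lattice l) p (polytabloid l t) T)"
      by (simp add: specht_Z_simps act_permutation_lattice[OF p] c)
    also have "\<dots> = (\<Sum>t\<in>tableaux l. c (?q \<circ> (p \<circ> t)) * polytabloid l (p \<circ> t) T)"
      by (intro sum.cong refl) (simp only: polytabloid_act[OF _ p] inv_compose_cancel[OF p])
    also have "\<dots> = (\<Sum>t\<in>tableaux l. c (?q \<circ> t) * polytabloid l t T)"
      by (rule sum.reindex_bij_betw[OF tableaux_bij[OF p]])
    finally show ?thesis .
  qed
  then have "act (specht_Z l) p f = (\<lambda>T. \<Sum>t\<in>tableaux l. c (?q \<circ> t) * polytabloid l t T)" ..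
  then show ?thesis by (simp only: specht_Z_I)
qed

lemma specht_Z_group_ring_module: "group_ring_module (sym_group (sum_list l)) \<Z> (specht_Z l)"
proof -
  let ?S = "specht_Z l" and ?G = "sym_group (sum_list l)"
  note carrierI = specht_Z_I[where l = l]
  have add: "(\<lambda>T. f T + g T) \<in> carrier ?S" if fg: "f \<in> carrier ?S" "g \<in> carrier ?S" for f g
  proof -
    obtain c where "f = (\<lambda>T. \<Sum>t\<in>tableaux l. c t * polytabloid l t T)"
      using fg(1) by (rule specht_Z_E)
    moreover obtain d where "g = (\<lambda>T. \<Sum>t\<in>tableaux l. d t * polytabloid l t T)"
      using fg(2) by (rule specht_Z_E)
    ultimately show ?thesis
      using carrierI[where c = "\<lambda>t. c t + d t"] by (simp add: distrib_right sum.distrib)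
  qed
  have smult: "(\<lambda>T. a * f T) \<in> carrier ?S" if f: "f \<in> carrier ?S" for a f
  proof -
    obtain c where "f = (\<lambda>T. \<Sum>t\<in>tableaux l. c t * polytabloid l t T)"
      using f by (rule specht_Z_E)
    then show ?thesis
      using carrierI[where c = "\<lambda>t. a * c t"] by (simp add: sum_distrib_left mult.assoc)
  qed
  have zero: "(\<lambda>T. 0) \<in> carrier ?S" using carrierI[where c = "\<lambda>t. 0"] by simp
  have "abelian_group ?S"
  proof (rule abelian_groupI)
    fix f assume "f \<in> carrier ?S"
    then show "\<exists>g\<in>carrier ?S. g \<oplus>\<^bsub>?S\<^esub> f = \<zero>\<^bsub>?S\<^esub>"
      using smult[of f "- 1"] by (intro bexI[of _ "\<lambda>T. - 1 * f T"]) (simp_all add: specht_Z_simps(1,2))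
  qed (simp_all add: specht_Z_simps(1,2) add zero add_ac)
  then have mod: "Module.module \<Z> ?S"
    using int_is_cring
    by (intro moduleI) (simp_all add: specht_Z_simps(1-3) smult algebra_simps)
  have act_one: "act ?S \<one>\<^bsub>?G\<^esub> f = f" for f
  proof -
    have "id permutes {1..sum_list l}" by (rule permutes_id)
    then show ?thesis
      by (simp add: specht_Z_simps(4) sym_group_one act_permutation_lattice)
  qed
  have act_mult: "act ?S (p \<otimes>\<^bsub>?G\<^esub> q) f = act ?S p (act ?S q f)"
    if pq: "p \<in> carrier ?G" "q \<in> carrier ?G" for p q f
  proof -
    have p: "p permutes {1..sum_list l}" and q: "q permutes {1..sum_list l}"
      using pq by (simp_all add: sym_group_carrier)
    have "inv_into UNIV (p \<circ> q) = inv_into UNIV q \<circ> inv_into UNIV p"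
      using permutes_bij[OF p] permutes_bij[OF q] by (rule o_inv_distrib)
    then show ?thesis
      unfolding specht_Z_simps(4) sym_group_mult act_permutation_lattice[OF permutes_compose[OF q p]]
        act_permutation_lattice[OF p] act_permutation_lattice[OF q]
      by (simp add: image_image comp_assoc)
  qed
  show ?thesis
    unfolding group_ring_module_def
  proof (intro conjI ballI)
    show "group ?G" by (rule sym_group_is_group)
    show "Module.module \<Z> ?S" by (rule mod)
    fix p assume "p \<in> carrier ?G"
    then have p: "p permutes {1..sum_list l}" by (simp add: sym_group_carrier)
    show "act ?S p f \<in> carrier ?S" if "f \<in> carrier ?S" for f
      using that p by (rule specht_Z_act)
    show "act ?S p (f \<oplus>\<^bsub>?S\<^esub> g) = act ?S p f \<oplus>\<^bsub>?S\<^esub> act ?S p g" for f g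
      by (simp add: specht_Z_simps(2,4) act_permutation_lattice[OF p])
    show "act ?S p (a \<odot>\<^bsub>?S\<^esub> f) = a \<odot>\<^bsub>?S\<^esub> act ?S p f" for a f
      by (simp add: specht_Z_simps(3,4) act_permutation_lattice[OF p])
  qed (simp_all add: act_one act_mult)
qed

lemma polytabloid_in_specht:
  assumes t: "t \<in> tableaux l" and fin: "finite (tableaux l)"
  shows "polytabloid l t \<in> carrier (specht_Z l)"
proof -
  have "polytabloid l t = (\<lambda>T. \<Sum>s\<in>tableaux l. of_bool (s = t) * polytabloid l s T)"
    using t fin by (simp add: of_bool_def if_distrib[of "\<lambda>x. x * _"] cong: if_cong)
  then show ?thesis by (simp only: specht_Z_I)
qed

lemma polytabloid_off_tabloids:
  assumes "t \<in> tableaux l" "T \<notin> tabloids l"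
  shows "polytabloid l t T = 0"
proof -
  have "T \<noteq> tabloid l (\<sigma> \<circ> t)" if "\<sigma> \<in> column_stabilizer l t" for \<sigma>
    using that assms tableaux_compose[OF assms(1), of \<sigma>]
    by (auto simp: tabloids_def column_stabilizer_def sym_group_carrier)
  then show ?thesis by (simp add: polytabloid_def)
qed

lemma specht_off_tabloids:
  assumes "f \<in> carrier (specht_Z l)" "T \<notin> tabloids l"
  shows "f T = 0"
proof -
  obtain c where "f = (\<lambda>T. \<Sum>t\<in>tableaux l. c t * polytabloid l t T)"
    using assms(1) by (rule specht_Z_E)
  then show ?thesis by (simp add: polytabloid_off_tabloids assms(2))
qed

text \<open>A permutation of the triangle is determined by the images of \<open>q\<close> and
  \<open>r\<close>. The three even ones give its arcs and the three odd ones the reversed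
  arcs.\<close>

lemma sum_permutes3:
  assumes "distinct [p, q, r]"
  shows "(\<Sum>\<sigma>\<in>{\<sigma>. \<sigma> permutes {p, q, r}}. of_int (sign \<sigma>) * of_bool (\<sigma> q = a \<and> \<sigma> r = b)) = tri p q r (a, b)"
proof -
  let ?f = "\<lambda>\<sigma>. of_int (sign \<sigma>) * of_bool (\<sigma> q = a \<and> \<sigma> r = b) :: rat"
  have d: "p \<noteq> q" "p \<noteq> r" "q \<noteq> r" "q \<noteq> p" "r \<noteq> p" "r \<noteq> q" using assms by auto
  have two: "sum g {\<sigma>. \<sigma> permutes {q, r}} = g id + g (transpose q r)" for g :: "('a \<Rightarrow> 'a) \<Rightarrow> rat"
    using d sum_over_permutations_insert[of "{r}" q g]
      sum_over_permutations_insert[of "{}" r "\<lambda>s. g (transpose q q \<circ> s)"]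
      sum_over_permutations_insert[of "{}" r "\<lambda>s. g (transpose q r \<circ> s)"]
    by simp
  have "(\<Sum>\<sigma>\<in>{\<sigma>. \<sigma> permutes {p, q, r}}. ?f \<sigma>)
      = (\<Sum>b\<in>{p, q, r}. \<Sum>s\<in>{\<sigma>. \<sigma> permutes {q, r}}. ?f (transpose p b \<circ> s))"
    by (rule sum_over_permutations_insert) (use d in auto)
  also have "\<dots> = (?f id + ?f (transpose q r)) + ((?f (transpose p q) + ?f (transpose p q \<circ> transpose q r))
      + (?f (transpose p r) + ?f (transpose p r \<circ> transpose q r)))"
    using d by (simp add: two)
  also have "\<dots> = tri p q r (a, b)"
  proof -
    have sgn: "sign (transpose x y) = - 1" "sign (transpose x y \<circ> transpose z w) = 1"
      if "x \<noteq> y" "z \<noteq> w" for x y z w :: 'a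
      using that by (simp_all add: sign_compose permutation_swap_id sign_swap_id)
    have bool: "of_bool (q = a \<and> r = b) = (of_bool ((a, b) = (q, r)) :: rat)"
      "of_bool (r = a \<and> q = b) = (of_bool ((a, b) = (r, q)) :: rat)"
      "of_bool (p = a \<and> r = b) = (of_bool ((a, b) = (p, r)) :: rat)"
      "of_bool (r = a \<and> p = b) = (of_bool ((a, b) = (r, p)) :: rat)"
      "of_bool (q = a \<and> p = b) = (of_bool ((a, b) = (q, p)) :: rat)"
      "of_bool (p = a \<and> q = b) = (of_bool ((a, b) = (p, q)) :: rat)"
      by (auto intro: arg_cong[where f = of_bool])
    show ?thesis
      using d by (simp add: sgn transpose_def bool tri_def arc_def del: prod.inject)
  qed
  finally show ?thesis .
qed

text \<open>Both sides pair the triangle with the arc from \<open>x\<close> to \<open>y\<close>, and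
  the pairing is symmetric.\<close>

lemma tri_eq_tri_sum: "tri p q r (x, y) = tri_sum (arc x y) p q r"
proof -
  have "arc a b (x, y) = arc x y (a, b)" for a b
    unfolding arc_def by (intro arg_cong2[where f = minus] arg_cong[where f = of_bool]) auto
  then show ?thesis by (simp add: tri_def tri_sum_def)
qed

lemma (in flows) rational_span_W:
  assumes L: "L \<subseteq> W" and N: "(N::nat) > 0" "\<And>z. z \<in> L0 \<Longrightarrow> scale (of_nat N) z \<in> L"
  shows "rational_span L = W"
proof (intro equalityI subsetI)
  fix x assume "x \<in> rational_span L"
  then obtain K :: nat where K: "K > 0" "scale (of_nat K) x \<in> L" unfolding rational_span_def by blast
  then have "scale (of_nat K) x \<in> W" using L by blast
  then have "scale (1 / of_nat K) (scale (of_nat K) x) \<in> W" by (rule W_scale)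
  then show "x \<in> W" using K(1) by (simp del: scale_apply)
next
  fix x assume "x \<in> W"
  then obtain K :: nat where K: "K > 0" "scale (of_nat K) x \<in> L0" by (rule multiple_in_L0)
  then have "scale (of_nat (N * K)) x \<in> L" using N(2)[OF K(2)] by (simp del: scale_apply)
  then show "x \<in> rational_span L" unfolding rational_span_def using K(1) N(1) by (intro CollectI exI[of _ "N * K"]) simp
qed

text \<open>The inverse turns the right action \<open>pull\<close> into a left action. The character
  \<open>\<chi>\<close> is trivial for leg length 2 and the sign for arm length 2.\<close>

definition twisted :: "(('v \<Rightarrow> 'v) \<Rightarrow> int) \<Rightarrow> ('v \<Rightarrow> 'v) \<Rightarrow> ('v \<times> 'v \<Rightarrow> rat) \<Rightarrow> 'v \<times> 'v \<Rightarrow> rat" where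
  "twisted \<chi> p x = scale (of_int (\<chi> p)) (pull (inv_into UNIV p) x)"

subsection \<open>Hook partitions\<close>

locale hook = flows n for n :: nat +
  fixes k :: nat
  assumes k: "1 \<le> k" "k < n"
begin

definition l :: "nat list" where "l = hook_partition n k"

lemma sum_l: "sum_list l = n"
  using k by (simp add: l_def hook_partition_def sum_list_replicate)

lemma V_eq: "{1..sum_list l} = V"
  by (simp add: sum_l V_def)

lemma diagram_iff: "(i, j) \<in> young_diagram l \<longleftrightarrow> (i = 0 \<and> j < n - k) \<or> (1 \<le> i \<and> i \<le> k \<and> j = 0)"
  by (cases i) (auto simp: young_diagram_def l_def hook_partition_def)

text \<open>The corner belongs to the arm, so the first column is the leg together with
  \<open>(0, 0)\<close>.\<close>

definition arm :: "(nat \<times> nat) set" where "arm = {0} \<times> {..<n - k}"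
definition leg :: "(nat \<times> nat) set" where "leg = {1..k} \<times> {0}"

lemma diagram_eq: "young_diagram l = arm \<union> leg"
proof (rule Set.set_eqI)
  show "c \<in> young_diagram l \<longleftrightarrow> c \<in> arm \<union> leg" for c
    by (cases c) (auto simp: diagram_iff arm_def leg_def)
qed

lemma arm_leg: "arm \<inter> leg = {}" "finite arm" "finite leg" "card arm = n - k" "card leg = k"
  by (auto simp: arm_def leg_def)

lemma row_eq: "row l i = (if i = 0 then arm else if i \<le> k then {(i, 0)} else {})"
  unfolding row_def by (auto simp: diagram_iff arm_def)

lemma column_eq: "column l j = (if j = 0 then insert (0, 0) leg else if j < n - k then {(0, j)} else {})"
  unfolding column_def using k by (auto simp: diagram_iff leg_def)

section \<open>Tableaux, tabloids and column stabilizers of hooks\<close>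

lemma tableaux_iff:
  "t \<in> tableaux l \<longleftrightarrow> bij_betw t (arm \<union> leg) V \<and> (\<forall>c. c \<notin> arm \<union> leg \<longrightarrow> t c = 0)"
  unfolding tableaux_def diagram_eq V_eq mem_Collect_eq ..

lemma tableauxD:
  assumes "t \<in> tableaux l"
  shows "bij_betw t (arm \<union> leg) V" "c \<notin> arm \<union> leg \<Longrightarrow> t c = 0"
  using assms unfolding tableaux_iff by blast+

lemma tableau_inj:
  "t \<in> tableaux l \<Longrightarrow> c \<in> arm \<union> leg \<Longrightarrow> d \<in> arm \<union> leg \<Longrightarrow> t c = t d \<longleftrightarrow> c = d"
  using tableauxD(1) unfolding bij_betw_def by (auto dest: inj_onD)

lemma tableau_in_V: "t \<in> tableaux l \<Longrightarrow> c \<in> arm \<union> leg \<Longrightarrow> t c \<in> V"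
  using tableauxD(1) by (rule bij_betw_apply)

lemma tableau_compose: "t \<in> tableaux l \<Longrightarrow> p permutes V \<Longrightarrow> p \<circ> t \<in> tableaux l"
  using tableaux_compose[of t l p] by (simp only: V_eq)

lemma tableau_permutes:
  assumes s: "s \<in> tableaux l" and t: "t \<in> tableaux l"
  obtains p where "p permutes V" "s = p \<circ> t"
proof -
  define p where "p v = (if v \<in> V then s (inv_into (arm \<union> leg) t v) else v)" for v
  have "bij_betw (s \<circ> inv_into (arm \<union> leg) t) V V"
    by (rule bij_betw_trans[OF bij_betw_inv_into[OF tableauxD(1)[OF t]] tableauxD(1)[OF s]])
  then have "bij_betw p V V"
    by (rule bij_betw_cong[THEN iffD1, rotated]) (simp add: p_def)
  then have "p permutes V" by (rule bij_imp_permutes) (simp add: p_def)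
  moreover have "s = p \<circ> t"
  proof
    fix c
    show "s c = (p \<circ> t) c"
    proof (cases "c \<in> arm \<union> leg")
      case True
      then have "inv_into (arm \<union> leg) t (t c) = c"
        using tableauxD(1)[OF t] by (intro inv_into_f_f) (simp_all add: bij_betw_def)
      then show ?thesis using tableau_in_V[OF t True] by (simp add: p_def)
    next
      case False
      have "0 \<notin> V" by (simp add: V_def)
      then show ?thesis using False s t by (simp add: tableauxD(2) p_def)
    qed
  qed
  ultimately show ?thesis by (rule that)
qed

lemma compose_tableau_eq:
  assumes t: "t \<in> tableaux l" and p: "p permutes V" "q permutes V" and eq: "p \<circ> t = q \<circ> t"
  shows "p = q"
proof
  fix v
  show "p v = q v"
  proof (cases "v \<in> V")
    case True
    then obtain c where "v = t c" using tableauxD(1)[OF t] unfolding bij_betw_def by blast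
    then show ?thesis using fun_cong[OF eq, of c] by simp
  qed (use p in \<open>simp add: permutes_def\<close>)
qed

lemma tableaux_nonempty: "tableaux l \<noteq> {}"
proof -
  have "card (arm \<union> leg) = card V"
    using k arm_leg by (simp add: card_Un_disjoint)
  then obtain b where b: "bij_betw b (arm \<union> leg) V"
    using finite_same_card_bij[of "arm \<union> leg" V] arm_leg by auto
  have "bij_betw (\<lambda>c. if c \<in> arm \<union> leg then b c else 0) (arm \<union> leg) V"
    using b by (rule bij_betw_cong[THEN iffD1, rotated]) simp
  then have "(\<lambda>c. if c \<in> arm \<union> leg then b c else 0) \<in> tableaux l"
    unfolding tableaux_iff by simp
  then show ?thesis by blast
qed

lemma finite_tableaux: "finite (tableaux l)"
proof -
  obtain t where t: "t \<in> tableaux l" using tableaux_nonempty by blast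
  have "tableaux l \<subseteq> (\<lambda>p. p \<circ> t) ` {p. p permutes V}"
    using tableau_permutes[OF _ t] by blast
  then show ?thesis by (rule finite_subset) (simp add: finite_permutations)
qed

lemma exists_tableau:
  assumes cs: "distinct cs" "set cs \<subseteq> arm \<union> leg" and vs: "distinct vs" "set vs \<subseteq> V"
    and len: "length cs = length vs"
  obtains t where "t \<in> tableaux l" "map t cs = vs"
proof -
  obtain t where t: "t \<in> tableaux l" using tableaux_nonempty by blast
  have "distinct (map t cs)"
    using cs tableauxD(1)[OF t] by (auto simp: distinct_map bij_betw_def intro: inj_on_subset)
  moreover have "set (map t cs) \<subseteq> V" using cs tableau_in_V[OF t] by auto
  ultimately obtain p where p: "p permutes V" "map p (map t cs) = vs"
    using exists_permutes_map[of "map t cs" vs V] vs len by auto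
  then show ?thesis using tableau_compose[OF t p(1)] by (intro that[of "p \<circ> t"]) simp_all
qed

text \<open>Every row below the first has one cell, so row equivalence fixes the leg; the first row
  then holds the same complement.\<close>

lemma tabloid_iff:
  assumes t: "t \<in> tableaux l"
  shows "s \<in> tabloid l t \<longleftrightarrow> s \<in> tableaux l \<and> (\<forall>i. 1 \<le> i \<longrightarrow> i \<le> k \<longrightarrow> s (i, 0) = t (i, 0))"
proof
  assume s: "s \<in> tabloid l t"
  have "s (i, 0) = t (i, 0)" if "1 \<le> i" "i \<le> k" for i
  proof -
    have "s ` row l i = t ` row l i" using s by (simp add: tabloid_def)
    then show ?thesis using that by (simp add: row_eq)
  qed
  then show "s \<in> tableaux l \<and> (\<forall>i. 1 \<le> i \<longrightarrow> i \<le> k \<longrightarrow> s (i, 0) = t (i, 0))"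
    using s by (simp add: tabloid_def)
next
  assume s: "s \<in> tableaux l \<and> (\<forall>i. 1 \<le> i \<longrightarrow> i \<le> k \<longrightarrow> s (i, 0) = t (i, 0))"
  have arm: "u ` arm = V - u ` leg" if "u \<in> tableaux l" for u
  proof -
    have "u ` (arm \<union> leg - leg) = u ` (arm \<union> leg) - u ` leg"
      using tableauxD(1)[OF that] by (intro inj_on_image_set_diff[of u "arm \<union> leg"]) (auto simp: bij_betw_def)
    moreover have "arm \<union> leg - leg = arm" using arm_leg(1) by blast
    ultimately show ?thesis using tableauxD(1)[OF that] by (simp add: bij_betw_def)
  qed
  have "s ` leg = t ` leg" using s by (intro image_cong) (auto simp: leg_def)
  then have "s ` arm = t ` arm" using arm s t by simp
  then have "s ` row l i = t ` row l i" for i using s by (simp add: row_eq)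
  then show "s \<in> tabloid l t" using s by (simp add: tabloid_def)
qed

lemma column_stabilizer_eq:
  "column_stabilizer l t = {\<sigma>. \<sigma> permutes V \<and> (\<forall>j. \<sigma> ` (t ` column l j) = t ` column l j)}"
  unfolding column_stabilizer_def sym_group_carrier V_eq by blast

text \<open>Every column but the first has one cell, whose entry must be fixed; the first column is
  then preserved as the complement.\<close>

lemma column_stabilizer_iff:
  assumes t: "t \<in> tableaux l"
  shows "\<sigma> \<in> column_stabilizer l t \<longleftrightarrow>
    \<sigma> permutes V \<and> (\<forall>j. 1 \<le> j \<longrightarrow> j < n - k \<longrightarrow> \<sigma> (t (0, j)) = t (0, j))"
proof
  assume s: "\<sigma> \<in> column_stabilizer l t"
  have "\<sigma> (t (0, j)) = t (0, j)" if "1 \<le> j" "j < n - k" for j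
  proof -
    have "\<sigma> ` t ` column l j = t ` column l j" using s by (simp add: column_stabilizer_eq)
    then show ?thesis using that by (simp add: column_eq)
  qed
  then show "\<sigma> permutes V \<and> (\<forall>j. 1 \<le> j \<longrightarrow> j < n - k \<longrightarrow> \<sigma> (t (0, j)) = t (0, j))"
    using s by (simp add: column_stabilizer_eq)
next
  assume s: "\<sigma> permutes V \<and> (\<forall>j. 1 \<le> j \<longrightarrow> j < n - k \<longrightarrow> \<sigma> (t (0, j)) = t (0, j))"
  let ?A = "{0} \<times> {1..<n - k}"
  have A: "?A \<subseteq> arm \<union> leg" "arm \<union> leg - ?A = insert (0, 0) leg"
    using k by (auto simp: arm_def leg_def)
  have col: "t ` insert (0, 0) leg = V - t ` ?A"
  proof -
    have "t ` (arm \<union> leg - ?A) = t ` (arm \<union> leg) - t ` ?A"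
      using tableauxD(1)[OF t] A(1) by (intro inj_on_image_set_diff[of t "arm \<union> leg"]) (auto simp: bij_betw_def)
    then show ?thesis using tableauxD(1)[OF t] A(2) by (simp add: bij_betw_def)
  qed
  have fixA: "\<sigma> ` t ` ?A = t ` ?A"
  proof -
    have "\<sigma> v = v" if "v \<in> t ` ?A" for v using that s by auto
    then show ?thesis by simp
  qed
  have "\<sigma> ` (V - t ` ?A) = \<sigma> ` V - \<sigma> ` t ` ?A"
    using s by (intro image_set_diff permutes_inj) blast
  then have "\<sigma> ` t ` insert (0, 0) leg = t ` insert (0, 0) leg"
    unfolding col fixA using s by (simp add: permutes_image)
  moreover have "\<sigma> ` t ` column l j = t ` column l j" if "j \<noteq> 0" for j
    using that s by (auto simp: column_eq)
  ultimately have "\<sigma> ` t ` column l j = t ` column l j" for j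
    by (cases "j = 0") (simp_all only: column_eq if_True if_False simp_thms)
  then show "\<sigma> \<in> column_stabilizer l t"
    using s by (simp add: column_stabilizer_eq)
qed

lemma permutes_fix_iff:
  assumes "p permutes V" "T \<subseteq> V"
  shows "p permutes T \<longleftrightarrow> (\<forall>v\<in>V - T. p v = v)"
proof
  show "p permutes T \<Longrightarrow> \<forall>v\<in>V - T. p v = v" by (auto simp: permutes_def)
  show "p permutes T" if "\<forall>v\<in>V - T. p v = v"
    by (rule permutes_superset[OF assms(1)]) (use that in blast)
qed

lemma act_specht:
  assumes "p permutes V"
  shows "act (specht_Z l) p f = (\<lambda>T. f ((\<lambda>t. inv_into UNIV p \<circ> t) ` T))"
  using assms unfolding specht_Z_simps(4) by (intro act_permutation_lattice) (simp only: V_eq)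

lemma tabloid_act:
  assumes "p permutes V"
  shows "(\<lambda>s. p \<circ> s) ` tabloid l t = tabloid l (p \<circ> t)"
  using tabloid_compose[of p l t] assms by (simp only: V_eq)

lemma specht_module: "group_ring_module (sym_group n) \<Z> (specht_Z l)"
  using specht_Z_group_ring_module[of l] by (simp add: sum_l)

lemma diagram_cells:
  "(0, 0) \<in> arm \<union> leg" "1 \<le> i \<Longrightarrow> i \<le> k \<Longrightarrow> (i, 0) \<in> arm \<union> leg" "j < n - k \<Longrightarrow> (0, j) \<in> arm \<union> leg"
  using k by (auto simp: arm_def leg_def)

lemma V_cells: "t \<in> tableaux l \<Longrightarrow> v \<in> V \<Longrightarrow> \<exists>c\<in>arm \<union> leg. v = t c"
  using tableauxD(1) unfolding bij_betw_def by blast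

text \<open>For a full span it suffices that the image contains a multiple of every triangle.
  \<open>N\<close> is 1 for leg length 2, and \<open>n\<close> for arm length 2, where the images of
  the polytabloids are fans up to sign.\<close>

lemma hook_lattice:
  assumes add: "\<And>f g. \<Theta> (\<lambda>T. f T + g T) = \<Theta> f + \<Theta> g"
    and smult: "\<And>a f. \<Theta> (\<lambda>T. a * f T) = scale (of_int a) (\<Theta> f)"
    and inj: "inj_on \<Theta> (carrier (specht_Z l))"
    and act: "\<And>p f. p permutes V \<Longrightarrow> f \<in> carrier (specht_Z l) \<Longrightarrow>
      \<Theta> (\<lambda>T. f ((\<lambda>t. inv_into UNIV p \<circ> t) ` T)) = twisted \<chi> p (\<Theta> f)"
    and W: "\<And>f. f \<in> carrier (specht_Z l) \<Longrightarrow> \<Theta> f \<in> W"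
    and N: "(N::nat) > 0"
    and tri: "\<And>K a b c. zsubmodule K \<Longrightarrow> (\<And>t. t \<in> tableaux l \<Longrightarrow> \<Theta> (polytabloid l t) \<in> K) \<Longrightarrow>
      distinct [a, b, c] \<Longrightarrow> {a, b, c} \<subseteq> V \<Longrightarrow> scale (of_nat N) (tri a b c) \<in> K"
  shows "\<exists>L. group_ring_isomorphic (sym_group n) \<Z> (specht_Z l) (int_vectors (twisted \<chi>) L) \<and> rational_span L = W"
proof (intro exI conjI)
  let ?L = "\<Theta> ` carrier (specht_Z l)"
  have emb: "int_embedding (specht_Z l) \<Theta>"
    unfolding int_embedding_def specht_Z_simps(2,3) using inj add smult by blast
  have actp: "act (specht_Z l) p f = (\<lambda>T. f ((\<lambda>t. inv_into UNIV p \<circ> t) ` T))"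
    if "p \<in> carrier (sym_group n)" for p f
    using that by (intro act_specht) (simp add: sym_group_carrier V_def)
  show "group_ring_isomorphic (sym_group n) \<Z> (specht_Z l) (int_vectors (twisted \<chi>) ?L)"
  proof (rule int_vectors_isoI[OF emb refl])
    fix p f assume p: "p \<in> carrier (sym_group n)" and f: "f \<in> carrier (specht_Z l)"
    have "p permutes V" using p by (simp add: sym_group_carrier V_def)
    then show "\<Theta> (act (specht_Z l) p f) = twisted \<chi> p (\<Theta> f)"
      unfolding actp[OF p] using f by (rule act)
  qed
  have "Module.module \<Z> (specht_Z l)" using specht_module by (simp add: group_ring_module_def)
  from int_embedding_image_zsubmodule[OF this emb] have L: "zsubmodule ?L" .
  let ?K = "{z. scale (of_nat N) z \<in> ?L}"
  have "zsubmodule ?K"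
    using zsubmodule_0[OF L] zsubmodule_diff[OF L] by (simp add: zsubmodule_def scale_distrib del: scale_apply)
  then have "L0 \<subseteq> ?K"
  proof (rule L0_generated)
    fix a b c :: nat assume abc: "distinct [a, b, c]" "{a, b, c} \<subseteq> V"
    have "scale (of_nat N) (tri a b c) \<in> ?L"
      by (rule tri[OF L _ abc]) (rule imageI[OF polytabloid_in_specht[OF _ finite_tableaux]])
    then show "tri a b c \<in> ?K" by simp
  qed
  then show "rational_span ?L = W"
    using W N by (intro rational_span_W[of ?L N]) auto
qed

subsection \<open>The partition with leg length two\<close>

text \<open>
  Here a tabloid is an ordered pair, namely the entries below the corner, and a polytabloid is the
  triangle on the first column.
\<close>

lemma specht_leg_two:
  assumes k2: "k = 2"
  shows "\<exists>L. group_ring_isomorphic (sym_group n) \<Z> (specht_Z l) (int_vectors (twisted (\<lambda>_. 1)) L) \<and> rational_span L = W"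
proof -
  define Tab where "Tab a b = {s \<in> tableaux l. s (1, 0) = a \<and> s (2, 0) = b}" for a b
  have cells: "(0, 0) \<in> arm \<union> leg" "(1, 0) \<in> arm \<union> leg" "(2, 0) \<in> arm \<union> leg"
    using diagram_cells(1) diagram_cells(2)[of 1] diagram_cells(2)[of 2] k2 by auto
  have tab: "tabloid l t = Tab (t (1, 0)) (t (2, 0))" if t: "t \<in> tableaux l" for t
  proof -
    have "(\<forall>i. 1 \<le> i \<longrightarrow> i \<le> k \<longrightarrow> s (i, 0) = t (i, 0)) \<longleftrightarrow> s (1, 0) = t (1, 0) \<and> s (2, 0) = t (2, 0)"
      for s :: "nat \<times> nat \<Rightarrow> nat"
    proof -
      have "(\<forall>i. 1 \<le> i \<longrightarrow> i \<le> k \<longrightarrow> s (i, 0) = t (i, 0)) \<longleftrightarrow> (\<forall>i\<in>{1..k}. s (i, 0) = t (i, 0))"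
        by auto
      moreover have "{1..k} = {1, 2}" using k2 by auto
      ultimately show ?thesis by simp
    qed
    then show ?thesis using tabloid_iff[OF t] by (auto simp: Tab_def)
  qed
  have Tab_eq: "Tab a b = Tab (t (1, 0)) (t (2, 0)) \<longleftrightarrow> t (1, 0) = a \<and> t (2, 0) = b" if t: "t \<in> tableaux l" for a b t
  proof
    assume "Tab a b = Tab (t (1, 0)) (t (2, 0))"
    moreover have "t \<in> Tab (t (1, 0)) (t (2, 0))" using t by (simp add: Tab_def)
    ultimately have "t \<in> Tab a b" by simp
    then show "t (1, 0) = a \<and> t (2, 0) = b" by (simp add: Tab_def)
  qed auto
  have Tab_act: "(\<lambda>t. inv_into UNIV p \<circ> t) ` Tab a b = Tab (inv_into UNIV p a) (inv_into UNIV p b)"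
    if p: "p permutes V" for p a b
  proof (intro equalityI subsetI)
    fix s assume "s \<in> (\<lambda>t. inv_into UNIV p \<circ> t) ` Tab a b"
    then obtain t where "s = inv_into UNIV p \<circ> t" "t \<in> tableaux l" "t (1, 0) = a" "t (2, 0) = b"
      by (auto simp: Tab_def)
    then show "s \<in> Tab (inv_into UNIV p a) (inv_into UNIV p b)"
      using tableau_compose[OF _ permutes_inv[OF p]] by (simp add: Tab_def)
  next
    fix s assume s: "s \<in> Tab (inv_into UNIV p a) (inv_into UNIV p b)"
    then have "p \<circ> s \<in> Tab a b"
      using tableau_compose[OF _ p] permutes_inverses(1)[OF p] by (simp add: Tab_def)
    moreover have "s = inv_into UNIV p \<circ> (p \<circ> s)" by (simp only: inv_compose_cancel[OF p])
    ultimately show "s \<in> (\<lambda>t. inv_into UNIV p \<circ> t) ` Tab a b"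
      by (intro image_eqI[where x = "p \<circ> s"])
  qed
  define \<Theta> :: "((nat \<times> nat \<Rightarrow> nat) set \<Rightarrow> int) \<Rightarrow> nat \<times> nat \<Rightarrow> rat"
    where "\<Theta> f = (\<lambda>(a, b). of_int (f (Tab a b)))" for f
  have poly: "\<Theta> (polytabloid l t) = tri (t (0, 0)) (t (1, 0)) (t (2, 0))" if t: "t \<in> tableaux l" for t
  proof (rule ext, clarify)
    fix a b
    let ?T = "{t (0, 0), t (1, 0), t (2, 0)}"
    have TV: "?T \<subseteq> V" using tableau_in_V[OF t] cells by auto
    have compl: "v \<in> V - ?T \<longleftrightarrow> (\<exists>j. 1 \<le> j \<and> j < n - k \<and> v = t (0, j))" for v
    proof
      assume v: "v \<in> V - ?T"
      then obtain c where c: "c \<in> arm \<union> leg" "v = t c" using V_cells[OF t] by blast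
      then have "c \<noteq> (0, 0)" "c \<noteq> (1, 0)" "c \<noteq> (2, 0)" using v by auto
      moreover have "{1..k} = {1, 2}" using k2 by auto
      ultimately have "\<exists>j. 1 \<le> j \<and> j < n - k \<and> c = (0, j)"
        using c(1) unfolding arm_def leg_def by force
      then show "\<exists>j. 1 \<le> j \<and> j < n - k \<and> v = t (0, j)" using c(2) by blast
    next
      assume "\<exists>j. 1 \<le> j \<and> j < n - k \<and> v = t (0, j)"
      then obtain j where j: "1 \<le> j" "j < n - k" "v = t (0, j)" by blast
      then show "v \<in> V - ?T"
        using tableau_in_V[OF t diagram_cells(3)[OF j(2)]] tableau_inj[OF t diagram_cells(3)[OF j(2)]] cells by auto
    qed
    have C: "column_stabilizer l t = {\<sigma>. \<sigma> permutes ?T}"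
    proof -
      have "\<sigma> \<in> column_stabilizer l t \<longleftrightarrow> \<sigma> permutes V \<and> (\<forall>v\<in>V - ?T. \<sigma> v = v)" for \<sigma>
        unfolding column_stabilizer_iff[OF t] Ball_def compl by blast
      then have "\<sigma> \<in> column_stabilizer l t \<longleftrightarrow> \<sigma> permutes V \<and> \<sigma> permutes ?T" for \<sigma>
        using permutes_fix_iff[OF _ TV, of \<sigma>] by blast
      moreover have "\<sigma> permutes V" if "\<sigma> permutes ?T" for \<sigma>
        using that TV by (rule permutes_subset)
      ultimately show ?thesis by blast
    qed
    have "of_int (polytabloid l t (Tab a b))
        = (\<Sum>\<sigma>\<in>column_stabilizer l t. of_int (sign \<sigma>) * of_bool (\<sigma> (t (1, 0)) = a \<and> \<sigma> (t (2, 0)) = b) :: rat)"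
      unfolding polytabloid_def of_int_sum
    proof (intro sum.cong refl)
      fix \<sigma> assume "\<sigma> \<in> column_stabilizer l t"
      then have s: "\<sigma> \<circ> t \<in> tableaux l" using tableau_compose[OF t] by (simp add: column_stabilizer_iff[OF t])
      show "of_int (sign \<sigma> * (if Tab a b = tabloid l (\<sigma> \<circ> t) then 1 else 0))
          = (of_int (sign \<sigma>) * of_bool (\<sigma> (t (1, 0)) = a \<and> \<sigma> (t (2, 0)) = b) :: rat)"
        unfolding tab[OF s] Tab_eq[OF s] by simp
    qed
    also have "\<dots> = tri (t (0, 0)) (t (1, 0)) (t (2, 0)) (a, b)"
      unfolding C by (rule sum_permutes3) (use tableau_inj[OF t] cells in simp)
    finally show "\<Theta> (polytabloid l t) (a, b) = tri (t (0, 0)) (t (1, 0)) (t (2, 0)) (a, b)"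
      by (simp add: \<Theta>_def)
  qed
  show ?thesis
  proof (rule hook_lattice[of \<Theta> _ 1])
    show "\<Theta> (\<lambda>T. f T + g T) = \<Theta> f + \<Theta> g" for f g by (auto simp: \<Theta>_def fun_eq_iff)
    show "\<Theta> (\<lambda>T. a * f T) = scale (of_int a) (\<Theta> f)" for a f by (auto simp: \<Theta>_def fun_eq_iff)
    show "inj_on \<Theta> (carrier (specht_Z l))"
    proof (rule inj_onI)
      fix f g assume fg: "f \<in> carrier (specht_Z l)" "g \<in> carrier (specht_Z l)" "\<Theta> f = \<Theta> g"
      show "f = g"
      proof
        fix T
        show "f T = g T"
        proof (cases "T \<in> tabloids l")
          case True
          then obtain t where t: "t \<in> tableaux l" "T = tabloid l t" by (auto simp: tabloids_def)
          then show ?thesis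
            using fun_cong[OF fg(3), of "(t (1, 0), t (2, 0))"] tab by (simp add: \<Theta>_def)
        qed (use fg(1,2) in \<open>simp add: specht_off_tabloids\<close>)
      qed
    qed
    show "\<Theta> (\<lambda>T. f ((\<lambda>t. inv_into UNIV p \<circ> t) ` T)) = twisted (\<lambda>_. 1) p (\<Theta> f)" if p: "p permutes V" for p f
      by (rule ext, clarify) (simp add: \<Theta>_def twisted_def Tab_act[OF p])
    show "\<Theta> f \<in> W" if f: "f \<in> carrier (specht_Z l)" for f
    proof -
      obtain c where c: "f = (\<lambda>T. \<Sum>t\<in>tableaux l. c t * polytabloid l t T)"
        using f by (rule specht_Z_E)
      have "\<Theta> f = (\<Sum>t\<in>tableaux l. scale (of_int (c t)) (\<Theta> (polytabloid l t)))"
        by (rule ext, clarify) (simp add: \<Theta>_def c sum_fun_apply)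
      also have "\<dots> \<in> W"
        using tableau_in_V cells by (intro zsubmodule_sum W_zsubmodule W_scale) (simp add: poly tri_in_W)
      finally show ?thesis .
    qed
    fix K a b c
    assume K: "zsubmodule K" "\<And>t. t \<in> tableaux l \<Longrightarrow> \<Theta> (polytabloid l t) \<in> K"
      and abc: "distinct [a, b, c]" "{a, b, c} \<subseteq> V"
    obtain t where "t \<in> tableaux l" "map t [(0, 0), (1, 0), (2, 0)] = [a, b, c]"
      by (rule exists_tableau[of "[(0, 0), (1, 0), (2, 0)]" "[a, b, c]"]) (use abc cells in auto)
    then show "scale (of_nat 1) (tri a b c) \<in> K" using K(2)[of t] poly[of t] by simp
  qed simp
qed

subsection \<open>The partition with arm length two\<close>

text \<open>
  Here the coefficient at a tabloid, multiplied by the sign of the tableau, depends only on the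
  first row, where it is a triangle sum of an antisymmetric matrix \<open>D\<close>.  The embedding sends it to
  \<open>n\<close> times the projection of \<open>D\<close> to the flows.
\<close>

lemma specht_arm_two:
  assumes k3: "k = n - 3"
  shows "\<exists>L. group_ring_isomorphic (sym_group n) \<Z> (specht_Z l) (int_vectors (twisted sign) L) \<and> rational_span L = W"
proof -
  have nk: "n - k = 3" using k3 n_ge by simp
  have cells: "(0, 0) \<in> arm \<union> leg" "(0, 1) \<in> arm \<union> leg" "(0, 2) \<in> arm \<union> leg"
    using diagram_cells(3)[of 0] diagram_cells(3)[of 1] diagram_cells(3)[of 2] nk by auto
  have perm: "permutation p" if "p permutes V" for p using that permutation_permutes finite_V by blast
  have sign2: "sign p * sign p = (1::int)" for p :: "nat \<Rightarrow> nat" by (rule sign_idempotent)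
  obtain t0 where t0: "t0 \<in> tableaux l" using tableaux_nonempty by blast
  \<comment> \<open>the sign of a tableau relative to the reference tableau \<open>t0\<close>\<close>
  define eps where "eps s = sign (SOME w. w permutes V \<and> s = w \<circ> t0)" for s
  have eps: "eps (p \<circ> s) = sign p * eps s" if s: "s \<in> tableaux l" and p: "p permutes V" for p s
  proof -
    have ex: "eps u = sign w" if "w permutes V" "u = w \<circ> t0" for u w
    proof -
      have "(SOME w. w permutes V \<and> u = w \<circ> t0) permutes V \<and> u = (SOME w. w permutes V \<and> u = w \<circ> t0) \<circ> t0"
        by (rule someI[of _ w]) (use that in blast)
      then have "(SOME w. w permutes V \<and> u = w \<circ> t0) = w"
        using that by (intro compose_tableau_eq[OF t0]) auto
      then show ?thesis by (simp add: eps_def)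
    qed
    obtain w where w: "w permutes V" "s = w \<circ> t0" by (rule tableau_permutes[OF s t0])
    have "eps (p \<circ> s) = sign (p \<circ> w)"
      using w p by (intro ex permutes_compose) (simp_all add: comp_assoc)
    then show ?thesis using ex[OF w] perm w(1) p by (simp add: sign_compose)
  qed
  have eps2: "eps s * eps s = (1::int)" for s by (simp add: eps_def sign2)
  have row: "v \<in> V - {s (0, 0), s (0, 1), s (0, 2)} \<longleftrightarrow> (\<exists>i. 1 \<le> i \<and> i \<le> k \<and> v = s (i, 0))"
    if s: "s \<in> tableaux l" for s v
  proof
    assume v: "v \<in> V - {s (0, 0), s (0, 1), s (0, 2)}"
    then obtain c where c: "c \<in> arm \<union> leg" "v = s c" using V_cells[OF s] by blast
    then have "c \<noteq> (0, 0)" "c \<noteq> (0, 1)" "c \<noteq> (0, 2)" using v by auto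
    moreover have "{..<n - k} = {0, 1, 2}" using nk by auto
    ultimately have "\<exists>i. 1 \<le> i \<and> i \<le> k \<and> c = (i, 0)"
      using c(1) unfolding arm_def leg_def by force
    then show "\<exists>i. 1 \<le> i \<and> i \<le> k \<and> v = s (i, 0)" using c(2) by blast
  next
    assume "\<exists>i. 1 \<le> i \<and> i \<le> k \<and> v = s (i, 0)"
    then obtain i where i: "1 \<le> i" "i \<le> k" "v = s (i, 0)" by blast
    then show "v \<in> V - {s (0, 0), s (0, 1), s (0, 2)}"
      using tableau_in_V[OF s diagram_cells(2)[OF i(1,2)]] tableau_inj[OF s diagram_cells(2)[OF i(1,2)]] cells by auto
  qed
  have TV: "{s (0, 0), s (0, 1), s (0, 2)} \<subseteq> V" if "s \<in> tableaux l" for s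
    using tableau_in_V[OF that] cells by auto
  have dist: "distinct [s (0, 0), s (0, 1), s (0, 2)]" if "s \<in> tableaux l" for s
    using tableau_inj[OF that] cells by simp
  have C: "\<sigma> \<in> column_stabilizer l t \<longleftrightarrow> \<sigma> permutes V \<and> \<sigma> (t (0, 1)) = t (0, 1) \<and> \<sigma> (t (0, 2)) = t (0, 2)"
    if t: "t \<in> tableaux l" for t \<sigma>
  proof -
    have "(\<forall>j. 1 \<le> j \<longrightarrow> j < n - k \<longrightarrow> \<sigma> (t (0, j)) = t (0, j))
        \<longleftrightarrow> (\<forall>j\<in>{1..<n - k}. \<sigma> (t (0, j)) = t (0, j))"
      by auto
    moreover have "{1..<n - k} = {1, 2}" using nk by auto
    ultimately show ?thesis unfolding column_stabilizer_iff[OF t] by simp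
  qed
  \<comment> \<open>With \<open>t = w \<circ> s\<close> and the substitution
    \<open>\<tau> = \<sigma> \<circ> w\<close>, row equivalence of \<open>\<sigma> \<circ> t\<close>
    and \<open>s\<close> says that \<open>\<tau>\<close> permutes the first row of \<open>s\<close>,
    and the column condition prescribes two values of \<open>\<tau>\<close>. The factor
    \<open>sign w\<close> of the substitution turns \<open>eps s\<close> into
    \<open>eps t\<close>.\<close>
  have poly: "eps s * polytabloid l t (tabloid l s)
      = eps t * (\<Sum>\<tau>\<in>{\<tau>. \<tau> permutes {s (0, 0), s (0, 1), s (0, 2)}}.
          sign \<tau> * of_bool (\<tau> (s (0, 1)) = t (0, 1) \<and> \<tau> (s (0, 2)) = t (0, 2)))"
    if s: "s \<in> tableaux l" and t: "t \<in> tableaux l" for s t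
  proof -
    let ?T = "{s (0, 0), s (0, 1), s (0, 2)}"
    let ?A = "{\<sigma> \<in> column_stabilizer l t. \<sigma> \<circ> t \<in> tabloid l s}"
    let ?B = "{\<tau>. \<tau> permutes ?T \<and> \<tau> (s (0, 1)) = t (0, 1) \<and> \<tau> (s (0, 2)) = t (0, 2)}"
    obtain w where w: "w permutes V" "t = w \<circ> s" by (rule tableau_permutes[OF t s])
    have AB: "\<sigma> \<in> ?A \<longleftrightarrow> \<sigma> \<circ> w \<in> ?B" if \<sigma>: "\<sigma> permutes V" for \<sigma>
    proof -
      have \<sigma>w: "\<sigma> \<circ> w permutes V" by (intro permutes_compose w \<sigma>)
      have "\<sigma> \<circ> t \<in> tabloid l s \<longleftrightarrow> (\<forall>v\<in>V - ?T. (\<sigma> \<circ> w) v = v)"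
        unfolding tabloid_iff[OF s] row[OF s] Ball_def using tableau_compose[OF t \<sigma>] w(2) by auto
      then have "\<sigma> \<circ> t \<in> tabloid l s \<longleftrightarrow> \<sigma> \<circ> w permutes ?T"
        unfolding permutes_fix_iff[OF \<sigma>w TV[OF s]] .
      then have "\<sigma> \<in> ?A \<longleftrightarrow> \<sigma> \<in> column_stabilizer l t \<and> \<sigma> \<circ> w permutes ?T" by blast
      moreover have t12: "t (0, 1) = w (s (0, 1))" "t (0, 2) = w (s (0, 2))" by (simp_all add: w(2))
      ultimately show ?thesis using \<sigma> unfolding C[OF t] t12 mem_Collect_eq o_apply by blast
    qed
    have "bij_betw (\<lambda>\<sigma>. \<sigma> \<circ> w) ?A ?B"
    proof (rule bij_betw_byWitness[of _ "\<lambda>\<tau>. \<tau> \<circ> inv_into UNIV w"])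
      have cancel: "\<tau> \<circ> inv_into UNIV w \<circ> w = \<tau>" "\<tau> \<circ> w \<circ> inv_into UNIV w = \<tau>" for \<tau> :: "nat \<Rightarrow> nat"
        using permutes_inverses[OF w(1)] by (auto simp: fun_eq_iff)
      show "\<forall>a\<in>?A. a \<circ> w \<circ> inv_into UNIV w = a" "\<forall>a'\<in>?B. a' \<circ> inv_into UNIV w \<circ> w = a'"
        using cancel by blast+
      have "\<sigma> \<circ> w \<in> ?B" if "\<sigma> \<in> ?A" for \<sigma>
        using that AB[of \<sigma>] C[OF t] by blast
      then show "(\<lambda>\<sigma>. \<sigma> \<circ> w) ` ?A \<subseteq> ?B" by blast
      have "\<tau> \<circ> inv_into UNIV w \<in> ?A" if \<tau>: "\<tau> \<in> ?B" for \<tau>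
      proof -
        have "\<tau> permutes V" using \<tau> permutes_subset[OF _ TV[OF s]] by blast
        then have "\<tau> \<circ> inv_into UNIV w permutes V" by (intro permutes_compose permutes_inv w)
        then show ?thesis using AB[of "\<tau> \<circ> inv_into UNIV w"] \<tau> cancel(1)[of \<tau>] by simp
      qed
      then show "(\<lambda>\<tau>. \<tau> \<circ> inv_into UNIV w) ` ?B \<subseteq> ?A" by blast
    qed
    note bij = this
    have fC: "finite (column_stabilizer l t)"
      using finite_subset[of "column_stabilizer l t" "{p. p permutes V}"] C[OF t] by (auto simp: finite_permutations)
    have "polytabloid l t (tabloid l s) = (\<Sum>\<sigma>\<in>column_stabilizer l t. if \<sigma> \<circ> t \<in> tabloid l s then sign \<sigma> else 0)"
      unfolding polytabloid_def
    proof (intro sum.cong refl)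
      fix \<sigma> assume "\<sigma> \<in> column_stabilizer l t"
      then have "\<sigma> \<circ> t \<in> tableaux l" using tableau_compose[OF t] C[OF t] by blast
      then have "tabloid l s = tabloid l (\<sigma> \<circ> t) \<longleftrightarrow> \<sigma> \<circ> t \<in> tabloid l s"
        using tabloid_eq_iff[of "\<sigma> \<circ> t" l s] by auto
      then show "sign \<sigma> * (if tabloid l s = tabloid l (\<sigma> \<circ> t) then 1 else 0)
          = (if \<sigma> \<circ> t \<in> tabloid l s then sign \<sigma> else 0)" by simp
    qed
    also have "\<dots> = (\<Sum>\<sigma>\<in>?A. sign \<sigma>)"
      using fC by (simp add: sum.inter_filter)
    also have "\<dots> = (\<Sum>\<sigma>\<in>?A. sign w * sign (\<sigma> \<circ> w))"
    proof (intro sum.cong refl)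
      fix \<sigma> assume "\<sigma> \<in> ?A"
      then have "\<sigma> permutes V" using C[OF t] by blast
      then have "sign w * sign (\<sigma> \<circ> w) = (sign w * sign w) * sign \<sigma>"
        using perm w(1) by (simp add: sign_compose mult_ac)
      then show "sign \<sigma> = sign w * sign (\<sigma> \<circ> w)" by (simp only: sign2 mult_1_left)
    qed
    also have "\<dots> = (\<Sum>\<tau>\<in>?B. sign w * sign \<tau>)" by (rule sum.reindex_bij_betw[OF bij])
    also have "\<dots> = sign w * (\<Sum>\<tau>\<in>{\<tau>. \<tau> permutes ?T}.
        sign \<tau> * of_bool (\<tau> (s (0, 1)) = t (0, 1) \<and> \<tau> (s (0, 2)) = t (0, 2)))"
    proof -
      have "?B = {\<tau> \<in> {\<tau>. \<tau> permutes ?T}. \<tau> (s (0, 1)) = t (0, 1) \<and> \<tau> (s (0, 2)) = t (0, 2)}" by blast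
      then show ?thesis
        by (simp only: sum_distrib_left[symmetric] sum.inter_filter[OF finite_permutations[of ?T]] finite.intros)
          (intro arg_cong2[where f = times] sum.cong refl, simp)
    qed
    finally have "eps s * polytabloid l t (tabloid l s) = (eps s * sign w) * (\<Sum>\<tau>\<in>{\<tau>. \<tau> permutes ?T}.
        sign \<tau> * of_bool (\<tau> (s (0, 1)) = t (0, 1) \<and> \<tau> (s (0, 2)) = t (0, 2)))"
      by simp
    also have "eps s * sign w = eps t" using eps[OF s w(1)] w(2) by simp
    finally show ?thesis .
  qed
  have poly': "of_int (eps s * polytabloid l t (tabloid l s))
      = of_int (eps t) * tri_sum (arc (t (0, 1)) (t (0, 2))) (s (0, 0)) (s (0, 1)) (s (0, 2))"
    if s: "s \<in> tableaux l" and t: "t \<in> tableaux l" for s t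
    unfolding poly[OF s t] tri_eq_tri_sum[symmetric] sum_permutes3[OF dist[OF s], symmetric] by simp
  have arc: "arc x y (b, a) = - arc x y (a, b)" for x y a b :: nat
    by (simp add: arc_def conj_commute)
  \<comment> \<open>\<open>D\<close> is determined only up to matrices without triangle sums.
    Therefore \<open>\<Theta>\<close> below is defined from the coefficients of \<open>f\<close>,
    and \<open>D\<close> is a tool to compute with it.\<close>
  let ?D = "\<lambda>D f. (\<forall>a b. D (b, a) = - D (a, b)) \<and> (\<forall>s\<in>tableaux l.
      of_int (eps s * f (tabloid l s)) = tri_sum D (s (0, 0)) (s (0, 1)) (s (0, 2)))"
  have D: "\<exists>D. ?D D f" if f: "f \<in> carrier (specht_Z l)" for f
  proof -
    obtain c where c: "f = (\<lambda>T. \<Sum>t\<in>tableaux l. c t * polytabloid l t T)"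
      using f by (rule specht_Z_E)
    let ?E = "\<Sum>t\<in>tableaux l. scale (of_int (c t * eps t)) (arc (t (0, 1)) (t (0, 2)))"
    have "?E (b, a) = - ?E (a, b)" for a b
      unfolding sum_fun_apply sum_negf[symmetric] by (intro sum.cong refl) (simp add: arc[of _ _ b a])
    moreover have "of_int (eps s * f (tabloid l s)) = tri_sum ?E (s (0, 0)) (s (0, 1)) (s (0, 2))"
      if s: "s \<in> tableaux l" for s
    proof -
      have "of_int (eps s * f (tabloid l s))
          = (\<Sum>t\<in>tableaux l. of_int (c t) * (of_int (eps s * polytabloid l t (tabloid l s)) :: rat))"
        by (simp add: c sum_distrib_left mult_ac)
      also have "\<dots> = (\<Sum>t\<in>tableaux l. of_int (c t) * (of_int (eps t)
          * tri_sum (arc (t (0, 1)) (t (0, 2))) (s (0, 0)) (s (0, 1)) (s (0, 2))))"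
        by (intro sum.cong refl) (simp only: poly'[OF s])
      also have "\<dots> = tri_sum ?E (s (0, 0)) (s (0, 1)) (s (0, 2))"
        by (simp add: tri_sum_def sum_fun_apply sum.distrib distrib_left mult.assoc)
      finally show ?thesis .
    qed
    ultimately show ?thesis by blast
  qed
  \<comment> \<open>The corner receives \<open>c\<close>, so that the first row is \<open>c\<close>,
    \<open>a\<close>, \<open>b\<close>, a rotation of the triangle \<open>a\<close>,
    \<open>b\<close>, \<open>c\<close>.\<close>
  define tb where "tb a b c = (SOME s. s \<in> tableaux l \<and> s (0, 0) = c \<and> s (0, 1) = a \<and> s (0, 2) = b)" for a b c
  have tb: "tb a b c \<in> tableaux l" "tb a b c (0, 0) = c" "tb a b c (0, 1) = a" "tb a b c (0, 2) = b"
    if abc: "distinct [a, b, c]" "{a, b, c} \<subseteq> V" for a b c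
  proof -
    obtain s where s: "s \<in> tableaux l" "map s [(0, 0), (0, 1), (0, 2)] = [c, a, b]"
      by (rule exists_tableau[of "[(0, 0), (0, 1), (0, 2)]" "[c, a, b]"]) (use abc cells in auto)
    then have "s \<in> tableaux l \<and> s (0, 0) = c \<and> s (0, 1) = a \<and> s (0, 2) = b" by simp
    then have "tb a b c \<in> tableaux l \<and> tb a b c (0, 0) = c \<and> tb a b c (0, 1) = a \<and> tb a b c (0, 2) = b"
      unfolding tb_def
      by (rule someI[where P = "\<lambda>s. s \<in> tableaux l \<and> s (0, 0) = c \<and> s (0, 1) = a \<and> s (0, 2) = b"])
    then show "tb a b c \<in> tableaux l" "tb a b c (0, 0) = c" "tb a b c (0, 1) = a" "tb a b c (0, 2) = b"
      by blast+
  qed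
  define \<Theta> :: "((nat \<times> nat \<Rightarrow> nat) set \<Rightarrow> int) \<Rightarrow> nat \<times> nat \<Rightarrow> rat"
    where "\<Theta> f = (\<lambda>(a, b). if a \<in> V \<and> b \<in> V \<and> a \<noteq> b
      then \<Sum>c\<in>V - {a, b}. of_int (eps (tb a b c) * f (tabloid l (tb a b c))) else 0)" for f
  have \<Theta>_eq: "\<Theta> f (a, b) = (if a \<in> V \<and> b \<in> V then \<Sum>c\<in>V. tri_sum D a b c else 0)" if D: "?D D f" for D f a b
  proof -
    have anti: "D (y, x) = - D (x, y)" for x y using D by blast
    have diag: "D (x, x) = 0" for x using anti[of x x] by simp
    show ?thesis
    proof (cases "a \<in> V \<and> b \<in> V \<and> a \<noteq> b")
      case True
      have "\<Theta> f (a, b) = (\<Sum>c\<in>V - {a, b}. tri_sum D c a b)"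
        using True D tb by (simp add: \<Theta>_def)
      also have "\<dots> = (\<Sum>c\<in>V - {a, b}. tri_sum D a b c)"
        by (intro sum.cong refl) (simp add: tri_sum_def)
      also have "\<dots> = (\<Sum>c\<in>V. tri_sum D a b c)"
        using anti[of b a] by (intro sum.mono_neutral_left) (auto simp: tri_sum_def diag)
      finally show ?thesis using True by simp
    next
      case False
      have "tri_sum D a a c = 0" for c using anti[of a c] by (simp add: tri_sum_def diag)
      then show ?thesis using False by (auto simp: \<Theta>_def)
    qed
  qed
  have \<Theta>_sum: "\<Theta> f (a, b) = of_nat n * D (a, b) + (\<Sum>c\<in>V. D (b, c)) - (\<Sum>c\<in>V. D (a, c))"
    if D: "?D D f" and ab: "a \<in> V" "b \<in> V" for D f a b
  proof -
    have "D (c, a) = - D (a, c)" for c using D by blast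
    then show ?thesis using ab
      by (simp add: \<Theta>_eq[OF D] tri_sum_def sum.distrib sum_negf sum_subtractf)
  qed
  \<comment> \<open>The row sums of \<open>D\<close> enter \<open>\<Theta>_sum\<close> as
    differences of vertex potentials and cancel around a triangle. Hence \<open>\<Theta> f\<close>
    still determines \<open>f\<close>, which gives injectivity.\<close>
  have \<Theta>_tri: "tri_sum (\<Theta> f) p q r = of_nat n * tri_sum D p q r" if D: "?D D f" and "{p, q, r} \<subseteq> V" for D f p q r
    using that(2) by (simp add: tri_sum_def \<Theta>_sum[OF D] algebra_simps)
  have \<Theta>_poly: "\<Theta> (polytabloid l t) = scale (of_int (eps t)) (fan (t (0, 1)) (t (0, 2)))" if t: "t \<in> tableaux l" for t
  proof -
    let ?E = "scale (of_int (eps t)) (arc (t (0, 1)) (t (0, 2)))"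
    have xy: "t (0, 1) \<in> V" "t (0, 2) \<in> V" using TV[OF t] by auto
    have D: "?D ?E (polytabloid l t)"
    proof (intro conjI allI ballI)
      show "?E (b, a) = - ?E (a, b)" for a b
        by (simp add: arc[of _ _ b a])
      show "of_int (eps s * polytabloid l t (tabloid l s)) = tri_sum ?E (s (0, 0)) (s (0, 1)) (s (0, 2))"
        if "s \<in> tableaux l" for s
        unfolding poly'[OF that t] tri_sum_linear ..
    qed
    show ?thesis
    proof (rule ext, clarify)
      fix a b
      show "\<Theta> (polytabloid l t) (a, b) = scale (of_int (eps t)) (fan (t (0, 1)) (t (0, 2))) (a, b)"
      proof (cases "a \<in> V \<and> b \<in> V")
        case True
        have row: "(\<Sum>c\<in>V. ?E (x, c)) = of_int (eps t) * (of_bool (x = t (0, 1)) - of_bool (x = t (0, 2)))" for x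
          using arc_row[OF xy, of x] by (simp add: sum_distrib_left[symmetric])
        have "\<Theta> (polytabloid l t) (a, b) = of_nat n * ?E (a, b) + (\<Sum>c\<in>V. ?E (b, c)) - (\<Sum>c\<in>V. ?E (a, c))"
          using True by (intro \<Theta>_sum[OF D]) simp_all
        also have "\<dots> = scale (of_int (eps t)) (fan (t (0, 1)) (t (0, 2))) (a, b)"
          unfolding row unfolding scale_apply fan_apply[OF conjunct1[OF True] conjunct2[OF True]]
          by (simp add: algebra_simps)
        finally show ?thesis .
      next
        case False
        then show ?thesis
          using W_out[OF L0_W[OF fan_in_L0[OF xy]]] W_out'[OF L0_W[OF fan_in_L0[OF xy]]]
          by (auto simp: \<Theta>_def)
      qed
    qed
  qed
  show ?thesis
  proof (rule hook_lattice[of \<Theta> _ n])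
    show "\<Theta> (\<lambda>T. f T + g T) = \<Theta> f + \<Theta> g" for f g
      by (auto simp: \<Theta>_def fun_eq_iff sum.distrib distrib_left)
    show "\<Theta> (\<lambda>T. a * f T) = scale (of_int a) (\<Theta> f)" for a f
      by (auto simp: \<Theta>_def fun_eq_iff sum_distrib_left mult_ac)
    show "inj_on \<Theta> (carrier (specht_Z l))"
    proof (rule inj_onI)
      fix f g assume fg: "f \<in> carrier (specht_Z l)" "g \<in> carrier (specht_Z l)" "\<Theta> f = \<Theta> g"
      obtain D E where DE: "?D D f" "?D E g" using D[OF fg(1)] D[OF fg(2)] by blast
      show "f = g"
      proof
        fix T
        show "f T = g T"
        proof (cases "T \<in> tabloids l")
          case True
          then obtain s where s: "s \<in> tableaux l" "T = tabloid l s" by (auto simp: tabloids_def)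
          have "of_nat n * tri_sum D (s (0, 0)) (s (0, 1)) (s (0, 2))
              = of_nat n * tri_sum E (s (0, 0)) (s (0, 1)) (s (0, 2))"
            unfolding \<Theta>_tri[OF DE(1) TV[OF s(1)], symmetric] \<Theta>_tri[OF DE(2) TV[OF s(1)], symmetric] fg(3) ..
          then have "tri_sum D (s (0, 0)) (s (0, 1)) (s (0, 2)) = tri_sum E (s (0, 0)) (s (0, 1)) (s (0, 2))"
            using n_ge by simp
          then have "(of_int (eps s * f T) :: rat) = of_int (eps s * g T)"
            using DE s by simp
          then have "eps s * f T = eps s * g T" by (simp only: of_int_eq_iff)
          then have "eps s * (eps s * f T) = eps s * (eps s * g T)" by simp
          then show ?thesis unfolding mult.assoc[symmetric] eps2 by simp
        qed (use fg(1,2) in \<open>simp add: specht_off_tabloids\<close>)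
      qed
    qed
    show "\<Theta> f \<in> W" if f: "f \<in> carrier (specht_Z l)" for f
    proof -
      obtain c where c: "f = (\<lambda>T. \<Sum>t\<in>tableaux l. c t * polytabloid l t T)"
        using f by (rule specht_Z_E)
      have "\<Theta> f = (\<Sum>t\<in>tableaux l. scale (of_int (c t)) (\<Theta> (polytabloid l t)))"
      proof (rule ext, clarify)
        fix a b
        show "\<Theta> f (a, b) = (\<Sum>t\<in>tableaux l. scale (of_int (c t)) (\<Theta> (polytabloid l t))) (a, b)"
        proof (cases "a \<in> V \<and> b \<in> V \<and> a \<noteq> b")
          case True
          have "\<Theta> f (a, b) = (\<Sum>c'\<in>V - {a, b}. \<Sum>t\<in>tableaux l.
              of_int (c t) * of_int (eps (tb a b c') * polytabloid l t (tabloid l (tb a b c'))))"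
            using True by (simp add: \<Theta>_def c sum_distrib_left mult_ac)
          also have "\<dots> = (\<Sum>t\<in>tableaux l. of_int (c t) * \<Theta> (polytabloid l t) (a, b))"
            using True by (subst sum.swap) (simp add: \<Theta>_def sum_distrib_left)
          finally show ?thesis by (simp add: sum_fun_apply)
        qed (auto simp: \<Theta>_def sum_fun_apply)
      qed
      also have "\<dots> \<in> W"
        by (intro zsubmodule_sum W_zsubmodule W_scale) (use TV in \<open>simp add: \<Theta>_poly W_scale L0_W fan_in_L0 del: scale_apply\<close>)
      finally show ?thesis .
    qed
    show "\<Theta> (\<lambda>T. f ((\<lambda>t. inv_into UNIV p \<circ> t) ` T)) = twisted sign p (\<Theta> f)"
      if p: "p permutes V" and f: "f \<in> carrier (specht_Z l)" for p f
    proof -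
      let ?q = "inv_into UNIV p" and ?f = "\<lambda>T. f ((\<lambda>t. inv_into UNIV p \<circ> t) ` T)"
      have q: "?q permutes V" using p by (rule permutes_inv)
      obtain D where D: "?D D f" using D[OF f] by blast
      let ?E = "scale (of_int (sign p)) (pull ?q D)"
      have E: "?D ?E ?f"
      proof (intro conjI allI ballI)
        fix a b
        have "D (?q b, ?q a) = - D (?q a, ?q b)" using D by blast
        then show "?E (b, a) = - ?E (a, b)" by simp
      next
        fix s assume s: "s \<in> tableaux l"
        have qs: "?q \<circ> s \<in> tableaux l" by (rule tableau_compose[OF s q])
        \<comment> \<open>The relative sign of the tableaux \<open>s\<close> and
          \<open>?q \<circ> s\<close> is the source of the twist by \<open>sign\<close>.\<close>
        have "eps s = sign p * eps (?q \<circ> s)"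
          using eps[OF qs p] inv_compose_cancel(1)[OF p, of s] by simp
        then have "of_int (eps s * ?f (tabloid l s)) = of_int (sign p) * (of_int (eps (?q \<circ> s) * f (tabloid l (?q \<circ> s))) :: rat)"
          by (simp add: tabloid_act[OF q])
        also have "\<dots> = of_int (sign p) * tri_sum D (?q (s (0, 0))) (?q (s (0, 1))) (?q (s (0, 2)))"
          using D qs by simp
        finally show "of_int (eps s * ?f (tabloid l s)) = tri_sum ?E (s (0, 0)) (s (0, 1)) (s (0, 2))"
          by (simp only: tri_sum_linear)
      qed
      show ?thesis
      proof (rule ext, clarify)
        fix a b
        have "(\<Sum>c\<in>V. tri_sum ?E a b c) = of_int (sign p) * (\<Sum>c\<in>V. tri_sum D (?q a) (?q b) (?q c))"
          by (simp only: tri_sum_linear sum_distrib_left)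
        also have "(\<Sum>c\<in>V. tri_sum D (?q a) (?q b) (?q c)) = (\<Sum>c\<in>V. tri_sum D (?q a) (?q b) c)"
          by (rule sum.reindex_bij_betw[OF permutes_imp_bij[OF q]])
        finally show "\<Theta> ?f (a, b) = twisted sign p (\<Theta> f) (a, b)"
          by (simp add: \<Theta>_eq[OF E] \<Theta>_eq[OF D] twisted_def permutes_V[OF q])
      qed
    qed
    show "n > 0" using n_ge by simp
    fix K a b c
    assume K: "zsubmodule K" "\<And>t. t \<in> tableaux l \<Longrightarrow> \<Theta> (polytabloid l t) \<in> K"
      and abc: "distinct [a, b, c]" "{a, b, c} \<subseteq> V"
    have fan: "fan x y \<in> K" if "distinct [x, y, z]" "{x, y, z} \<subseteq> V" for x y z
    proof -
      have t: "tb x y z \<in> tableaux l" "tb x y z (0, 1) = x" "tb x y z (0, 2) = y" using tb[OF that] by auto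
      have "scale (of_int (eps (tb x y z))) (\<Theta> (polytabloid l (tb x y z))) \<in> K"
        by (intro zsubmodule_scale_int K t)
      also have "scale (of_int (eps (tb x y z))) (\<Theta> (polytabloid l (tb x y z)))
          = scale (of_int (eps (tb x y z) * eps (tb x y z))) (fan x y)"
        unfolding \<Theta>_poly[OF t(1)] t(2,3) by (simp only: scale_simps of_int_mult)
      finally show ?thesis by (simp only: eps2) simp
    qed
    have "fan a b + fan b c + fan c a \<in> K"
      by (intro zsubmodule_add K(1) fan[of a b c] fan[of b c a] fan[of c a b]) (use abc in auto)
    then show "scale (of_nat n) (tri a b c) \<in> K" by (simp only: fan_cycle)
  qed
qed

end

text \<open>As \<open>\<chi>\<close> takes only the values 1 and -1, a subgroup is invariant under
  the twisted action exactly if it is invariant under \<open>pull\<close>, and the equivariant maps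
  are the same. So the count does not depend on \<open>\<chi>\<close>.\<close>

lemma (in flows) card_Z_form_classes_twisted:
  fixes S :: "(int, 's, nat \<Rightarrow> nat) gmodule"
  assumes \<chi>: "\<And>p. \<chi> p * \<chi> p = (1::int)" "\<chi> id = 1"
      "\<And>p q. p permutes V \<Longrightarrow> q permutes V \<Longrightarrow> \<chi> (p \<circ> q) = \<chi> p * \<chi> q"
    and S: "group_ring_module (sym_group n) \<Z> S"
      "group_ring_isomorphic (sym_group n) \<Z> S (int_vectors (twisted \<chi>) LS)" "rational_span LS = W"
  shows "card (Z_form_classes (sym_group n) (rational_tensor S) :: (int, 'm::infinite, nat \<Rightarrow> nat) gmodule set set)
    = card Lattices"
proof (rule card_Z_form_classes[OF S, where ?K0.0 = L0])
  have carrier: "p \<in> carrier (sym_group n) \<longleftrightarrow> p permutes V" for p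
    by (simp add: sym_group_carrier V_def)
  show "twisted \<chi> p (x + y) = twisted \<chi> p x + twisted \<chi> p y" for p x y
    by (simp only: twisted_def pull_linear scale_distrib)
  show "twisted \<chi> p (scale c x) = scale c (twisted \<chi> p x)" for p c x
    by (simp only: twisted_def pull_linear scale_simps mult.commute)
  show "twisted \<chi> \<one>\<^bsub>sym_group n\<^esub> x = x" for x
    by (simp add: twisted_def sym_group_one \<chi>(2) del: scale_apply)
  show "twisted \<chi> (p \<otimes>\<^bsub>sym_group n\<^esub> q) x = twisted \<chi> p (twisted \<chi> q x)"
    if "p \<in> carrier (sym_group n)" "q \<in> carrier (sym_group n)" for p q x
  proof -
    have pq: "p permutes V" "q permutes V" using that by (simp_all add: carrier)
    have "inv_into UNIV (p \<circ> q) = inv_into UNIV q \<circ> inv_into UNIV p"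
      using permutes_bij[OF pq(1)] permutes_bij[OF pq(2)] by (rule o_inv_distrib)
    then show ?thesis
      by (simp only: sym_group_mult twisted_def pull_linear pull_simps scale_simps \<chi>(3)[OF pq] of_int_mult)
  qed
  show "zsubmodule L0" by (rule L0_zsubmodule)
  show span_L0: "rational_span L0 = W"
    by (rule rational_span_W[of L0 1]) (auto simp: L0_W)
  have inv: "twisted \<chi> p x \<in> L" if "zsubmodule L" "invariant L" "p permutes V" "x \<in> L" for L p x
    unfolding twisted_def using that
    by (intro zsubmodule_scale_int) (auto intro: invariantD permutes_inv)
  show "zsubmodule L" "\<And>p x. p \<in> carrier (sym_group n) \<Longrightarrow> x \<in> L \<Longrightarrow> twisted \<chi> p x \<in> L"
    "rational_span L = W" "\<exists>B. int_basis B L" if L: "L \<in> Lattices" for L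
  proof -
    note L' = LatticesD[OF L]
    show "zsubmodule L" by (rule L'(1))
    show "twisted \<chi> p x \<in> L" if "p \<in> carrier (sym_group n)" "x \<in> L" for p x
      using that inv[OF L'(1,2)] by (simp add: carrier)
    show "rational_span L = W"
    proof (rule rational_span_W[of L 2])
      show "scale (of_nat 2) z \<in> L" if "z \<in> L0" for z
        using double_L0_M1[OF that] L'(3) by auto
    qed (use L'(4) Mst_W in auto)
    show "\<exists>B. int_basis B L"
    proof (rule exists_int_basis[of "V \<times> V" L "2 * n"])
      fix x i assume x: "x \<in> L"
      then have Mst: "x \<in> Mst" using L'(4) by blast
      show "x i = 0" if "i \<notin> V \<times> V"
        using that W_out[OF Mst_W[OF Mst]] W_out'[OF Mst_W[OF Mst]] by (cases i) auto
      show "of_nat (2 * n) * x i \<in> \<int>"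
        using Mst_multiple[OF Mst] by (cases i) (auto simp: L0_def)
    qed (use L'(1) n_ge in auto)
  qed
  have untwist: "pull p x = scale (of_int (\<chi> (inv_into UNIV p))) (twisted \<chi> (inv_into UNIV p) x)"
    if p: "p permutes V" for p x
  proof -
    have "scale (of_int (\<chi> (inv_into UNIV p))) (twisted \<chi> (inv_into UNIV p) x)
        = scale (of_int (\<chi> (inv_into UNIV p) * \<chi> (inv_into UNIV p))) (pull p x)"
      unfolding twisted_def permutes_inv_inv[OF p] by (simp only: scale_simps of_int_mult)
    then show ?thesis by (simp only: \<chi>(1) of_int_1 scale_simps)
  qed
  show "\<exists>c. c \<noteq> 0 \<and> scale c ` L \<in> Lattices"
    if L: "zsubmodule L" "\<And>p x. p \<in> carrier (sym_group n) \<Longrightarrow> x \<in> L \<Longrightarrow> twisted \<chi> p x \<in> L"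
      "rational_span L = W" "\<exists>N::nat. N > 0 \<and> (\<forall>x\<in>L. scale (of_nat N) x \<in> L0)" for L
  proof -
    have inv: "invariant L"
      unfolding invariant_def
    proof (intro allI impI)
      fix p x assume p: "p permutes V" and x: "x \<in> L"
      show "pull p x \<in> L"
        unfolding untwist[OF p]
        by (intro zsubmodule_scale_int L(1) L(2) x) (simp add: carrier permutes_inv[OF p])
    qed
    have LW: "L \<subseteq> W" using subset_rational_span[of L] L(3) by simp
    obtain x where x: "x \<in> L" "x \<noteq> 0"
    proof -
      let ?t = "tri 1 2 3 :: nat \<times> nat \<Rightarrow> rat"
      have "?t \<in> rational_span L" unfolding L(3) by (rule tri_in_W) simp
      then obtain N :: nat where N: "N > 0" "scale (of_nat N) ?t \<in> L" unfolding rational_span_def by blast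
      have "scale (of_nat N) ?t (1, 2) \<noteq> 0" using N(1) by (simp add: tri_def arc_def)
      then have "scale (of_nat N) ?t \<noteq> 0" by (metis zero_fun_apply)
      with N(2) show ?thesis by (rule that)
    qed
    obtain N :: nat where N: "N > 0" "\<And>y. y \<in> L \<Longrightarrow> scale (of_nat N) y \<in> L0" using L(4) by blast
    obtain c where "c \<noteq> 0" "scale c ` L \<in> Lattices"
      by (rule normalize_lattice[OF L(1) inv LW x N])
    then show ?thesis by blast
  qed
  show "L = K" if LK: "L \<in> Lattices" "K \<in> Lattices"
    and iso: "group_ring_isomorphic (sym_group n) \<Z> (int_vectors (twisted \<chi>) L) (int_vectors (twisted \<chi>) K)" for L K
  proof -
    note L' = LatticesD[OF LK(1)]
    obtain \<phi> where \<phi>: "int_embedding (int_vectors (twisted \<chi>) L) \<phi>" "\<phi> ` carrier (int_vectors (twisted \<chi>) L) = K"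
      "\<And>p x. p \<in> carrier (sym_group n) \<Longrightarrow> x \<in> carrier (int_vectors (twisted \<chi>) L) \<Longrightarrow>
        \<phi> (act (int_vectors (twisted \<chi>) L) p x) = twisted \<chi> p (\<phi> x)"
      by (rule int_vectors_isoE[OF iso]) (rule that)
    have add: "\<phi> (x + y) = \<phi> x + \<phi> y" if "x \<in> L" "y \<in> L" for x y
      using \<phi>(1) that by (simp add: int_embedding_def int_vectors_def)
    have smult: "\<phi> (scale (of_int a) x) = scale (of_int a) (\<phi> x)" if "x \<in> L" for a x
      using \<phi>(1) that by (simp add: int_embedding_def int_vectors_def)
    have act: "\<phi> (twisted \<chi> p x) = twisted \<chi> p (\<phi> x)" if "p permutes V" "x \<in> L" for p x
      using \<phi>(3)[of p x] that by (simp add: int_vectors_def carrier)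
    have "\<phi> ` L = K" using \<phi>(2) by (simp add: int_vectors_def)
    then show ?thesis
    proof (rule isomorphic_lattices_eq[OF LK _ add])
      fix p x assume p: "p permutes V" and x: "x \<in> L"
      have q: "inv_into UNIV p permutes V" using p by (rule permutes_inv)
      have "\<phi> (pull p x) = scale (of_int (\<chi> (inv_into UNIV p))) (\<phi> (twisted \<chi> (inv_into UNIV p) x))"
        unfolding untwist[OF p] by (intro smult inv[OF L'(1,2) q x])
      also have "\<dots> = pull p (\<phi> x)" unfolding act[OF q x] untwist[OF p] ..
      finally show "\<phi> (pull p x) = pull p (\<phi> x)" .
    qed
  qed
qed

theorem corollary1p2:
  fixes n k j d :: nat
  assumes "n \<ge> 4" and "n mod 4 \<noteq> 0"
    and "k \<in> {2, n - 3}"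
    and "j = card (Z_form_classes (sym_group n) (specht_Q (hook_partition n k))
                     :: (int, 'm::infinite, nat \<Rightarrow> nat) gmodule set set)"
    and "d = card {m::nat. m > 0 \<and> m dvd n}"
  shows "(n \<ge> 5 \<and> odd n \<longrightarrow> j = 3 * d) \<and> (n mod 4 = 2 \<longrightarrow> j = 2 * d)"
proof -
  have n5: "n \<ge> 5" using assms(1,2) by (cases "n = 4") auto
  interpret hook n k by unfold_locales (use n5 assms(3) in auto)
  have "j = card Lattices"
  \<comment> \<open>For \<open>n = 5\<close> the two values of \<open>k\<close> coincide, and the
    first case applies.\<close>
  proof (cases "k = 2")
    case True
    then obtain L where L: "group_ring_isomorphic (sym_group n) \<Z> (specht_Z l) (int_vectors (twisted (\<lambda>_. 1)) L)"
      "rational_span L = W"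
      using specht_leg_two by blast
    show ?thesis
      unfolding assms(4) l_def[symmetric]
      by (rule card_Z_form_classes_twisted[OF _ _ _ specht_module L]) simp_all
  next
    case False
    then have "k = n - 3" using assms(3) by simp
    then obtain L where L: "group_ring_isomorphic (sym_group n) \<Z> (specht_Z l) (int_vectors (twisted sign) L)"
      "rational_span L = W"
      using specht_arm_two by blast
    have perm: "permutation p" if "p permutes V" for p using that permutation_permutes finite_V by blast
    show ?thesis
      unfolding assms(4) l_def[symmetric]
      by (rule card_Z_form_classes_twisted[OF _ _ _ specht_module L])
        (simp_all add: sign_idempotent sign_id sign_compose perm)
  qed
  then show ?thesis using card_Lattices_odd card_Lattices_even by (simp add: assms(5))
qed

end
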